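(* Let $\Omega=\mathbb{T}_{2L\pi}\times[-1,1]$, $\Phi\ge0$, and consider the steady Navier–Stokes problem without external force $$\boldsymbol{u}\cdot\nabla\boldsymbol{u}+\nabla p=\Delta\boldsymbol{u},\quad \mathrm{div}\,\boldsymbol{u}=0\ \text{ in }\Omega,\qquad \boldsymbol{u}=0\ \text{ at }y=\pm1,\qquad \int_{-1}^1u_1(x,y)\,dy=\Phi. \quad (\mathrm{NS}_0)$$ (a) There exist constants $\varepsilon_1>0$ and $L_0>0$ such that for all $L\le L_0$, if $\boldsymbol{u}$ is a (periodic) solution of $(\mathrm{NS}_0)$ in $\Omega$ satisfying $\|u_2\|_{H^1(\Omega)}\le\varepsilon_1$, then $\boldsymbol{u}\equiv\boldsymbol{U}$. (b) There exist constants $L_0>0$ and $\Phi_0>0$ such that for all $L\le L_0$ and $\Phi\ge\Phi_0$, if $\boldsymbol{u}$ is a periodic solution of $(\mathrm{NS}_0)$ satisfying $\|u_2\|_{H^1(\Omega)}\le\Phi^{1/60}$, then $\boldsymbol{u}\equiv\boldsymbol{U}$. Here $\boldsymbol{U}=U(y)\boldsymbol{e}_1$ with $U(y)=\frac34\Phi(1-y^2)$ is the Poiseuille flow.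
   Context: $\Omega=\mathbb{T}_{2L\pi}\times[-1,1]$ is the strip periodic in $x$ with period $2L\pi$, $L>0$. $\boldsymbol{u}=(u_1,u_2)$. The velocity and the pressure gradient $\nabla p$ (not necessarily $p$ itself) are periodic in $x$ with period $2L\pi$. The constants $\varepsilon_1$ and $L_0$ in (a) are independent of the flux $\Phi$. *)

theory Defs
  imports "HOL-Analysis.Analysis"
begin

text \<open>
  Functions on the periodic strip are represented by functions on the plane whose restriction to
  the strip is periodic in the first variable with period \<open>2 * L * pi\<close>; their values outside the
  closed strip play no role.
\<close>

definition strip :: "(real \<times> real) set" where
  "strip = UNIV \<times> {-1<..<1}"

definition closed_strip :: "(real \<times> real) set" where
  "closed_strip = UNIV \<times> {-1..1}"

definition period_cell :: "real \<Rightarrow> (real \<times> real) set" where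
  "period_cell L = {0<..<2 * L * pi} \<times> {-1<..<1}"

definition x_periodic_on :: "(real \<times> real) set \<Rightarrow> real \<Rightarrow> (real \<times> real \<Rightarrow> real) \<Rightarrow> bool" where
  "x_periodic_on S T f \<longleftrightarrow> (\<forall>x y. (x, y) \<in> S \<longrightarrow> f (x + T, y) = f (x, y))"

definition pdx :: "(real \<times> real \<Rightarrow> real) \<Rightarrow> real \<times> real \<Rightarrow> real" where
  "pdx f z = deriv (\<lambda>s. f (s, snd z)) (fst z)"

definition pdy :: "(real \<times> real \<Rightarrow> real) \<Rightarrow> real \<times> real \<Rightarrow> real" where
  "pdy f z = deriv (\<lambda>s. f (fst z, s)) (snd z)"

definition laplacian :: "(real \<times> real \<Rightarrow> real) \<Rightarrow> real \<times> real \<Rightarrow> real" where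
  "laplacian f z = pdx (pdx f) z + pdy (pdy f) z"

definition C1_on :: "(real \<times> real) set \<Rightarrow> (real \<times> real \<Rightarrow> real) \<Rightarrow> bool" where
  "C1_on S f \<longleftrightarrow> f differentiable_on S \<and> continuous_on S (pdx f) \<and> continuous_on S (pdy f)"

definition C2_on :: "(real \<times> real) set \<Rightarrow> (real \<times> real \<Rightarrow> real) \<Rightarrow> bool" where
  "C2_on S f \<longleftrightarrow> C1_on S f \<and> C1_on S (pdx f) \<and> C1_on S (pdy f)"

text \<open>
  Classical solutions: the equations hold pointwise in the open strip and the velocity attains its
  boundary values continuously.  No regularity of derivatives up to the boundary is required, and
  only the gradient of the pressure is periodic.
\<close>

definition NS0_solution ::
  "real \<Rightarrow> real \<Rightarrow> (real \<times> real \<Rightarrow> real) \<Rightarrow> (real \<times> real \<Rightarrow> real) \<Rightarrow> (real \<times> real \<Rightarrow> real) \<Rightarrow> bool"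
where
  "NS0_solution L \<Phi> u1 u2 p \<longleftrightarrow>
     C2_on strip u1 \<and> C2_on strip u2 \<and> C1_on strip p \<and>
     continuous_on closed_strip u1 \<and> continuous_on closed_strip u2 \<and>
     x_periodic_on closed_strip (2 * L * pi) u1 \<and> x_periodic_on closed_strip (2 * L * pi) u2 \<and>
     x_periodic_on strip (2 * L * pi) (pdx p) \<and> x_periodic_on strip (2 * L * pi) (pdy p) \<and>
     (\<forall>z\<in>strip. u1 z * pdx u1 z + u2 z * pdy u1 z + pdx p z = laplacian u1 z) \<and>
     (\<forall>z\<in>strip. u1 z * pdx u2 z + u2 z * pdy u2 z + pdy p z = laplacian u2 z) \<and>
     (\<forall>z\<in>strip. pdx u1 z + pdy u2 z = 0) \<and>
     (\<forall>x. u1 (x, -1) = 0 \<and> u1 (x, 1) = 0 \<and> u2 (x, -1) = 0 \<and> u2 (x, 1) = 0) \<and>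
     (\<forall>x. integral {-1..1} (\<lambda>y. u1 (x, y)) = \<Phi>)"

text \<open>
  The Sobolev space and its norm are only used for functions that are continuously differentiable
  in the open strip, where the weak and the classical gradient agree.  Membership is a separate
  predicate because the Lebesgue integral of a non-integrable function is 0.
\<close>

definition H1_density :: "(real \<times> real \<Rightarrow> real) \<Rightarrow> real \<times> real \<Rightarrow> real" where
  "H1_density f z = (f z)\<^sup>2 + (pdx f z)\<^sup>2 + (pdy f z)\<^sup>2"

definition in_H1 :: "real \<Rightarrow> (real \<times> real \<Rightarrow> real) \<Rightarrow> bool" where
  "in_H1 L f \<longleftrightarrow> C1_on strip f \<and> x_periodic_on strip (2 * L * pi) f \<and>
     set_integrable lborel (period_cell L) (H1_density f)"

definition H1_norm :: "real \<Rightarrow> (real \<times> real \<Rightarrow> real) \<Rightarrow> real" where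
  "H1_norm L f = sqrt (set_lebesgue_integral lborel (period_cell L) (H1_density f))"

definition poiseuille :: "real \<Rightarrow> real \<Rightarrow> real" where
  "poiseuille \<Phi> y = 3 / 4 * \<Phi> * (1 - y\<^sup>2)"

definition is_poiseuille_flow ::
  "real \<Rightarrow> (real \<times> real \<Rightarrow> real) \<Rightarrow> (real \<times> real \<Rightarrow> real) \<Rightarrow> bool" where
  "is_poiseuille_flow \<Phi> u1 u2 \<longleftrightarrow>
     (\<forall>z\<in>closed_strip. u1 z = poiseuille \<Phi> (snd z) \<and> u2 z = 0)"

end

theory Submission imports Defs begin

text \<open>
  Write \<open>u = U + v\<close> and \<open>X = \<partial>\<^sub>x v\<close>, so that \<open>|X|\<close> is controlled by the \<open>H\<^sup>1\<close> norm of \<open>u2\<close> through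
  incompressibility.  Testing the momentum equation with \<open>v\<close> bounds the dissipation \<open>D\<close> of \<open>v\<close> by
  \<open>\<Phi>\<close> times the pairing of \<open>v1\<close> and \<open>u2\<close>; as \<open>u2\<close> has mean zero in \<open>x\<close>, this already gives \<open>v = 0\<close>
  when \<open>\<Phi> * L\<^sup>2\<close> is small.  Testing with \<open>\<partial>\<^sub>x u\<close> cancels viscosity and pressure, and the concavity of \<open>U\<close>
  leaves \<open>\<Phi> * W\<close> on the left, \<open>W\<close> being the integral of \<open>(1 - y\<^sup>2) * |X|\<^sup>2\<close>, against the cubic term
  \<open>\<integral> (v \<cdot> \<nabla> v) \<cdot> X\<close>.  Interpolating between \<open>W\<close> and bounds that degenerate at the walls gives
  \<open>D \<lesssim> \<Phi>\<^bsup>6/5\<^esup> * W\<close> and, for the energy of \<open>X\<close>, \<open>\<lesssim> \<Phi>\<^bsup>3/2\<^esup> * W\<close>; the cubic term is then at most a multiple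
  of \<open>\<Phi>\<^bsup>119/120\<^esup> * W\<close>, which is impossible for large \<open>\<Phi>\<close> unless \<open>W = 0\<close>.

  No regularity up to the walls is given.  Averaging three times in \<open>x\<close> makes the pressure and the normal
  derivative bounded up to the walls, because the equations express normal derivatives by tangential
  ones; the averaging parameter is removed by Fatou's lemma and dominated convergence.
\<close>

section \<open>One-dimensional estimates\<close>

text \<open>The weight in W vanishes at the walls, since U does, so W alone bounds no unweighted
  integral. The missing information is always a bound f <= (1 - |y|) * k, and the interpolation
  costs W / delta + 2 * delta^2 * k for a free delta. Balancing this against the factor Phi fixes
  the exponents: delta of order Phi^(-1/2) for the energy of X gives 3/2; delta of order Phi^(-2/5)
  with a Young weight of order Phi^(-1/5) for D gives 6/5. Let E be the integral of |X|^2, so that W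
  <= E. The leading part of the cubic term is of the order of the square root of Phi^(3/4) * E * W *
  D; if the norm of \<open>u2\<close> is at most Phi^a, then E <= Phi^(2 * a) and this becomes
  Phi^(39/40 + a) * W. Thus a < 1/40 is the natural limit of the argument, and a = 1/60 leaves the
  margin Phi^(-1/120). The period enters only through an upper bound for T: the 1/T in the maximum
  of v1 on a line is cancelled by a factor T in the bound for D.\<close>

lemma Ioo_integrableI_bounded:
  fixes f :: "real \<Rightarrow> real"
  assumes "continuous_on {a<..<b} f" "g integrable_on {a<..<b}" "\<And>y. y \<in> {a<..<b} \<Longrightarrow> \<bar>f y\<bar> \<le> g y"
  shows "f integrable_on {a<..<b}"
proof -
  have "f \<in> borel_measurable (lebesgue_on {a<..<b})"
    by (rule continuous_imp_measurable_on_sets_lebesgue[OF assms(1)]) auto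
  then show ?thesis
    by (rule measurable_bounded_by_integrable_imp_integrable) (use assms in auto)
qed

lemma integrable_const_Ioo: "(\<lambda>y::real. c::real) integrable_on {a<..<b}"
  using integrable_const_ivl[of c a b] by (simp only: integrable_on_open_interval_real)

lemma integral_abs_bound_Ioo:
  fixes f :: "real \<Rightarrow> real"
  assumes "f integrable_on S" "g integrable_on S" "\<And>y. y \<in> S \<Longrightarrow> \<bar>f y\<bar> \<le> g y"
  shows "\<bar>integral S f\<bar> \<le> integral S g"
  using integral_norm_bound_integral[OF assms(1,2)] assms(3) by auto

text \<open>The upper bounds \<open>K n\<close> may vary, because the averaged problems have
  right-hand sides that converge along with the integrands. Passing through the nonnegative Lebesgue
  integral yields the integrability of the limit together with the bound.\<close>

lemma fatou_Ioo:
  fixes f :: "nat \<Rightarrow> real \<Rightarrow> real"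
  assumes int: "\<And>n. f n integrable_on {a<..<b}" and nn: "\<And>n y. y \<in> {a<..<b} \<Longrightarrow> 0 \<le> f n y"
    and lim: "\<And>y. y \<in> {a<..<b} \<Longrightarrow> (\<lambda>n. f n y) \<longlonglongrightarrow> g y"
    and le: "\<And>n. integral {a<..<b} (f n) \<le> K n" and K: "K \<longlonglongrightarrow> K0"
  shows "g integrable_on {a<..<b}" "integral {a<..<b} g \<le> K0"
proof -
  let ?I = "{a<..<b}"
  let ?M = "lebesgue_on ?I"
  have meas: "f n \<in> borel_measurable ?M" for n
    using int[of n] integrable_imp_measurable by blast
  have gm: "g \<in> borel_measurable ?M"
    by (rule borel_measurable_LIMSEQ_metric[where f=f]) (use meas lim in auto)
  have g0: "0 \<le> g y" if "y \<in> ?I" for y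
    using lim[OF that] nn[OF that] LIMSEQ_le_const by blast
  have fn: "(\<integral>\<^sup>+ y. ennreal (f n y) \<partial>?M) = ennreal (integral ?I (f n))" for n
  proof -
    have ab: "f n absolutely_integrable_on ?I"
      using nonnegative_absolutely_integrable_1[OF int] nn by blast
    then have i: "integrable ?M (f n)"
      using integrable_restrict_space[of ?I lebesgue "f n"] by (simp add: set_integrable_def)
    have "(\<integral>\<^sup>+ y. ennreal (f n y) \<partial>?M) = ennreal (integral\<^sup>L ?M (f n))"
      by (rule nn_integral_eq_integral[OF i]) (use nn in \<open>auto intro!: AE_I2\<close>)
    also have "integral\<^sup>L ?M (f n) = integral ?I (f n)"
      using lebesgue_integral_eq_integral[OF i] by simp
    finally show ?thesis .
  qed
  have "(\<integral>\<^sup>+ y. ennreal (g y) \<partial>?M) = (\<integral>\<^sup>+ y. liminf (\<lambda>n. ennreal (f n y)) \<partial>?M)"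
  proof (rule nn_integral_cong)
    fix y assume "y \<in> space ?M"
    then have y: "y \<in> ?I" by simp
    have "(\<lambda>n. ennreal (f n y)) \<longlonglongrightarrow> ennreal (g y)"
      using lim[OF y] by (rule tendsto_ennrealI)
    then show "ennreal (g y) = liminf (\<lambda>n. ennreal (f n y))"
      using lim_imp_Liminf[OF trivial_limit_sequentially] by metis
  qed
  also have "\<dots> \<le> liminf (\<lambda>n. \<integral>\<^sup>+ y. ennreal (f n y) \<partial>?M)"
    by (rule nn_integral_liminf) (use meas in auto)
  also have "\<dots> \<le> liminf (\<lambda>n. ennreal (K n))"
    by (rule Liminf_mono) (use fn le in \<open>auto intro!: always_eventually ennreal_leI\<close>)
  also have "\<dots> = ennreal K0"
    using lim_imp_Liminf[OF trivial_limit_sequentially] tendsto_ennrealI[OF K] by metis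
  finally have fin: "(\<integral>\<^sup>+ y. ennreal (g y) \<partial>?M) \<le> ennreal K0" .
  have K0: "0 \<le> K0"
  proof (rule LIMSEQ_le_const[OF K], intro exI allI impI)
    fix n show "0 \<le> K n" using le[of n] integral_nonneg[OF int[of n]] nn by force
  qed
  have gi: "integrable ?M g"
  proof (rule integrableI_nonneg[OF gm])
    show "AE y in ?M. 0 \<le> g y" using g0 by (auto intro!: AE_I2)
    show "(\<integral>\<^sup>+ y. ennreal (g y) \<partial>?M) < \<infinity>" using fin by (simp add: le_less_trans)
  qed
  have eq: "integral\<^sup>L ?M g = integral ?I g" "g integrable_on ?I"
    using lebesgue_integral_eq_integral[OF gi] integrable_on_lebesgue_on[OF gi] by auto
  show "g integrable_on ?I" by (fact eq)
  have "ennreal (integral ?I g) = (\<integral>\<^sup>+ y. ennreal (g y) \<partial>?M)"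
    unfolding eq(1)[symmetric] by (rule nn_integral_eq_integral[OF gi, symmetric]) (use g0 in \<open>auto intro!: AE_I2\<close>)
  with fin have "ennreal (integral ?I g) \<le> ennreal K0" by simp
  then show "integral ?I g \<le> K0" using K0 by simp
qed

text \<open>Domination by \<open>g\<close> lets \<open>F\<close> be extended continuously by 0 to
  the end points. The fundamental theorem for the Henstock-Kurzweil integral then applies although
  nothing is known about the integrability of \<open>f\<close> near them.\<close>

lemma ftc_vanishing_ends:
  fixes F f g :: "real \<Rightarrow> real"
  assumes der: "\<And>y. y \<in> {-1<..<1} \<Longrightarrow> (F has_real_derivative f y) (at y)"
    and bd: "\<And>y. y \<in> {-1<..<1} \<Longrightarrow> \<bar>F y\<bar> \<le> C * g y"
    and g: "continuous_on {-1..1} g" "g (-1) = 0" "g 1 = 0"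
  shows "(f has_integral 0) {-1<..<1}"
proof -
  define H where "H y = (if y \<in> {-1<..<1} then F y else 0)" for y
  have Hd: "(H has_real_derivative f y) (at y)" if "y \<in> {-1<..<1}" for y
  proof (rule has_field_derivative_transform_within_open[OF der[OF that]])
    show "open {-1<..<1::real}" by simp
  qed (use that in \<open>auto simp: H_def\<close>)
  have bd': "\<bar>H y\<bar> \<le> C * g y" if "y \<in> {-1..1}" for y
    using bd[of y] that g by (cases "y = -1 \<or> y = 1") (auto simp: H_def)
  have "continuous_on {-1..1} H"
    unfolding continuous_on_eq_continuous_within
  proof
    fix y :: real assume y: "y \<in> {-1..1}"
    show "continuous (at y within {-1..1}) H"
    proof (cases "y \<in> {-1<..<1}")
      case True
      then show ?thesis using Hd DERIV_isCont continuous_at_imp_continuous_at_within by blast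
    next
      case False
      then have gy: "g y = 0" "H y = 0" using y g by (auto simp: H_def)
      have "((\<lambda>y. C * g y) \<longlongrightarrow> C * g y) (at y within {-1..1})"
        using g(1) y by (auto intro!: tendsto_intros simp: continuous_on_def)
      then have "(H \<longlongrightarrow> 0) (at y within {-1..1})"
        unfolding gy mult_zero_right
        by (rule Lim_null_comparison[rotated]) (use bd' in \<open>auto simp: eventually_at_filter\<close>)
      then show ?thesis by (simp add: continuous_within gy)
    qed
  qed
  then have "(f has_integral (H 1 - H (-1))) {-1..1}"
    by (intro fundamental_theorem_of_calculus_interior)
       (use Hd in \<open>auto simp: has_real_derivative_iff_has_vector_derivative[symmetric]\<close>)
  then show ?thesis by (simp add: H_def has_integral_Icc_iff_Ioo)
qed

text \<open>Cauchy-Schwarz for square roots. The arithmetic-geometric inequality with a free weight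
  \<open>t\<close> gives the integrability and, at the optimal \<open>t\<close>, the bound; if one
  of the integrals is 0 there is no optimal weight, and \<open>t\<close> is sent to infinity or to
  0.\<close>

lemma integral_sqrt_mult_le:
  fixes f g :: "real \<Rightarrow> real"
  assumes c: "continuous_on {a<..<b} f" "continuous_on {a<..<b} g"
    and nn: "\<And>y. y \<in> {a<..<b} \<Longrightarrow> 0 \<le> f y" "\<And>y. y \<in> {a<..<b} \<Longrightarrow> 0 \<le> g y"
    and i: "f integrable_on {a<..<b}" "g integrable_on {a<..<b}"
  shows "(\<lambda>y. sqrt (f y * g y)) integrable_on {a<..<b}"
    "integral {a<..<b} (\<lambda>y. sqrt (f y * g y)) \<le> sqrt (integral {a<..<b} f * integral {a<..<b} g)"
proof -
  let ?I = "{a<..<b}"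
  have am: "sqrt (f y * g y) \<le> (t * f y + g y / t) / 2" if "y \<in> ?I" "t > 0" for y t
    using arith_geo_mean_sqrt[of "t * f y" "g y / t"] nn[OF that(1)] that(2) by simp
  show int: "(\<lambda>y. sqrt (f y * g y)) integrable_on ?I"
  proof (rule Ioo_integrableI_bounded[where g="\<lambda>y. (1 * f y + g y / 1) / 2"])
    show "\<bar>sqrt (f y * g y)\<bar> \<le> (1 * f y + g y / 1) / 2" if "y \<in> ?I" for y
      using am[OF that, of 1] nn[OF that] by simp
  qed (use c i in \<open>auto intro!: continuous_intros integrable_add\<close>)
  let ?A = "integral ?I f" and ?B = "integral ?I g"
  have A0: "0 \<le> ?A" "0 \<le> ?B" using i nn by (auto intro!: integral_nonneg)
  have le: "integral ?I (\<lambda>y. sqrt (f y * g y)) \<le> (t * ?A + ?B / t) / 2" if "t > 0" for t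
  proof -
    have "integral ?I (\<lambda>y. sqrt (f y * g y)) \<le> integral ?I (\<lambda>y. (t * f y + g y / t) / 2)"
      by (rule integral_le[OF int]) (use am that i in \<open>auto intro!: integrable_add integrable_on_divide integrable_on_mult_right\<close>)
    also have "\<dots> = (t * ?A + ?B / t) / 2"
      using i by (subst integral_divide, subst integral_add) (auto intro!: integrable_on_divide integrable_on_mult_right)
    finally show ?thesis .
  qed
  show "integral ?I (\<lambda>y. sqrt (f y * g y)) \<le> sqrt (?A * ?B)"
  proof (cases "?A = 0 \<or> ?B = 0")
    case False
    with A0 have p: "?A > 0" "?B > 0" by auto
    have "integral ?I (\<lambda>y. sqrt (f y * g y)) \<le> (sqrt (?B / ?A) * ?A + ?B / sqrt (?B / ?A)) / 2"
      by (rule le) (use p in simp)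
    also have "sqrt (?B / ?A) * ?A = sqrt (?A * ?B)"
      using p by (simp add: real_sqrt_divide real_sqrt_mult field_simps real_sqrt_mult_self)
    also have "?B / sqrt (?B / ?A) = sqrt (?A * ?B)"
      using p by (simp add: real_sqrt_divide real_sqrt_mult field_simps) 
    finally show ?thesis by simp
  next
    case True
    let ?J = "integral ?I (\<lambda>y. sqrt (f y * g y))"
    have "?J \<le> 0 + e" if "e > 0" for e
    proof -
      from True show ?thesis
      proof
        assume A: "?A = 0"
        have "?J \<le> (?B / ((?B + 1) / e)) / 2" using le[of "(?B + 1) / e"] A A0 that by simp
        also have "\<dots> \<le> e" using A0 that by (simp add: field_simps)
        finally show ?thesis by simp
      next
        assume B: "?B = 0"
        have "?J \<le> (e / (?A + 1) * ?A) / 2" using le[of "e / (?A + 1)"] B A0 that by simp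
        also have "\<dots> \<le> e" using A0 that by (simp add: field_simps)
        finally show ?thesis by simp
      qed
    qed
    then have "?J \<le> 0" by (rule field_le_epsilon)
    then show ?thesis using A0 by (smt (verit) mult_nonneg_nonneg real_sqrt_ge_zero)
  qed
qed

lemma DERIV_divide_power2:
  fixes f g :: "real \<Rightarrow> real"
  assumes "(f has_real_derivative f') (at x)" "(g has_real_derivative g') (at x)" "g x \<noteq> 0"
  shows "((\<lambda>x. f x / g x) has_real_derivative f' / g x - f x * g' / (g x)\<^sup>2) (at x)"
  by (rule DERIV_cong[OF DERIV_divide[OF assms]]) (use assms in \<open>simp add: field_simps power2_eq_square\<close>)

text \<open>The model is \<open>a\<close> = the integral of f^2 over a line and \<open>b\<close> =
  the integral of f_y^2, with \<open>quad\<close> expressing that (f + t * f_y)^2 has a nonnegative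
  integral. For t = 1 - y, \<open>quad\<close> divided by t^2 says that a / (1 - y) has derivative
  at least -b; integration up to the wall gives the estimate. The other wall is treated with t = -(1
  + y).\<close>

lemma vanishing_ends_le:
  fixes a b :: "real \<Rightarrow> real"
  assumes a: "continuous_on {-1..1} a" "a (-1) = 0" "a 1 = 0"
    and der: "\<And>y. y \<in> {-1<..<1} \<Longrightarrow> (a has_real_derivative a' y) (at y)"
    and quad: "\<And>y t. y \<in> {-1<..<1} \<Longrightarrow> 0 \<le> a y + t * a' y + t\<^sup>2 * b y"
    and b: "b integrable_on {-1<..<1}"
    and y: "y \<in> {-1<..<1}"
  shows "a y \<le> (1 - \<bar>y\<bar>) * integral {-1<..<1} b"
proof -
  let ?K = "integral {-1<..<1} b"
  have b0: "0 \<le> b z" if "z \<in> {-1<..<1}" for z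
  proof (rule ccontr)
    assume n: "\<not> 0 \<le> b z"
    \<comment> \<open>If \<open>b z\<close> were negative, the quadratic would be negative for large
      \<open>t\<close>. This value is large enough, and the added 1 makes \<open>t\<close> at least
      1.\<close>
    define t where "t = (\<bar>a z\<bar> + \<bar>a' z\<bar> + 1) / (- b z) + 1"
    have "0 \<le> (\<bar>a z\<bar> + \<bar>a' z\<bar> + 1) / (- b z)" using n by (intro divide_nonneg_nonneg) auto
    then have "t \<ge> 1" by (simp add: t_def)
    have "t * (- b z) \<ge> \<bar>a z\<bar> + \<bar>a' z\<bar> + 1"
    proof -
      have "t * (- b z) = \<bar>a z\<bar> + \<bar>a' z\<bar> + 1 - b z"
        unfolding t_def distrib_right using n by (simp add: nonzero_divide_eq_eq)
      then show ?thesis using n by simp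
    qed
    then have "t\<^sup>2 * (- b z) \<ge> t * (\<bar>a z\<bar> + \<bar>a' z\<bar> + 1)"
    proof -
      have "t * (\<bar>a z\<bar> + \<bar>a' z\<bar> + 1) \<le> t * (t * (- b z))"
        using \<open>t \<ge> 1\<close> \<open>t * (- b z) \<ge> \<bar>a z\<bar> + \<bar>a' z\<bar> + 1\<close> by (intro mult_left_mono) auto
      then show ?thesis by (simp add: power2_eq_square mult.assoc)
    qed
    moreover have "t * \<bar>a z\<bar> \<ge> 1 * \<bar>a z\<bar>" using \<open>t \<ge> 1\<close> by (intro mult_right_mono) auto
    then have "t * (\<bar>a z\<bar> + \<bar>a' z\<bar> + 1) \<ge> \<bar>a z\<bar> + t * \<bar>a' z\<bar> + 1"
      using \<open>t \<ge> 1\<close> unfolding distrib_left by linarith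
    moreover have "t * a' z \<le> t * \<bar>a' z\<bar>" using \<open>t \<ge> 1\<close> by (intro mult_left_mono) auto
    ultimately show False using quad[OF that, of t] abs_ge_self[of "a z"] unfolding mult_minus_right by linarith
  qed
  have b': "b integrable_on {-1..1}" "integral {-1..1} b = ?K"
    using b by (simp_all add: integrable_on_Icc_iff_Ioo integral_open_interval_real)
  have quad_div: "(A + p * B + p\<^sup>2 * C) / p\<^sup>2 = A / p\<^sup>2 + B / p + C" if "p \<noteq> 0" for A B C p :: real
    using that by (simp add: field_simps power2_eq_square)
  \<comment> \<open>The shift \<open>e\<close> keeps the denominator positive at the wall, so that
    the quotient is continuous there; it is removed at the end.\<close>
  have R: "a y \<le> (1 + e - y) * ?K" if e: "e > 0" for e
  proof -
    let ?H = "\<lambda>x. a x / (1 + e - x)" and ?h = "\<lambda>x. a' x / (1 + e - x) + a x / (1 + e - x)\<^sup>2"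
    have "(?h has_integral (?H 1 - ?H y)) {y..1}"
    proof (rule fundamental_theorem_of_calculus_interior)
      show "continuous_on {y..1} ?H"
        using y e by (intro continuous_on_divide continuous_on_subset[OF a(1)] continuous_intros) auto
      show "(?H has_vector_derivative ?h x) (at x)" if "x \<in> {y<..<1}" for x
        unfolding has_real_derivative_iff_has_vector_derivative[symmetric]
      proof -
        have "((\<lambda>x. 1 + e - x) has_real_derivative -1) (at x)"
          by (auto intro!: derivative_eq_intros)
        moreover have "x \<in> {-1<..<1}" "1 + e - x \<noteq> 0" using that y e by auto
        ultimately show "(?H has_real_derivative ?h x) (at x)"
          using DERIV_divide_power2[OF der[of x], of "\<lambda>x. 1 + e - x" "-1"] by simp
      qed
    qed (use y in auto)
    then have h: "(?h has_integral (- a y / (1 + e - y))) {y<..<1}"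
      using a by (simp add: has_integral_Icc_iff_Ioo)
    have bs: "b integrable_on {y..1}" using b'(1) y by (auto intro: integrable_subinterval_real)
    then have "b integrable_on {y<..<1}" by (simp only: integrable_on_Icc_iff_Ioo)
    then have "integral {y..1} b \<le> ?K" unfolding integral_open_interval_real
      using y b b0 by (intro integral_subset_le) auto
    have "(b has_integral integral {y..1} b) {y<..<1}"
      using bs by (simp add: has_integral_integral has_integral_Icc_iff_Ioo)
    then have "((\<lambda>x. - b x) has_integral (- integral {y..1} b)) {y<..<1}" by (rule has_integral_neg)
    then have "- integral {y..1} b \<le> - a y / (1 + e - y)"
    proof (rule has_integral_le[OF _ h])
      fix x assume x: "x \<in> {y<..<1}"
      then have xI: "x \<in> {-1<..<1}" and p: "1 + e - x > 0" using y e by auto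
      have "0 \<le> (a x + (1 + e - x) * a' x + (1 + e - x)\<^sup>2 * b x) / (1 + e - x)\<^sup>2"
        using quad[OF xI] by simp
      also have "\<dots> = a x / (1 + e - x)\<^sup>2 + a' x / (1 + e - x) + b x"
        using quad_div[of "1 + e - x"] p by simp
      finally show "- b x \<le> ?h x" by simp
    qed
    with \<open>integral {y..1} b \<le> ?K\<close> have "a y / (1 + e - y) \<le> ?K" by simp
    then show ?thesis using y e by (simp add: divide_le_eq mult.commute)
  qed
  have L: "a y \<le> (1 + e + y) * ?K" if e: "e > 0" for e
  proof -
    let ?H = "\<lambda>x. a x / (1 + e + x)" and ?h = "\<lambda>x. a' x / (1 + e + x) - a x / (1 + e + x)\<^sup>2"
    have "(?h has_integral (?H y - ?H (-1))) {-1..y}"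
    proof (rule fundamental_theorem_of_calculus_interior)
      show "continuous_on {-1..y} ?H"
        using y e by (intro continuous_on_divide continuous_on_subset[OF a(1)] continuous_intros) auto
      show "(?H has_vector_derivative ?h x) (at x)" if "x \<in> {-1<..<y}" for x
        unfolding has_real_derivative_iff_has_vector_derivative[symmetric]
      proof -
        have "((\<lambda>x. 1 + e + x) has_real_derivative 1) (at x)"
          by (auto intro!: derivative_eq_intros)
        moreover have "x \<in> {-1<..<1}" "1 + e + x \<noteq> 0" using that y e by auto
        ultimately show "(?H has_real_derivative ?h x) (at x)"
          using DERIV_divide_power2[OF der[of x], of "\<lambda>x. 1 + e + x" "1"] by simp
      qed
    qed (use y in auto)
    then have h: "(?h has_integral (a y / (1 + e + y))) {-1<..<y}"
      using a by (simp add: has_integral_Icc_iff_Ioo)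
    have bs: "b integrable_on {-1..y}" using b'(1) y by (auto intro: integrable_subinterval_real)
    then have "b integrable_on {-1<..<y}" by (simp only: integrable_on_Icc_iff_Ioo)
    then have "integral {-1..y} b \<le> ?K" unfolding integral_open_interval_real
      using y b b0 by (intro integral_subset_le) auto
    have "(b has_integral integral {-1..y} b) {-1<..<y}"
      using bs by (simp add: has_integral_integral has_integral_Icc_iff_Ioo)
    then have "a y / (1 + e + y) \<le> integral {-1..y} b"
    proof (rule has_integral_le[OF h])
      fix x assume x: "x \<in> {-1<..<y}"
      then have xI: "x \<in> {-1<..<1}" and p: "1 + e + x > 0" using y e by auto
      have "0 \<le> (a x + (- (1 + e + x)) * a' x + (- (1 + e + x))\<^sup>2 * b x) / (1 + e + x)\<^sup>2"
        using quad[OF xI] by simp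
      also have "\<dots> = a x / (1 + e + x)\<^sup>2 - a' x / (1 + e + x) + b x"
        unfolding power2_minus mult_minus_left
        using quad_div[of "1 + e + x" "a x" "- a' x" "b x"] p by simp
      finally show "?h x \<le> b x" by simp
    qed
    with \<open>integral {-1..y} b \<le> ?K\<close> have "a y / (1 + e + y) \<le> ?K" by simp
    then show ?thesis using y e by (simp add: divide_le_eq mult.commute)
  qed
  have K0: "0 \<le> ?K" using b b0 by (intro integral_nonneg) auto
  have lim: "a y \<le> c * ?K" if "\<And>e. e > 0 \<Longrightarrow> a y \<le> (c + e) * ?K" for c
  proof (rule field_le_epsilon)
    fix e :: real assume "e > 0"
    have "a y \<le> (c + e / (?K + 1)) * ?K" using that[of "e / (?K + 1)"] \<open>e > 0\<close> K0 by simp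
    also have "\<dots> \<le> c * ?K + e" using K0 \<open>e > 0\<close> by (simp add: field_simps)
    finally show "a y \<le> c * ?K + e" .
  qed
  show ?thesis
  proof (cases "y \<ge> 0")
    case True then show ?thesis using lim[of "1 - y"] R by (simp add: algebra_simps)
  next
    case False then show ?thesis using lim[of "1 + y"] L by (simp add: algebra_simps)
  qed
qed

text \<open>Agmon's inequality in the normal direction: integrate \<open>a'\<close> from
  \<open>y\<close> to the wall at 1 and apply Cauchy-Schwarz to the bound \<open>quad\<close>. In
  contrast to \<open>vanishing_ends_le\<close> it profits from a small integral of
  \<open>a\<close>.\<close>

lemma vanishing_ends_sup_le:
  fixes a b :: "real \<Rightarrow> real"
  assumes a: "continuous_on {-1..1} a" "a 1 = 0"
    and der: "\<And>y. y \<in> {-1<..<1} \<Longrightarrow> (a has_real_derivative a' y) (at y)"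
    and quad: "\<And>y. y \<in> {-1<..<1} \<Longrightarrow> \<bar>a' y\<bar> \<le> 2 * sqrt (a y * b y)"
    and a0: "\<And>y. y \<in> {-1<..<1} \<Longrightarrow> 0 \<le> a y" and b0: "\<And>y. y \<in> {-1<..<1} \<Longrightarrow> 0 \<le> b y"
    and bc: "continuous_on {-1<..<1} b" and b: "b integrable_on {-1<..<1}"
    and y: "y \<in> {-1<..<1}"
  shows "a y \<le> 2 * sqrt (integral {-1<..<1} a * integral {-1<..<1} b)"
proof -
  have ai: "a integrable_on {-1<..<1}"
    using integrable_continuous_real[OF a(1)] by (simp add: integrable_on_Icc_iff_Ioo)
  have ac: "continuous_on {-1<..<1} a" by (rule continuous_on_subset[OF a(1)]) auto
  note S = integral_sqrt_mult_le[OF ac bc a0 b0 ai b]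
  have "(a' has_integral (a 1 - a y)) {y..1}"
    by (rule fundamental_theorem_of_calculus_interior)
       (use y der a in \<open>auto simp: has_real_derivative_iff_has_vector_derivative[symmetric] intro: continuous_on_subset\<close>)
  then have h: "(a' has_integral (- a y)) {y<..<1}"
    using a by (simp add: has_integral_Icc_iff_Ioo)
  let ?s = "\<lambda>y. 2 * sqrt (a y * b y)"
  have si: "?s integrable_on {-1<..<1}" using S(1) by (rule integrable_on_mult_right)
  have si': "?s integrable_on {y<..<1}"
    using integrable_subinterval_real[of ?s "-1" 1 y 1] si y by (simp add: integrable_on_Icc_iff_Ioo)
  have "(\<lambda>x. - ?s x) integrable_on {y<..<1}" using si' by (rule integrable_neg)
  then have "integral {y<..<1} (\<lambda>x. - ?s x) \<le> - a y"
  proof (rule has_integral_le[OF integrable_integral h])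
    show "- ?s x \<le> a' x" if "x \<in> {y<..<1}" for x using quad[of x] that y by auto
  qed
  then have "a y \<le> integral {y<..<1} ?s" by simp
  also have "\<dots> \<le> integral {-1<..<1} ?s"
    by (rule integral_subset_le) (use si si' y a0 b0 in auto)
  also have "\<dots> \<le> 2 * sqrt (integral {-1<..<1} a * integral {-1<..<1} b)"
    using S(2) by simp
  finally show ?thesis .
qed

text \<open>Where 1 - |y| exceeds \<delta>, so does the weight, and f is at most the weighted
  function divided by \<delta>. In the two layers of width \<delta> at the walls, \<open>le\<close>
  gives at most \<delta> * K.\<close>

lemma integral_le_weighted:
  fixes f :: "real \<Rightarrow> real"
  assumes c: "continuous_on {-1<..<1} f" and f0: "\<And>y. y \<in> {-1<..<1} \<Longrightarrow> 0 \<le> f y"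
    and le: "\<And>y. y \<in> {-1<..<1} \<Longrightarrow> f y \<le> (1 - \<bar>y\<bar>) * K"
    and i: "f integrable_on {-1<..<1}" and d: "0 < \<delta>"
  shows "integral {-1<..<1} f \<le> integral {-1<..<1} (\<lambda>y. (1 - y\<^sup>2) * f y) / \<delta> + 2 * \<delta>\<^sup>2 * K"
proof -
  have K: "0 \<le> K" using le[of 0] f0[of 0] by simp
  have wi: "(\<lambda>y. (1 - y\<^sup>2) * f y) integrable_on {-1<..<1}"
  proof (rule Ioo_integrableI_bounded[OF _ i])
    show "\<bar>(1 - y\<^sup>2) * f y\<bar> \<le> f y" if "y \<in> {-1<..<1}" for y
    proof -
      have "y\<^sup>2 \<le> 1" using that by (simp add: abs_square_le_1 abs_le_iff)
      then show ?thesis using f0[OF that] by (simp add: abs_mult mult_left_le_one_le)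
    qed
  qed (use c in \<open>auto intro!: continuous_intros\<close>)
  define k where "k y = (if y \<in> {-1..-1+\<delta>} \<union> {1-\<delta>..1} then \<delta> * K else 0)" for y :: real
  \<comment> \<open>The layers are integrated over the whole line as intervals of length \<delta>,
    so that \<delta> may be any positive number: overlap or overhang only increases the right-hand
    side.\<close>
  have k1: "((\<lambda>y. if y \<in> {-1..-1+\<delta>} then \<delta> * K else 0) has_integral (\<delta> * (\<delta> * K))) UNIV"
    unfolding has_integral_restrict_UNIV
    using has_integral_const_real[of "\<delta> * K" "-1" "-1+\<delta>"] d by simp
  have k2: "((\<lambda>y. if y \<in> {1-\<delta>..1} then \<delta> * K else 0) has_integral (\<delta> * (\<delta> * K))) UNIV"
    unfolding has_integral_restrict_UNIV
    using has_integral_const_real[of "\<delta> * K" "1-\<delta>" 1] d by simp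
  have k: "((\<lambda>y. (if y \<in> {-1..-1+\<delta>} then \<delta> * K else 0) + (if y \<in> {1-\<delta>..1} then \<delta> * K else 0)) has_integral (2 * \<delta>\<^sup>2 * K)) UNIV"
    using has_integral_add[OF k1 k2] by (simp add: power2_eq_square algebra_simps)
  let ?w = "\<lambda>y. (if y \<in> {-1<..<1} then (1 - y\<^sup>2) * f y / \<delta> else 0)"
  have w: "(?w has_integral (integral {-1<..<1} (\<lambda>y. (1 - y\<^sup>2) * f y) / \<delta>)) UNIV"
    unfolding has_integral_restrict_UNIV using has_integral_divide[OF integrable_integral[OF wi], of \<delta>] by simp
  have fU: "((\<lambda>y. if y \<in> {-1<..<1} then f y else 0) has_integral (integral {-1<..<1} f)) UNIV"
    unfolding has_integral_restrict_UNIV using i by blast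
  show ?thesis
  proof (rule has_integral_le[OF fU has_integral_add[OF w k]])
    fix y :: real
    show "(if y \<in> {-1<..<1} then f y else 0) \<le> ?w y + ((if y \<in> {-1..-1+\<delta>} then \<delta> * K else 0) + (if y \<in> {1-\<delta>..1} then \<delta> * K else 0))"
    proof (cases "y \<in> {-1<..<1}")
      case True
      have s: "1 - \<bar>y\<bar> \<le> 1 - y\<^sup>2" using True mult_left_le[of "\<bar>y\<bar>" "\<bar>y\<bar>"]
        by (simp add: power2_eq_square abs_le_iff)
      have w0: "0 \<le> (1 - y\<^sup>2) * f y / \<delta>"
        using s True f0[OF True] d by (auto intro!: divide_nonneg_pos mult_nonneg_nonneg)
      show ?thesis
      proof (cases "1 - \<bar>y\<bar> \<le> \<delta>")
        case True2: True
        have "f y \<le> \<delta> * K" using le[OF True] mult_right_mono[OF True2 K] by linarith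
        moreover have "y \<in> {-1..-1+\<delta>} \<or> y \<in> {1-\<delta>..1}" using True True2 by auto
        moreover have "0 \<le> \<delta> * K" using K d by simp
        ultimately show ?thesis using w0 True by (simp only: if_True) (smt (verit))
      next
        case False
        then have "\<delta> * f y \<le> (1 - y\<^sup>2) * f y" using s f0[OF True] by (intro mult_right_mono) auto
        then have "f y \<le> (1 - y\<^sup>2) * f y / \<delta>" using d by (simp add: pos_le_divide_eq mult.commute)
        moreover have "0 \<le> \<delta> * K" using K d by simp
        ultimately show ?thesis using True by (simp only: if_True) (smt (verit))
      qed
    qed (use K d in auto)
  qed
qed

section \<open>Averages of periodic functions\<close>

definition shift_periodic :: "real \<Rightarrow> (real \<Rightarrow> real) \<Rightarrow> bool" where
  "shift_periodic T g \<longleftrightarrow> (\<forall>x. g (x + T) = g x)"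

definition average :: "real \<Rightarrow> (real \<Rightarrow> real) \<Rightarrow> real \<Rightarrow> real" where
  "average h g x = integral {0..h} (\<lambda>s. g (x + s)) / h"

lemma integral_shift_real:
  fixes g :: "real \<Rightarrow> real"
  assumes "continuous_on UNIV g"
  shows "integral {a..b} (\<lambda>s. g (x + s)) = integral {x + a..x + b} g"
  using integral_shift_Icc_real[of a b g x] by (simp add: o_def add.commute)

lemma DERIV_integral_window:
  fixes g :: "real \<Rightarrow> real"
  assumes g: "continuous_on UNIV g" and h: "0 \<le> h"
  shows "((\<lambda>x. integral {x..x + h} g) has_real_derivative g (x + h) - g x) (at x)"
proof -
  define c where "c = x - 1"
  let ?F = "\<lambda>t. integral {c..t} g"
  have gi: "g integrable_on {a..b}" for a b
    using g by (auto intro!: integrable_continuous_real intro: continuous_on_subset)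
  have F: "(?F has_real_derivative g t) (at t)" if "t > c" for t
  proof -
    have "(?F has_real_derivative g t) (at t within {c..t + 1})"
      by (rule integral_has_real_derivative) (use g that in \<open>auto intro: continuous_on_subset\<close>)
    then show ?thesis using that by (simp add: at_within_Icc_at)
  qed
  have "((\<lambda>x. ?F (x + h) - ?F x) has_real_derivative g (x + h) * 1 - g x) (at x)"
  proof (rule DERIV_diff)
    have "(?F has_real_derivative g (x + h)) (at (x + h))" using h by (intro F) (simp add: c_def)
    moreover have "((\<lambda>x. x + h) has_real_derivative 1) (at x)" by (auto intro!: derivative_eq_intros)
    ultimately show "((\<lambda>x. ?F (x + h)) has_real_derivative g (x + h) * 1) (at x)"
      by (rule DERIV_chain2)
    show "(?F has_real_derivative g x) (at x)" by (intro F) (simp add: c_def)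
  qed
  then have "((\<lambda>x. ?F (x + h) - ?F x) has_real_derivative g (x + h) - g x) (at x)" by simp
  then show ?thesis
  proof (rule has_field_derivative_transform_within_open[where S="{c<..}"])
    show "?F (y + h) - ?F y = integral {y..y + h} g" if "y \<in> {c<..}" for y
      using Henstock_Kurzweil_Integration.integral_combine[of c y "y + h" g] that h gi by simp
  qed (auto simp: c_def)
qed

text \<open>The integral over a window of length \<open>T\<close> has derivative g (x + T) - g x = 0
  with respect to the position of the window.\<close>

lemma integral_shift_periodic:
  fixes g :: "real \<Rightarrow> real"
  assumes g: "continuous_on UNIV g" "shift_periodic T g" and T: "0 < T"
  shows "integral {0..T} (\<lambda>x. g (x + s)) = integral {0..T} g"
proof -
  let ?F = "\<lambda>x. integral {x..x + T} g"
  have "(?F has_real_derivative 0) (at x)" for x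
    using DERIV_integral_window[OF g(1), of T x] T g(2) by (simp add: shift_periodic_def)
  then have "?F s = ?F 0" using DERIV_isconst_all by blast
  then show ?thesis using integral_shift_real[OF g(1), of 0 T s] by (simp add: add.commute)
qed

lemma average_eq_window:
  assumes "continuous_on UNIV g"
  shows "average h g x = integral {x..x + h} g / h"
  using integral_shift_real[OF assms, of 0 h x] by (simp add: average_def)

lemma DERIV_average:
  assumes "continuous_on UNIV g" "0 < h"
  shows "(average h g has_real_derivative (g (x + h) - g x) / h) (at x)"
  unfolding average_eq_window[OF assms(1), abs_def]
  using DERIV_integral_window[OF assms(1), of h x] assms(2) by (intro DERIV_cdivide) simp

lemma continuous_on_average:
  assumes "continuous_on UNIV g" "0 < h"
  shows "continuous_on S (average h g)"
  using DERIV_average[OF assms] by (meson DERIV_isCont continuous_at_imp_continuous_on)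

lemma continuous_on_translate [continuous_intros]:
  fixes g :: "real \<Rightarrow> real"
  assumes "continuous_on UNIV g"
  shows "continuous_on S (\<lambda>s. g (x + s))" "continuous_on S (\<lambda>s. g (s + x))"
  by (rule continuous_on_compose2[OF assms]; auto intro!: continuous_intros)+

text \<open>With \<open>c\<close> = 0 this bounds averages; with \<open>c\<close> =
  \<open>g x\<close> it measures how close they are to \<open>g\<close>.\<close>

lemma average_bound:
  assumes g: "continuous_on UNIV g" and h: "0 < h" and C: "\<And>s. s \<in> {0..h} \<Longrightarrow> \<bar>g (x + s) - c\<bar> \<le> C"
  shows "\<bar>average h g x - c\<bar> \<le> C"
proof -
  have gi: "(\<lambda>s. g (x + s)) integrable_on {0..h}"
    using g by (intro integrable_continuous_real continuous_intros)
  have "average h g x - c = integral {0..h} (\<lambda>s. g (x + s) - c) / h"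
    using h gi by (simp add: average_def integral_diff integrable_const_ivl diff_divide_distrib)
  moreover have "\<bar>integral {0..h} (\<lambda>s. g (x + s) - c)\<bar> \<le> integral {0..h} (\<lambda>s. C)"
    by (rule integral_abs_bound_Ioo) (use gi C in \<open>auto intro!: integrable_diff\<close>)
  ultimately show ?thesis using h by (simp add: divide_le_eq mult.commute)
qed

lemma shift_periodic_average:
  assumes "shift_periodic T g"
  shows "shift_periodic T (average h g)"
proof -
  have "g (x + T + s) = g (x + s)" for x s
    using assms by (metis add.assoc add.commute shift_periodic_def)
  then show ?thesis by (simp add: shift_periodic_def average_def)
qed

text \<open>Jensen's inequality, in the form that the variance about the mean \<open>m\<close> is
  nonnegative.\<close>

lemma average_square_le:
  assumes g: "continuous_on UNIV g" and h: "0 < h"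
  shows "(average h g x)\<^sup>2 \<le> average h (\<lambda>x. (g x)\<^sup>2) x"
proof -
  define m where "m = average h g x"
  have gi: "(\<lambda>s. g (x + s)) integrable_on {0..h}" "(\<lambda>s. (g (x + s))\<^sup>2) integrable_on {0..h}"
    using g by (auto intro!: integrable_continuous_real continuous_intros)
  have "0 \<le> integral {0..h} (\<lambda>s. (g (x + s) - m)\<^sup>2)"
    using g by (intro integral_nonneg integrable_continuous_real continuous_intros) auto
  also have "(\<lambda>s. (g (x + s) - m)\<^sup>2) = (\<lambda>s. (g (x + s))\<^sup>2 + (- 2 * m * g (x + s) + m\<^sup>2))"
    by (simp add: power2_eq_square algebra_simps)
  also have "integral {0..h} \<dots> = integral {0..h} (\<lambda>s. (g (x + s))\<^sup>2) + (- 2 * m * integral {0..h} (\<lambda>s. g (x + s)) + m\<^sup>2 * h)"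
    using gi h by (simp add: integral_add integral_diff integrable_diff integrable_add integrable_on_mult_right integrable_const_ivl)
  also have "integral {0..h} (\<lambda>s. g (x + s)) = m * h" using h by (simp add: m_def average_def)
  finally show ?thesis using h unfolding m_def[symmetric]
    by (simp add: average_def le_divide_eq power2_eq_square algebra_simps)
qed

text \<open>Exchange the two integrations; every translate of \<open>g\<close> has the same integral
  over a period.\<close>

lemma integral_average:
  assumes g: "continuous_on UNIV g" "shift_periodic T g" and h: "0 < h" and T: "0 < T"
  shows "integral {0..T} (average h g) = integral {0..T} g"
proof -
  have "integral {0..T} (average h g) = integral {0..T} (\<lambda>x. integral {0..h} (\<lambda>s. g (x + s))) / h"
    by (simp add: average_def[abs_def])
  also have "integral {0..T} (\<lambda>x. integral {0..h} (\<lambda>s. g (x + s))) = integral {0..h} (\<lambda>s. integral {0..T} (\<lambda>x. g (x + s)))"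
    using integral_swap_continuous[of 0 0 T h "\<lambda>x s. g (x + s)"] 
    by (simp add: case_prod_beta' cbox_interval continuous_on_compose2[OF g(1)] continuous_intros)
  also have "\<dots> = integral {0..h} (\<lambda>s. integral {0..T} g)"
    using integral_shift_periodic[OF g T] by simp
  finally show ?thesis using h by simp
qed

lemma integral_average_square_le:
  assumes g: "continuous_on UNIV g" "shift_periodic T g" and h: "0 < h" and T: "0 < T"
  shows "integral {0..T} (\<lambda>x. (average h g x)\<^sup>2) \<le> integral {0..T} (\<lambda>x. (g x)\<^sup>2)"
proof -
  have c: "continuous_on UNIV (\<lambda>x. (g x)\<^sup>2)" using g by (intro continuous_intros)
  have "integral {0..T} (\<lambda>x. (average h g x)\<^sup>2) \<le> integral {0..T} (average h (\<lambda>x. (g x)\<^sup>2))"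
    using average_square_le[OF g(1) h] continuous_on_average[OF g(1) h] continuous_on_average[OF c h]
    by (intro integral_le integrable_continuous_real continuous_intros) auto
  also have "\<dots> = integral {0..T} (\<lambda>x. (g x)\<^sup>2)"
    by (rule integral_average[OF c _ h T]) (use g in \<open>simp add: shift_periodic_def\<close>)
  finally show ?thesis .
qed

section \<open>Functions on the strip and their slices\<close>

lemma integral_Icc_cauchy_schwarz:
  fixes f g :: "real \<Rightarrow> real"
  assumes "continuous_on {a..b} f" "continuous_on {a..b} g"
  shows "\<bar>integral {a..b} (\<lambda>x. f x * g x)\<bar> \<le> sqrt (integral {a..b} (\<lambda>x. (f x)\<^sup>2) * integral {a..b} (\<lambda>x. (g x)\<^sup>2))"
    "integral {a..b} (\<lambda>x. \<bar>f x * g x\<bar>) \<le> sqrt (integral {a..b} (\<lambda>x. (f x)\<^sup>2) * integral {a..b} (\<lambda>x. (g x)\<^sup>2))"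
proof -
  have c: "continuous_on {a<..<b} f" "continuous_on {a<..<b} g"
    using assms by (auto intro: continuous_on_subset)
  have i: "(\<lambda>x. (f x)\<^sup>2) integrable_on {a<..<b}" "(\<lambda>x. (g x)\<^sup>2) integrable_on {a<..<b}"
    unfolding integrable_on_Icc_iff_Ioo[symmetric]
    using assms by (auto intro!: integrable_continuous_real continuous_intros)
  have "integral {a<..<b} (\<lambda>x. sqrt ((f x)\<^sup>2 * (g x)\<^sup>2)) \<le> sqrt (integral {a<..<b} (\<lambda>x. (f x)\<^sup>2) * integral {a<..<b} (\<lambda>x. (g x)\<^sup>2))"
    by (rule integral_sqrt_mult_le) (use c i in \<open>auto intro!: continuous_intros\<close>)
  then show 2: "integral {a..b} (\<lambda>x. \<bar>f x * g x\<bar>) \<le> sqrt (integral {a..b} (\<lambda>x. (f x)\<^sup>2) * integral {a..b} (\<lambda>x. (g x)\<^sup>2))"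
    by (simp add: integral_open_interval_real real_sqrt_mult abs_mult)
  have "\<bar>integral {a..b} (\<lambda>x. f x * g x)\<bar> \<le> integral {a..b} (\<lambda>x. \<bar>f x * g x\<bar>)"
    by (rule integral_abs_bound_Ioo) (use assms in \<open>auto intro!: integrable_continuous_real continuous_intros\<close>)
  with 2 show "\<bar>integral {a..b} (\<lambda>x. f x * g x)\<bar> \<le> sqrt (integral {a..b} (\<lambda>x. (f x)\<^sup>2) * integral {a..b} (\<lambda>x. (g x)\<^sup>2))"
    by linarith
qed

lemma integral_attains_mean:
  fixes f :: "real \<Rightarrow> real"
  assumes "continuous_on {0..T} f" "0 < T"
  obtains x where "x \<in> {0..T}" "T * f x = integral {0..T} f"
proof -
  have "((\<lambda>t. integral {0..t} f) has_real_derivative f x) (at x)" if "0 < x" "x < T" for x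
  proof -
    have "((\<lambda>t. integral {0..t} f) has_real_derivative f x) (at x within {0..T})"
      by (rule integral_has_real_derivative) (use assms that in auto)
    then show ?thesis using that by (simp add: at_within_Icc_at)
  qed
  moreover have "continuous_on {0..T} (\<lambda>t. integral {0..t} f)"
    by (rule indefinite_integral_continuous_1) (use assms in \<open>auto intro: integrable_continuous_real\<close>)
  ultimately obtain l z where z: "0 < z" "z < T" "((\<lambda>t. integral {0..t} f) has_real_derivative l) (at z)"
    "integral {0..T} f - integral {0..0} f = (T - 0) * l"
    using MVT[of 0 T "\<lambda>t. integral {0..t} f"] assms(2) real_differentiable_def by blast
  moreover have "l = f z" using z \<open>\<And>x. 0 < x \<Longrightarrow> x < T \<Longrightarrow> _ x\<close> DERIV_unique by blast
  ultimately show ?thesis using that[of z] by simp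
qed

lemma increment_le_integral:
  fixes f f' :: "real \<Rightarrow> real"
  assumes d: "\<And>x. (f has_real_derivative f' x) (at x)" and c: "continuous_on UNIV f'"
    and x: "x \<in> {0..T}" "z \<in> {0..T}"
  shows "\<bar>f x - f z\<bar> \<le> integral {0..T} (\<lambda>x. \<bar>f' x\<bar>)"
proof -
  have main: "\<bar>f v - f u\<bar> \<le> integral {0..T} (\<lambda>x. \<bar>f' x\<bar>)" if "0 \<le> u" "u \<le> v" "v \<le> T" for u v
  proof -
    have "(f' has_integral (f v - f u)) {u..v}"
      by (rule fundamental_theorem_of_calculus)
         (use d that in \<open>auto simp: has_real_derivative_iff_has_vector_derivative[symmetric] intro: has_field_derivative_at_within\<close>)
    then have "f v - f u = integral {u..v} f'" by (simp add: integral_unique)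
    also have "\<bar>\<dots>\<bar> \<le> integral {u..v} (\<lambda>x. \<bar>f' x\<bar>)"
      by (rule integral_abs_bound_Ioo) (use c in \<open>auto intro!: integrable_continuous_real continuous_intros intro: continuous_on_subset\<close>)
    also have "\<dots> \<le> integral {0..T} (\<lambda>x. \<bar>f' x\<bar>)"
      by (rule integral_subset_le) (use c that in \<open>auto intro!: integrable_continuous_real continuous_intros intro: continuous_on_subset\<close>)
    finally show ?thesis .
  qed
  show ?thesis using main[of x z] main[of z x] x by (cases "x \<le> z") auto
qed

text \<open>Somewhere f^2 equals its mean, and from there it changes by at most the integral of |2 *
  f * f'|.\<close>

lemma sup_square_le:
  fixes f f' :: "real \<Rightarrow> real"
  assumes d: "\<And>x. (f has_real_derivative f' x) (at x)" and c: "continuous_on UNIV f'"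
    and T: "0 < T" and x: "x \<in> {0..T}"
  shows "(f x)\<^sup>2 \<le> integral {0..T} (\<lambda>x. (f x)\<^sup>2) / T + 2 * sqrt (integral {0..T} (\<lambda>x. (f x)\<^sup>2) * integral {0..T} (\<lambda>x. (f' x)\<^sup>2))"
proof -
  have fc: "continuous_on S f" for S using d by (meson DERIV_isCont continuous_at_imp_continuous_on)
  obtain z where z: "z \<in> {0..T}" "T * (f z)\<^sup>2 = integral {0..T} (\<lambda>x. (f x)\<^sup>2)"
    using integral_attains_mean[of T "\<lambda>x. (f x)\<^sup>2"] fc T by (metis continuous_on_power)
  have "\<bar>(f x)\<^sup>2 - (f z)\<^sup>2\<bar> \<le> integral {0..T} (\<lambda>x. \<bar>2 * f x * f' x\<bar>)"
    by (rule increment_le_integral[OF _ _ x z(1)])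
       (auto intro!: derivative_eq_intros d continuous_intros fc c)
  also have "\<dots> = 2 * integral {0..T} (\<lambda>x. \<bar>f x * f' x\<bar>)"
    by (simp add: abs_mult mult.assoc)
  also have "\<dots> \<le> 2 * sqrt (integral {0..T} (\<lambda>x. (f x)\<^sup>2) * integral {0..T} (\<lambda>x. (f' x)\<^sup>2))"
    using integral_Icc_cauchy_schwarz(2)[of 0 T f f'] fc c by (auto intro: continuous_on_subset)
  moreover have "(f z)\<^sup>2 = integral {0..T} (\<lambda>x. (f x)\<^sup>2) / T" using z(2) T by (simp add: field_simps)
  ultimately show ?thesis by linarith
qed

text \<open>A continuous function of mean zero vanishes at some \<open>u\<close>, so |f| is at most
  the integral of |f'|. The constant T^2 is not the sharp one; only its order in \<open>T\<close>
  matters later.\<close>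

lemma poincare_mean_zero:
  fixes f f' :: "real \<Rightarrow> real"
  assumes d: "\<And>x. (f has_real_derivative f' x) (at x)" and c: "continuous_on UNIV f'"
    and T: "0 < T" and z: "integral {0..T} f = 0"
  shows "integral {0..T} (\<lambda>x. (f x)\<^sup>2) \<le> T\<^sup>2 * integral {0..T} (\<lambda>x. (f' x)\<^sup>2)"
proof -
  have fc: "continuous_on S f" for S using d by (meson DERIV_isCont continuous_at_imp_continuous_on)
  have fc': "continuous_on S f'" for S using c by (rule continuous_on_subset) simp
  obtain u where u: "u \<in> {0..T}" "f u = 0"
    using integral_attains_mean[of T f] fc T z by (metis mult_eq_0_iff less_irrefl)
  let ?B = "integral {0..T} (\<lambda>x. (f' x)\<^sup>2)"
  have B0: "0 \<le> ?B" by (intro integral_nonneg integrable_continuous_real continuous_intros fc') auto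
  have "integral {0..T} (\<lambda>x. \<bar>f' x\<bar>) \<le> sqrt (?B * T)"
    using integral_Icc_cauchy_schwarz(2)[of 0 T f' "\<lambda>_. 1"] fc' T by simp
  then have "\<bar>f x\<bar> \<le> sqrt (?B * T)" if "x \<in> {0..T}" for x
    using increment_le_integral[OF d c that u(1)] u(2) by simp
  then have "\<bar>f x\<bar>\<^sup>2 \<le> (sqrt (?B * T))\<^sup>2" if "x \<in> {0..T}" for x
    using that by (intro power_mono) auto
  then have "integral {0..T} (\<lambda>x. (f x)\<^sup>2) \<le> integral {0..T} (\<lambda>x. ?B * T)"
    using B0 T by (intro integral_le integrable_continuous_real continuous_intros fc) auto
  then show ?thesis using T by (simp add: power2_eq_square algebra_simps)
qed

section \<open>Partial derivatives on the strip and integrals over horizontal lines\<close>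

definition slice :: "real \<Rightarrow> (real \<times> real \<Rightarrow> real) \<Rightarrow> real \<Rightarrow> real" where
  "slice T f y = integral {0..T} (\<lambda>x. f (x, y))"

text \<open>The derivative is an explicit second argument, so that rules compose by resolution.
  Joint continuity of both functions is included because differentiation under the integral sign
  relies on it.\<close>

definition has_pdx :: "(real \<times> real \<Rightarrow> real) \<Rightarrow> (real \<times> real \<Rightarrow> real) \<Rightarrow> bool" where
  "has_pdx f f' \<longleftrightarrow> continuous_on strip f \<and> continuous_on strip f' \<and>
     (\<forall>x y. -1 < y \<longrightarrow> y < 1 \<longrightarrow> ((\<lambda>s. f (s, y)) has_real_derivative f' (x, y)) (at x))"

definition has_pdy :: "(real \<times> real \<Rightarrow> real) \<Rightarrow> (real \<times> real \<Rightarrow> real) \<Rightarrow> bool" where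
  "has_pdy f f' \<longleftrightarrow> continuous_on strip f \<and> continuous_on strip f' \<and>
     (\<forall>x y. -1 < y \<longrightarrow> y < 1 \<longrightarrow> ((\<lambda>s. f (x, s)) has_real_derivative f' (x, y)) (at y))"

definition translate :: "real \<Rightarrow> (real \<times> real \<Rightarrow> real) \<Rightarrow> real \<times> real \<Rightarrow> real" where
  "translate k f z = f (fst z + k, snd z)"

definition steklov :: "real \<Rightarrow> (real \<times> real \<Rightarrow> real) \<Rightarrow> real \<times> real \<Rightarrow> real" where
  "steklov h f z = average h (\<lambda>x. f (x, snd z)) (fst z)"

definition strip_bounded :: "(real \<times> real \<Rightarrow> real) \<Rightarrow> bool" where
  "strip_bounded f \<longleftrightarrow> (\<exists>C. \<forall>z\<in>strip. \<bar>f z\<bar> \<le> C)"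

lemma strip_iff [simp]: "(x, y) \<in> strip \<longleftrightarrow> -1 < y \<and> y < 1"
  by (auto simp: strip_def)

lemma closed_strip_iff [simp]: "(x, y) \<in> closed_strip \<longleftrightarrow> -1 \<le> y \<and> y \<le> 1"
  by (auto simp: closed_strip_def)

lemma strip_subset_closed_strip: "strip \<subseteq> closed_strip"
  by auto

lemma continuous_on_strip_if_closed: "continuous_on closed_strip f \<Longrightarrow> continuous_on strip f"
  by (rule continuous_on_subset[OF _ strip_subset_closed_strip])

lemma has_pdxD:
  assumes "has_pdx f f'"
  shows "continuous_on strip f" "continuous_on strip f'"
    "-1 < y \<Longrightarrow> y < 1 \<Longrightarrow> ((\<lambda>s. f (s, y)) has_real_derivative f' (x, y)) (at x)"
  using assms by (auto simp: has_pdx_def)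

lemma has_pdyD:
  assumes "has_pdy f f'"
  shows "continuous_on strip f" "continuous_on strip f'"
    "-1 < y \<Longrightarrow> y < 1 \<Longrightarrow> ((\<lambda>s. f (x, s)) has_real_derivative f' (x, y)) (at y)"
  using assms by (auto simp: has_pdy_def)

lemma has_pdx_add: "has_pdx f f' \<Longrightarrow> has_pdx g g' \<Longrightarrow> has_pdx (\<lambda>z. f z + g z) (\<lambda>z. f' z + g' z)"
  by (auto simp: has_pdx_def intro!: continuous_intros derivative_eq_intros)

lemma has_pdy_add: "has_pdy f f' \<Longrightarrow> has_pdy g g' \<Longrightarrow> has_pdy (\<lambda>z. f z + g z) (\<lambda>z. f' z + g' z)"
  by (auto simp: has_pdy_def intro!: continuous_intros derivative_eq_intros)

lemma has_pdx_diff: "has_pdx f f' \<Longrightarrow> has_pdx g g' \<Longrightarrow> has_pdx (\<lambda>z. f z - g z) (\<lambda>z. f' z - g' z)"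
  by (auto simp: has_pdx_def intro!: continuous_intros derivative_eq_intros)

lemma has_pdy_diff: "has_pdy f f' \<Longrightarrow> has_pdy g g' \<Longrightarrow> has_pdy (\<lambda>z. f z - g z) (\<lambda>z. f' z - g' z)"
  by (auto simp: has_pdy_def intro!: continuous_intros derivative_eq_intros)

lemma has_pdx_mult: "has_pdx f f' \<Longrightarrow> has_pdx g g' \<Longrightarrow> has_pdx (\<lambda>z. f z * g z) (\<lambda>z. f' z * g z + f z * g' z)"
  by (auto simp: has_pdx_def intro!: continuous_intros derivative_eq_intros)

lemma has_pdy_mult: "has_pdy f f' \<Longrightarrow> has_pdy g g' \<Longrightarrow> has_pdy (\<lambda>z. f z * g z) (\<lambda>z. f' z * g z + f z * g' z)"
  by (auto simp: has_pdy_def intro!: continuous_intros derivative_eq_intros)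

lemma has_pdx_const: "has_pdx (\<lambda>z. c) (\<lambda>z. 0)"
  by (auto simp: has_pdx_def)

lemma has_pdy_const: "has_pdy (\<lambda>z. c) (\<lambda>z. 0)"
  by (auto simp: has_pdy_def)

lemma has_pdx_cmult: "has_pdx f f' \<Longrightarrow> has_pdx (\<lambda>z. c * f z) (\<lambda>z. c * f' z)"
  by (auto simp: has_pdx_def intro!: continuous_intros derivative_eq_intros)

lemma has_pdy_cmult: "has_pdy f f' \<Longrightarrow> has_pdy (\<lambda>z. c * f z) (\<lambda>z. c * f' z)"
  by (auto simp: has_pdy_def intro!: continuous_intros derivative_eq_intros)

lemma has_pdx_divide: "has_pdx f f' \<Longrightarrow> has_pdx (\<lambda>z. f z / c) (\<lambda>z. f' z / c)"
  using has_pdx_cmult[of f f' "1 / c"] by simp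

lemma has_pdy_divide: "has_pdy f f' \<Longrightarrow> has_pdy (\<lambda>z. f z / c) (\<lambda>z. f' z / c)"
  using has_pdy_cmult[of f f' "1 / c"] by simp

lemma continuous_on_strip_snd:
  assumes "continuous_on {-1<..<1} g"
  shows "continuous_on strip (\<lambda>z. g (snd z))"
  by (rule continuous_on_compose2[OF assms]) (auto simp: strip_def intro: continuous_on_snd)

lemma has_pdx_snd: "continuous_on {-1<..<1} g \<Longrightarrow> has_pdx (\<lambda>z. g (snd z)) (\<lambda>z. 0)"
  by (simp add: has_pdx_def continuous_on_strip_snd)

lemma has_pdy_snd:
  assumes "\<And>y. y \<in> {-1<..<1} \<Longrightarrow> (g has_real_derivative g' y) (at y)" "continuous_on {-1<..<1} g'"
  shows "has_pdy (\<lambda>z. g (snd z)) (\<lambda>z. g' (snd z))"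
proof -
  have "continuous_on {-1<..<1} g"
    using assms(1) by (meson DERIV_isCont continuous_at_imp_continuous_on)
  then show ?thesis
    using assms by (simp add: has_pdy_def continuous_on_strip_snd)
qed

lemma continuous_on_translate_strip:
  "continuous_on (UNIV \<times> J) f \<Longrightarrow> continuous_on (UNIV \<times> J) (translate k f)"
  unfolding translate_def[abs_def] by (erule continuous_on_compose2) (auto intro!: continuous_intros)

lemma has_pdx_translate: "has_pdx f f' \<Longrightarrow> has_pdx (translate k f) (translate k f')"
proof -
  assume a: "has_pdx f f'"
  have "((\<lambda>s. f (s + k, y)) has_real_derivative f' (x + k, y)) (at x)" if "-1 < y" "y < 1" for x y
    using has_pdxD(3)[OF a that, of "x + k"] by (simp add: DERIV_shift)
  then show ?thesis using a
    by (auto simp: has_pdx_def translate_def[abs_def] strip_def intro: continuous_on_translate_strip[unfolded translate_def[abs_def]])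
qed

lemma has_pdy_translate: "has_pdy f f' \<Longrightarrow> has_pdy (translate k f) (translate k f')"
  by (auto simp: has_pdy_def translate_def[abs_def] strip_def intro: continuous_on_translate_strip[unfolded translate_def[abs_def]])

lemma has_pdx_cong: "has_pdx f f' \<Longrightarrow> (\<And>z. z \<in> strip \<Longrightarrow> g' z = f' z) \<Longrightarrow> has_pdx f g'"
  by (auto simp: has_pdx_def cong: continuous_on_cong)

lemmas pd_intros = has_pdx_add has_pdy_add has_pdx_diff has_pdy_diff has_pdx_mult has_pdy_mult
  has_pdx_const has_pdy_const has_pdx_cmult has_pdy_cmult has_pdx_divide has_pdy_divide
  has_pdx_translate has_pdy_translate

lemma continuous_on_line:
  "continuous_on (UNIV \<times> J) f \<Longrightarrow> y \<in> J \<Longrightarrow> continuous_on S (\<lambda>x. f (x, y))"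
  by (erule continuous_on_compose2) (auto intro!: continuous_intros)

lemma continuous_on_strip_line:
  "continuous_on strip f \<Longrightarrow> -1 < y \<Longrightarrow> y < 1 \<Longrightarrow> continuous_on S (\<lambda>x. f (x, y))"
  unfolding strip_def by (rule continuous_on_line) auto

lemma strip_line_integrable:
  fixes f :: "real \<times> real \<Rightarrow> real"
  shows
  "continuous_on strip f \<Longrightarrow> -1 < y \<Longrightarrow> y < 1 \<Longrightarrow> (\<lambda>x. f (x, y)) integrable_on {a..b::real}"
  using integrable_continuous_real[OF continuous_on_strip_line[of f y "{a..b}"]] by simp

lemma continuous_on_slice':
  assumes "continuous_on (UNIV \<times> J) f"
  shows "continuous_on J (slice T f)"
proof -
  have "continuous_on (J \<times> cbox 0 T) (\<lambda>(y, x). f (x, y))"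
    unfolding case_prod_beta'
    by (rule continuous_on_compose2[OF assms]) (auto intro!: continuous_intros)
  from integral_continuous_on_param[OF this] show ?thesis
    by (simp add: slice_def[abs_def] cbox_interval)
qed

lemma continuous_on_slice: "continuous_on strip f \<Longrightarrow> continuous_on {-1<..<1} (slice T f)"
  unfolding strip_def by (rule continuous_on_slice')

lemma continuous_on_slice_closed: "continuous_on closed_strip f \<Longrightarrow> continuous_on {-1..1} (slice T f)"
  unfolding closed_strip_def by (rule continuous_on_slice')

lemma DERIV_slice:
  assumes f: "has_pdy f f'" and y: "-1 < y" "y < 1"
  shows "(slice T f has_real_derivative slice T f' y) (at y)"
proof -
  have c: "continuous_on ({-1<..<1} \<times> cbox 0 T) (\<lambda>(y, x). f' (x, y))"
    unfolding case_prod_beta'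
    by (rule continuous_on_compose2[OF has_pdyD(2)[OF f]]) (auto intro!: continuous_intros simp: strip_def)
  have "((\<lambda>y. integral (cbox 0 T) (\<lambda>x. f (x, y))) has_real_derivative integral (cbox 0 T) (\<lambda>x. f' (x, y))) (at y within {-1<..<1})"
    by (rule leibniz_rule_field_derivative[where fx="\<lambda>y x. f' (x, y)"])
       (use y c in \<open>auto simp: cbox_interval intro: strip_line_integrable[OF has_pdyD(1)[OF f]]
         has_field_derivative_at_within[OF has_pdyD(3)[OF f]]\<close>)
  then show ?thesis using y
    by (simp add: slice_def[abs_def] cbox_interval at_within_open[of y "{-1<..<1}"])
qed

lemma slice_pdx_eq_0:
  assumes f: "has_pdx f f'" "x_periodic_on strip T f" and T: "0 \<le> T" and y: "-1 < y" "y < 1"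
  shows "slice T f' y = 0"
proof -
  have "((\<lambda>x. f' (x, y)) has_integral (f (T, y) - f (0, y))) {0..T}"
    by (rule fundamental_theorem_of_calculus)
       (use T has_pdxD(3)[OF f(1) y] in \<open>auto simp: has_real_derivative_iff_has_vector_derivative[symmetric] intro: has_field_derivative_at_within\<close>)
  moreover have "f (0 + T, y) = f (0, y)" using f(2) y unfolding x_periodic_on_def by (metis strip_iff)
  ultimately show ?thesis by (simp add: slice_def integral_unique)
qed

lemma slice_add: "continuous_on strip f \<Longrightarrow> continuous_on strip g \<Longrightarrow> -1 < y \<Longrightarrow> y < 1 \<Longrightarrow>
    slice T (\<lambda>z. f z + g z) y = slice T f y + slice T g y"
  by (simp add: slice_def integral_add strip_line_integrable)

lemma slice_diff: "continuous_on strip f \<Longrightarrow> continuous_on strip g \<Longrightarrow> -1 < y \<Longrightarrow> y < 1 \<Longrightarrow>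
    slice T (\<lambda>z. f z - g z) y = slice T f y - slice T g y"
  by (simp add: slice_def integral_diff strip_line_integrable)

lemma slice_cmult: "slice T (\<lambda>z. c * f z) y = c * slice T f y"
  by (simp add: slice_def)

lemma slice_snd_mult: "slice T (\<lambda>z. g (snd z) * f z) y = g y * slice T f y"
  by (simp add: slice_def)

lemma slice_minus: "slice T (\<lambda>z. - f z) y = - slice T f y"
  by (simp add: slice_def)

lemma slice_const: "0 \<le> T \<Longrightarrow> slice T (\<lambda>z. c) y = c * T"
  by (simp add: slice_def)

lemma slice_cong: "(\<And>x. x \<in> {0..T} \<Longrightarrow> f (x, y) = g (x, y)) \<Longrightarrow> slice T f y = slice T g y"
  unfolding slice_def by (rule integral_cong)

lemma slice_mono: "continuous_on strip f \<Longrightarrow> continuous_on strip g \<Longrightarrow> -1 < y \<Longrightarrow> y < 1 \<Longrightarrow>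
    (\<And>x. x \<in> {0..T} \<Longrightarrow> f (x, y) \<le> g (x, y)) \<Longrightarrow> slice T f y \<le> slice T g y"
  unfolding slice_def by (intro integral_le strip_line_integrable)

lemma slice_nonneg: "continuous_on strip f \<Longrightarrow> -1 < y \<Longrightarrow> y < 1 \<Longrightarrow>
    (\<And>x. 0 \<le> f (x, y)) \<Longrightarrow> 0 \<le> slice T f y"
  unfolding slice_def by (intro integral_nonneg strip_line_integrable)

lemma slice_abs_le: "continuous_on strip f \<Longrightarrow> continuous_on strip g \<Longrightarrow> -1 < y \<Longrightarrow> y < 1 \<Longrightarrow>
    (\<And>x. x \<in> {0..T} \<Longrightarrow> \<bar>f (x, y)\<bar> \<le> g (x, y)) \<Longrightarrow> \<bar>slice T f y\<bar> \<le> slice T g y"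
  unfolding slice_def by (intro integral_abs_bound_Ioo strip_line_integrable)

lemma slice_cauchy_schwarz:
  assumes "continuous_on strip f" "continuous_on strip g" "-1 < y" "y < 1"
  shows "\<bar>slice T (\<lambda>z. f z * g z) y\<bar> \<le> sqrt (slice T (\<lambda>z. (f z)\<^sup>2) y * slice T (\<lambda>z. (g z)\<^sup>2) y)"
    "slice T (\<lambda>z. \<bar>f z * g z\<bar>) y \<le> sqrt (slice T (\<lambda>z. (f z)\<^sup>2) y * slice T (\<lambda>z. (g z)\<^sup>2) y)"
  unfolding slice_def
  using integral_Icc_cauchy_schwarz[OF assms(1,2)[THEN continuous_on_strip_line[OF _ assms(3,4)]]] by auto

text \<open>The Henstock--Kurzweil integral makes it unnecessary to know beforehand that the divergence is
  integrable up to the boundary.\<close>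

lemma divergence_has_integral_0:
  assumes A: "has_pdx A A'" "x_periodic_on strip T A" and B: "has_pdy B B'" and T: "0 \<le> T"
    and w: "continuous_on closed_strip w" "\<And>x. w (x, 1) = 0" "\<And>x. w (x, -1) = 0"
    and le: "\<And>z. z \<in> strip \<Longrightarrow> \<bar>B z\<bar> \<le> C * \<bar>w z\<bar>"
    and eq: "\<And>z. z \<in> strip \<Longrightarrow> A' z + B' z = f z"
  shows "(slice T f has_integral 0) {-1<..<1}"
proof -
  \<comment> \<open>On each line the contribution of \<open>A\<close> cancels by periodicity; the
    flux of \<open>B\<close> through a line tends to 0 at the walls because it is controlled by
    \<open>w\<close>.\<close>
  have "(slice T B' has_integral 0) {-1<..<1}"
  proof (rule ftc_vanishing_ends[where F="slice T B" and g="slice T (\<lambda>z. \<bar>w z\<bar>)" and C=C])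
    fix y :: real assume y: "y \<in> {-1<..<1}"
    show "(slice T B has_real_derivative slice T B' y) (at y)"
      by (rule DERIV_slice[OF B]) (use y in auto)
    have wc: "continuous_on strip (\<lambda>z. C * \<bar>w z\<bar>)"
      using continuous_on_strip_if_closed[OF w(1)] by (intro continuous_intros)
    have "\<bar>slice T B y\<bar> \<le> slice T (\<lambda>z. C * \<bar>w z\<bar>) y"
      by (rule slice_abs_le[OF has_pdyD(1)[OF B] wc]) (use y in \<open>auto intro!: le\<close>)
    then show "\<bar>slice T B y\<bar> \<le> C * slice T (\<lambda>z. \<bar>w z\<bar>) y" by (simp add: slice_cmult)
  next
    show "continuous_on {-1..1} (slice T (\<lambda>z. \<bar>w z\<bar>))"
      by (intro continuous_on_slice_closed continuous_intros w)
  qed (simp_all add: slice_def w)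
  moreover have "slice T f y = slice T B' y" if "y \<in> {-1<..<1}" for y
  proof -
    have "slice T f y = slice T (\<lambda>z. A' z + B' z) y" using that by (intro slice_cong) (auto simp: eq)
    also have "\<dots> = slice T A' y + slice T B' y"
      using that by (intro slice_add has_pdxD(2)[OF A(1)] has_pdyD(2)[OF B]) auto
    finally show ?thesis using slice_pdx_eq_0[OF A T, of y] that by auto
  qed
  ultimately show ?thesis by (subst has_integral_cong) auto
qed

section \<open>Steklov averages in the tangential variable\<close>

lemma shift_periodic_of_int:
  assumes "shift_periodic T g"
  shows "g (x + of_int k * T) = g x"
proof -
  have nat: "g (x + real n * T) = g x" for x n
  proof (induction n)
    case (Suc n)
    have "g (x + real (Suc n) * T) = g ((x + real n * T) + T)" by (simp add: algebra_simps)
    then show ?case using Suc assms by (simp add: shift_periodic_def)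
  qed simp
  show ?thesis
  proof (cases "k \<ge> 0")
    case True then show ?thesis using nat[of x "nat k"] by simp
  next
    case False then show ?thesis using nat[of "x + of_int k * T" "nat (- k)"] by simp
  qed
qed

text \<open>One representative \<open>z\<close> serves all functions of period \<open>T\<close> and
  all increments \<open>s\<close>; thus values at x + s and at x can be moved to the basic period
  together.\<close>

lemma shift_periodic_reduce:
  fixes x T :: real
  assumes "0 < T"
  obtains z where "0 \<le> z" "z \<le> T" "\<And>g s. shift_periodic T g \<Longrightarrow> g (z + s) = (g (x + s) :: real)"
proof -
  define k where "k = \<lfloor>x / T\<rfloor>"
  define z where "z = x + of_int (- k) * T"
  have "of_int k \<le> x / T" "x / T < of_int k + 1" unfolding k_def by linarith+
  then have "0 \<le> z" "z \<le> T" using assms by (auto simp: z_def field_simps)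
  moreover have "g (z + s) = g (x + s)" if "shift_periodic T g" for g :: "real \<Rightarrow> real" and s
    unfolding z_def using shift_periodic_of_int[OF that, of "x + s" "- k"] by (simp add: algebra_simps)
  ultimately show ?thesis using that by blast
qed

lemma shift_periodic_line:
  "x_periodic_on (UNIV \<times> J) T f \<Longrightarrow> y \<in> J \<Longrightarrow> shift_periodic T (\<lambda>x. f (x, y))"
  by (simp add: x_periodic_on_def shift_periodic_def)

lemma shift_periodic_strip_line:
  "x_periodic_on strip T f \<Longrightarrow> -1 < y \<Longrightarrow> y < 1 \<Longrightarrow> shift_periodic T (\<lambda>x. f (x, y))"
  by (rule shift_periodic_line) (auto simp: strip_def)

lemma periodic_uniform_modulus:
  assumes c: "continuous_on (UNIV \<times> J) f" and J: "compact J"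
    and per: "x_periodic_on (UNIV \<times> J) T f" and T: "0 < T" and e: "0 < e"
  shows "\<exists>h0>0. \<forall>x. \<forall>y\<in>J. \<forall>s. 0 \<le> s \<longrightarrow> s \<le> h0 \<longrightarrow> \<bar>f (x + s, y) - f (x, y)\<bar> \<le> e"
proof -
  \<comment> \<open>The additional unit length leaves room for an increment \<open>s\<close> of at
    most 1 beyond the period.\<close>
  have "uniformly_continuous_on ({0..T+1} \<times> J) f"
    by (intro compact_uniformly_continuous compact_Times J compact_Icc continuous_on_subset[OF c]) auto
  then obtain d where d: "d > 0" "\<And>u v. u \<in> {0..T+1} \<times> J \<Longrightarrow> v \<in> {0..T+1} \<times> J \<Longrightarrow> dist v u < d \<Longrightarrow> dist (f v) (f u) < e"
    unfolding uniformly_continuous_on_def using e by metis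
  show ?thesis
  proof (intro exI[of _ "min (d / 2) 1"] conjI allI ballI impI)
    fix x y s :: real assume y: "y \<in> J" and s: "0 \<le> s" "s \<le> min (d / 2) 1"
    obtain z where z: "0 \<le> z" "z \<le> T" "\<And>g s. shift_periodic T g \<Longrightarrow> g (z + s) = (g (x + s) :: real)"
      using shift_periodic_reduce[OF T, of x] by metis
    have "dist (f (z + s, y)) (f (z, y)) < e"
      by (rule d(2)) (use y z(1,2) s d(1) in \<open>auto simp: dist_prod_def dist_real_def\<close>)
    then show "\<bar>f (x + s, y) - f (x, y)\<bar> \<le> e"
      using z(3)[OF shift_periodic_line[OF per y], of s] z(3)[OF shift_periodic_line[OF per y], of 0]
      by (simp add: dist_real_def)
  qed (use d in auto)
qed

lemma periodic_bounded:
  assumes c: "continuous_on (UNIV \<times> J) f" and J: "compact J"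
    and per: "x_periodic_on (UNIV \<times> J) T f" and T: "0 < T"
  shows "\<exists>C. \<forall>x. \<forall>y\<in>J. \<bar>f (x, y)\<bar> \<le> C"
proof -
  have "compact (f ` ({0..T} \<times> J))"
    by (intro compact_continuous_image compact_Times J compact_Icc continuous_on_subset[OF c]) auto
  then obtain C where C: "\<And>u. u \<in> {0..T} \<times> J \<Longrightarrow> \<bar>f u\<bar> \<le> C"
    by (meson bounded_real compact_imp_bounded imageI)
  show ?thesis
  proof (intro exI[of _ C] allI ballI)
    fix x y assume y: "y \<in> J"
    obtain z where z: "0 \<le> z" "z \<le> T" "\<And>g s. shift_periodic T g \<Longrightarrow> g (z + s) = (g (x + s) :: real)"
      using shift_periodic_reduce[OF T, of x] by metis
    show "\<bar>f (x, y)\<bar> \<le> C"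
      using C[of "(z, y)"] z(3)[OF shift_periodic_line[OF per y], of 0] z(1,2) y by simp
  qed
qed

lemma strip_bounded_closed:
  assumes "continuous_on closed_strip f" "x_periodic_on closed_strip T f" "0 < T"
  shows "strip_bounded f"
  using periodic_bounded[of "{-1..1}" f T] assms
  by (fastforce simp: closed_strip_def[symmetric] strip_bounded_def strip_def)

lemma x_periodic_on_strip: "x_periodic_on closed_strip T f \<Longrightarrow> x_periodic_on strip T f"
  by (simp add: x_periodic_on_def)

lemma continuous_on_steklov:
  assumes "continuous_on (UNIV \<times> J) f"
  shows "continuous_on (UNIV \<times> J) (steklov h f)"
proof -
  have "continuous_on ((UNIV \<times> J) \<times> cbox 0 h) (\<lambda>(z, s). f (fst z + s, snd z))"
    unfolding case_prod_beta'
    by (rule continuous_on_compose2[OF assms]) (auto intro!: continuous_intros)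
  from integral_continuous_on_param[OF this]
  have "continuous_on (UNIV \<times> J) (\<lambda>z. integral {0..h} (\<lambda>s. f (fst z + s, snd z)) * (1 / h))"
    by (intro continuous_on_mult_right) (simp add: cbox_interval)
  then show ?thesis by (simp add: steklov_def[abs_def] average_def)
qed

lemma continuous_on_steklov_strip:
  "continuous_on strip f \<Longrightarrow> continuous_on strip (steklov h f)"
  "continuous_on closed_strip f \<Longrightarrow> continuous_on closed_strip (steklov h f)"
  by (simp_all add: strip_def closed_strip_def continuous_on_steklov)

lemma x_periodic_on_translate:
  "x_periodic_on (UNIV \<times> J) T f \<Longrightarrow> x_periodic_on (UNIV \<times> J) T (translate k f)"
proof -
  assume "x_periodic_on (UNIV \<times> J) T f"
  then have "f (x + k + T, y) = f (x + k, y)" if "y \<in> J" for x y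
    using that unfolding x_periodic_on_def by blast
  then show ?thesis by (simp add: x_periodic_on_def translate_def add.assoc add.commute[of k])
qed

lemma x_periodic_on_steklov:
  "x_periodic_on (UNIV \<times> J) T f \<Longrightarrow> x_periodic_on (UNIV \<times> J) T (steklov h f)"
  using shift_periodic_average[OF shift_periodic_line[of J T f]]
  by (simp add: x_periodic_on_def steklov_def shift_periodic_def)

lemma x_periodic_intros:
  "x_periodic_on S T f \<Longrightarrow> x_periodic_on S T g \<Longrightarrow> x_periodic_on S T (\<lambda>z. f z + g z)"
  "x_periodic_on S T f \<Longrightarrow> x_periodic_on S T g \<Longrightarrow> x_periodic_on S T (\<lambda>z. f z - g z)"
  "x_periodic_on S T f \<Longrightarrow> x_periodic_on S T g \<Longrightarrow> x_periodic_on S T (\<lambda>z. f z * g z)"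
  "x_periodic_on S T f \<Longrightarrow> x_periodic_on S T (\<lambda>z. c * f z)"
  "x_periodic_on S T f \<Longrightarrow> x_periodic_on S T (\<lambda>z. f z / c)"
  "x_periodic_on S T f \<Longrightarrow> x_periodic_on S T (\<lambda>z. - f z)"
  "x_periodic_on S T (\<lambda>z. g0 (snd z))"
  "x_periodic_on S T (\<lambda>z. c)"
  "x_periodic_on strip T f \<Longrightarrow> x_periodic_on strip T (translate k f)"
  "x_periodic_on closed_strip T f \<Longrightarrow> x_periodic_on closed_strip T (translate k f)"
  "x_periodic_on strip T f \<Longrightarrow> x_periodic_on strip T (steklov h f)"
  "x_periodic_on closed_strip T f \<Longrightarrow> x_periodic_on closed_strip T (steklov h f)"
  unfolding strip_def closed_strip_def
  by (auto intro: x_periodic_on_translate x_periodic_on_steklov) (auto simp: x_periodic_on_def)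

text \<open>Averaging a function that is merely continuous gains one continuous tangential
  derivative. It is a difference quotient, so for fixed \<open>h\<close> a bound for
  \<open>f\<close> up to the walls bounds it as well.\<close>

lemma has_pdx_steklov_quotient:
  assumes f: "continuous_on strip f" and h: "0 < h"
  shows "has_pdx (steklov h f) (\<lambda>z. (translate h f z - f z) / h)"
proof -
  have c: "continuous_on strip (\<lambda>z. (translate h f z - f z) / h)"
    using h f continuous_on_translate_strip[of "{-1<..<1}" f h] by (auto simp: strip_def intro!: continuous_intros)
  have "((\<lambda>s. steklov h f (s, y)) has_real_derivative (translate h f (x, y) - f (x, y)) / h) (at x)"
    if "-1 < y" "y < 1" for x y
    using DERIV_average[OF continuous_on_strip_line[OF f that] h, of x]
    by (simp add: steklov_def translate_def)
  then show ?thesis using c continuous_on_steklov_strip(1)[OF f] by (simp add: has_pdx_def)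
qed

lemma steklov_pdx:
  assumes f: "has_pdx f f'" and h: "0 < h" and z: "z \<in> strip"
  shows "steklov h f' z = (translate h f z - f z) / h"
proof -
  obtain x y where xy: "z = (x, y)" "-1 < y" "y < 1" using z by (cases z) auto
  have "((\<lambda>s. f' (s, y)) has_integral (f (x + h, y) - f (x, y))) {x..x + h}"
    by (rule fundamental_theorem_of_calculus)
       (use h has_pdxD(3)[OF f xy(2,3)] in \<open>auto simp: has_real_derivative_iff_has_vector_derivative[symmetric] intro: has_field_derivative_at_within\<close>)
  then show ?thesis
    using average_eq_window[OF continuous_on_strip_line[OF has_pdxD(2)[OF f] xy(2,3)], of h x]
    by (simp add: xy(1) steklov_def translate_def integral_unique)
qed

lemma has_pdx_steklov:
  assumes f: "has_pdx f f'" and h: "0 < h"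
  shows "has_pdx (steklov h f) (steklov h f')"
  by (rule has_pdx_cong[OF has_pdx_steklov_quotient[OF has_pdxD(1)[OF f] h]]) (rule steklov_pdx[OF f h])

lemma has_pdy_steklov:
  assumes f: "has_pdy f f'"
  shows "has_pdy (steklov h f) (steklov h f')"
proof -
  have "((\<lambda>s. steklov h f (x, s)) has_real_derivative steklov h f' (x, y)) (at y)"
    if y: "-1 < y" "y < 1" for x y
  proof -
    have g: "has_pdy (translate x f) (translate x f')" by (rule has_pdy_translate[OF f])
    show ?thesis
      using DERIV_cdivide[OF DERIV_slice[OF g y, of h], of h]
      by (simp add: slice_def[abs_def] steklov_def average_def translate_def add.commute)
  qed
  then show ?thesis using continuous_on_steklov_strip(1) has_pdyD[OF f] by (simp add: has_pdy_def)
qed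

lemma steklov_linear:
  assumes "continuous_on strip f" "continuous_on strip g" "z \<in> strip"
  shows "steklov h (\<lambda>z. f z + g z) z = steklov h f z + steklov h g z"
    "steklov h (\<lambda>z. f z - g z) z = steklov h f z - steklov h g z"
proof -
  obtain x y where xy: "z = (x, y)" "-1 < y" "y < 1" using assms(3) by (cases z) auto
  have i: "(\<lambda>s. f (x + s, y)) integrable_on {0..h}" "(\<lambda>s. g (x + s, y)) integrable_on {0..h}"
    using continuous_on_strip_line[OF assms(1) xy(2,3)] continuous_on_strip_line[OF assms(2) xy(2,3)]
    by (auto intro!: integrable_continuous_real continuous_on_translate[of "\<lambda>x. f (x, y)"] continuous_on_translate[of "\<lambda>x. g (x, y)"])
  show "steklov h (\<lambda>z. f z + g z) z = steklov h f z + steklov h g z"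
    "steklov h (\<lambda>z. f z - g z) z = steklov h f z - steklov h g z"
    using i by (simp_all add: steklov_def average_def xy(1) integral_add integral_diff add_divide_distrib diff_divide_distrib)
qed

lemma steklov_cong:
  "(\<And>z. z \<in> strip \<Longrightarrow> f z = g z) \<Longrightarrow> z \<in> strip \<Longrightarrow> steklov h f z = steklov h g z"
  by (cases z) (simp add: steklov_def average_def)

lemma steklov_cmult: "steklov h (\<lambda>z. c * f z) z = c * steklov h f z"
  by (simp add: steklov_def average_def)

lemma steklov_const: "0 < h \<Longrightarrow> steklov h (\<lambda>z. c) z = c"
  by (simp add: steklov_def average_def)

lemma steklov_bound:
  assumes f: "continuous_on (UNIV \<times> J) f" and y: "y \<in> J" and h: "0 < h"
    and C: "\<And>s. 0 \<le> s \<Longrightarrow> s \<le> h \<Longrightarrow> \<bar>f (x + s, y) - c\<bar> \<le> C"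
  shows "\<bar>steklov h f (x, y) - c\<bar> \<le> C"
  using average_bound[OF continuous_on_line[OF f y] h, of x c C] C by (simp add: steklov_def)

lemma slice_steklov:
  assumes "continuous_on strip f" "x_periodic_on strip T f" "0 < h" "0 < T" "-1 < y" "y < 1"
  shows "slice T (steklov h f) y = slice T f y"
    "slice T (\<lambda>z. (steklov h f z)\<^sup>2) y \<le> slice T (\<lambda>z. (f z)\<^sup>2) y"
  using integral_average[OF continuous_on_strip_line[OF assms(1,5,6)] shift_periodic_strip_line[OF assms(2,5,6)] assms(3,4)]
    integral_average_square_le[OF continuous_on_strip_line[OF assms(1,5,6)] shift_periodic_strip_line[OF assms(2,5,6)] assms(3,4)]
  by (auto simp: slice_def steklov_def)

lemma slice_translate:
  assumes "continuous_on strip f" "x_periodic_on strip T f" "0 < T" "-1 < y" "y < 1"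
  shows "slice T (translate k f) y = slice T f y"
  using integral_shift_periodic[OF continuous_on_strip_line[OF assms(1,4,5)] shift_periodic_strip_line[OF assms(2,4,5)] assms(3)]
  by (simp add: slice_def translate_def)

text \<open>Each average pays for one tangential derivative. In \<open>mollified_bounds\<close> two
  are spent on \<open>z2xx\<close>, which bounds the pressure, and the third on the derivative
  \<open>qx\<close> in the first momentum equation.\<close>

definition mollify :: "real \<Rightarrow> (real \<times> real \<Rightarrow> real) \<Rightarrow> real \<times> real \<Rightarrow> real" where
  "mollify h f = steklov h (steklov h (steklov h f))"

lemma continuous_on_mollify:
  "continuous_on strip f \<Longrightarrow> continuous_on strip (mollify h f)"
  "continuous_on closed_strip f \<Longrightarrow> continuous_on closed_strip (mollify h f)"
  by (simp_all add: mollify_def continuous_on_steklov_strip)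

lemma x_periodic_on_mollify:
  "x_periodic_on strip T f \<Longrightarrow> x_periodic_on strip T (mollify h f)"
  "x_periodic_on closed_strip T f \<Longrightarrow> x_periodic_on closed_strip T (mollify h f)"
  by (simp_all add: mollify_def x_periodic_intros)

lemma has_pdx_mollify: "has_pdx f f' \<Longrightarrow> 0 < h \<Longrightarrow> has_pdx (mollify h f) (mollify h f')"
  by (simp add: mollify_def has_pdx_steklov)

lemma has_pdy_mollify: "has_pdy f f' \<Longrightarrow> has_pdy (mollify h f) (mollify h f')"
  by (simp add: mollify_def has_pdy_steklov)

lemma mollify_cong:
  "(\<And>z. z \<in> strip \<Longrightarrow> f z = g z) \<Longrightarrow> z \<in> strip \<Longrightarrow> mollify h f z = mollify h g z"
  unfolding mollify_def by (intro steklov_cong)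

lemma mollify_linear:
  assumes "continuous_on strip f" "continuous_on strip g" "z \<in> strip"
  shows "mollify h (\<lambda>z. f z + g z) z = mollify h f z + mollify h g z"
    "mollify h (\<lambda>z. f z - g z) z = mollify h f z - mollify h g z"
proof -
  note c = assms(1,2) continuous_on_steklov_strip(1)[OF assms(1)] continuous_on_steklov_strip(1)[OF assms(2)]
  note c2 = c continuous_on_steklov_strip(1)[OF c(3)] continuous_on_steklov_strip(1)[OF c(4)]
  have "mollify h (\<lambda>z. f z + g z) z = steklov h (\<lambda>z. steklov h (steklov h f) z + steklov h (steklov h g) z) z"
    unfolding mollify_def
  proof (rule steklov_cong[OF _ assms(3)])
    fix z :: "real \<times> real" assume z: "z \<in> strip"
    have "steklov h (steklov h (\<lambda>z. f z + g z)) z = steklov h (\<lambda>z. steklov h f z + steklov h g z) z"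
      by (rule steklov_cong[OF steklov_linear(1)[OF c(1,2)] z])
    then show "steklov h (steklov h (\<lambda>z. f z + g z)) z = steklov h (steklov h f) z + steklov h (steklov h g) z"
      using steklov_linear(1)[OF c(3,4) z] by simp
  qed
  then show "mollify h (\<lambda>z. f z + g z) z = mollify h f z + mollify h g z"
    using steklov_linear(1)[OF c2(5,6) assms(3)] by (simp add: mollify_def)
  have "mollify h (\<lambda>z. f z - g z) z = steklov h (\<lambda>z. steklov h (steklov h f) z - steklov h (steklov h g) z) z"
    unfolding mollify_def
  proof (rule steklov_cong[OF _ assms(3)])
    fix z :: "real \<times> real" assume z: "z \<in> strip"
    have "steklov h (steklov h (\<lambda>z. f z - g z)) z = steklov h (\<lambda>z. steklov h f z - steklov h g z) z"
      by (rule steklov_cong[OF steklov_linear(2)[OF c(1,2)] z])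
    then show "steklov h (steklov h (\<lambda>z. f z - g z)) z = steklov h (steklov h f) z - steklov h (steklov h g) z"
      using steklov_linear(2)[OF c(3,4) z] by simp
  qed
  then show "mollify h (\<lambda>z. f z - g z) z = mollify h f z - mollify h g z"
    using steklov_linear(2)[OF c2(5,6) assms(3)] by (simp add: mollify_def)
qed

lemma mollify_cmult: "mollify h (\<lambda>z. c * f z) z = c * mollify h f z"
  by (simp add: mollify_def steklov_cmult[abs_def])

lemma mollify_const: "0 < h \<Longrightarrow> mollify h (\<lambda>z. c) z = c"
proof -
  assume "0 < h"
  then have "steklov h (\<lambda>z. c) = (\<lambda>z. c)" by (simp add: fun_eq_iff steklov_const)
  then show ?thesis by (simp add: mollify_def)
qed

lemma slice_mollify:
  assumes "continuous_on strip f" "x_periodic_on strip T f" "0 < h" "0 < T" "-1 < y" "y < 1"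
  shows "slice T (mollify h f) y = slice T f y"
    "slice T (\<lambda>z. (mollify h f z)\<^sup>2) y \<le> slice T (\<lambda>z. (f z)\<^sup>2) y"
proof -
  note c1 = continuous_on_steklov_strip(1)[OF assms(1), of h] and p1 = x_periodic_intros(11)[OF assms(2), of h]
  note c2 = continuous_on_steklov_strip(1)[OF c1, of h] and p2 = x_periodic_intros(11)[OF p1, of h]
  show "slice T (mollify h f) y = slice T f y"
    using slice_steklov(1)[OF assms] slice_steklov(1)[OF c1 p1 assms(3-6)] slice_steklov(1)[OF c2 p2 assms(3-6)]
    by (simp add: mollify_def)
  show "slice T (\<lambda>z. (mollify h f z)\<^sup>2) y \<le> slice T (\<lambda>z. (f z)\<^sup>2) y"
    using slice_steklov(2)[OF assms] slice_steklov(2)[OF c1 p1 assms(3-6)] slice_steklov(2)[OF c2 p2 assms(3-6)]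
    by (simp add: mollify_def)
qed

lemma mollify_bound:
  assumes f: "continuous_on (UNIV \<times> J) f" and y: "y \<in> J" and h: "0 < h"
    and C: "\<And>s. 0 \<le> s \<Longrightarrow> s \<le> 3 * h \<Longrightarrow> \<bar>f (x + s, y) - c\<bar> \<le> C"
  shows "\<bar>mollify h f (x, y) - c\<bar> \<le> C"
proof -
  note c1 = continuous_on_steklov[OF f, of h] 
  note c2 = continuous_on_steklov[OF c1, of h]
  have 1: "\<bar>steklov h f (x + s, y) - c\<bar> \<le> C" if "0 \<le> s" "s \<le> 2 * h" for s
    by (rule steklov_bound[OF f y h]) (use that C in \<open>simp add: add.assoc\<close>)
  have 2: "\<bar>steklov h (steklov h f) (x + s, y) - c\<bar> \<le> C" if "0 \<le> s" "s \<le> h" for s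
    by (rule steklov_bound[OF c1 y h]) (use that 1 in \<open>simp add: add.assoc\<close>)
  show ?thesis unfolding mollify_def
    by (rule steklov_bound[OF c2 y h]) (use 2 in simp)
qed

text \<open>A triple average of width h reads values up to distance 3 * h, whence the factor 3: the
  reach is 1 / (n + 1).\<close>

definition step :: "nat \<Rightarrow> real" where "step n = 1 / (3 * real (Suc n))"

lemma step_pos [simp]: "0 < step n"
  by (simp add: step_def)

lemma step_eventually_le: "0 < h \<Longrightarrow> eventually (\<lambda>n. 3 * step n \<le> h) sequentially"
proof -
  assume h: "0 < h"
  have "(\<lambda>n. 3 * step n) \<longlonglongrightarrow> 0"
    using LIMSEQ_inverse_real_of_nat unfolding step_def by (simp add: inverse_eq_divide del: of_nat_Suc)
  then have "eventually (\<lambda>n. 3 * step n < h) sequentially" using h by (rule order_tendstoD)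
  then show ?thesis by eventually_elim simp
qed

text \<open>The set \<open>J\<close> will be the interval {-1..1} for functions continuous up to the
  walls, and a single point for derivatives, whose continuity is known only in the open
  strip.\<close>

lemma mollify_uniform:
  assumes c: "continuous_on (UNIV \<times> J) f" and J: "compact J"
    and per: "x_periodic_on (UNIV \<times> J) T f" and T: "0 < T" and e: "0 < e"
  shows "eventually (\<lambda>n. \<forall>x. \<forall>y\<in>J. \<bar>mollify (step n) f (x, y) - f (x, y)\<bar> \<le> e) sequentially"
    "eventually (\<lambda>n. \<forall>x. \<forall>y\<in>J. \<bar>steklov (step n) f (x, y) - f (x, y)\<bar> \<le> e) sequentially"
proof -
  obtain h0 where h0: "h0 > 0" "\<And>x y s. y \<in> J \<Longrightarrow> 0 \<le> s \<Longrightarrow> s \<le> h0 \<Longrightarrow> \<bar>f (x + s, y) - f (x, y)\<bar> \<le> e"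
    using periodic_uniform_modulus[OF assms] by metis
  note ev = step_eventually_le[OF h0(1)]
  show "eventually (\<lambda>n. \<forall>x. \<forall>y\<in>J. \<bar>mollify (step n) f (x, y) - f (x, y)\<bar> \<le> e) sequentially"
    using ev by eventually_elim (auto intro!: mollify_bound[OF c] h0(2))
  show "eventually (\<lambda>n. \<forall>x. \<forall>y\<in>J. \<bar>steklov (step n) f (x, y) - f (x, y)\<bar> \<le> e) sequentially"
    using ev
  proof eventually_elim
    case (elim n)
    then have "step n \<le> h0" using step_pos[of n] by linarith
    then show ?case by (auto intro!: steklov_bound[OF c] h0(2))
  qed
qed

text \<open>Convergence is asked line by line, because derivatives may be unbounded at the walls.
  The continuity clauses make the notion stable under products and allow the passage to the limit in
  \<open>slice\<close>.\<close>

definition line_limit :: "real \<Rightarrow> real \<Rightarrow> (nat \<Rightarrow> real \<times> real \<Rightarrow> real) \<Rightarrow> (real \<times> real \<Rightarrow> real) \<Rightarrow> bool" where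
  "line_limit T y F f \<longleftrightarrow> continuous_on {0..T} (\<lambda>x. f (x, y)) \<and> (\<forall>n. continuous_on {0..T} (\<lambda>x. F n (x, y))) \<and>
     uniform_limit {0..T} (\<lambda>n x. F n (x, y)) (\<lambda>x. f (x, y)) sequentially"

lemma line_limit_const: "continuous_on strip f \<Longrightarrow> -1 < y \<Longrightarrow> y < 1 \<Longrightarrow> line_limit T y (\<lambda>n. f) f"
  by (auto simp: line_limit_def intro: continuous_on_strip_line uniform_limit_const)

lemma line_limit_add: "line_limit T y F f \<Longrightarrow> line_limit T y G g \<Longrightarrow> line_limit T y (\<lambda>n z. F n z + G n z) (\<lambda>z. f z + g z)"
  by (auto simp: line_limit_def intro!: continuous_intros uniform_limit_add)

lemma line_limit_mult: "line_limit T y F f \<Longrightarrow> line_limit T y G g \<Longrightarrow> line_limit T y (\<lambda>n z. F n z * G n z) (\<lambda>z. f z * g z)"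
  by (auto simp: line_limit_def intro!: continuous_intros uniform_lim_mult compact_imp_bounded compact_continuous_image)

lemma line_limit_power2: "line_limit T y F f \<Longrightarrow> line_limit T y (\<lambda>n z. (F n z)\<^sup>2) (\<lambda>z. (f z)\<^sup>2)"
  unfolding power2_eq_square by (rule line_limit_mult)

lemma line_limit_slice:
  assumes "line_limit T y F f"
  shows "(\<lambda>n. slice T (F n) y) \<longlonglongrightarrow> slice T f y"
proof -
  obtain I J where "\<And>n. ((\<lambda>x. F n (x, y)) has_integral I n) {0..T}" "((\<lambda>x. f (x, y)) has_integral J) {0..T}" "I \<longlonglongrightarrow> J"
    using uniform_limit_integral[where a=0 and b=T and f="\<lambda>n x. F n (x, y)" and g="\<lambda>x. f (x, y)" and F=sequentially] assms
    unfolding line_limit_def by (metis trivial_limit_sequentially)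
  then have "I = (\<lambda>n. slice T (F n) y)" "J = slice T f y" "I \<longlonglongrightarrow> J"
    by (auto simp: slice_def fun_eq_iff integral_unique[symmetric])
  then show ?thesis by simp
qed

lemma line_limit_mollify:
  assumes "continuous_on strip f" "x_periodic_on strip T f" "0 < T" "-1 < y" "y < 1"
  shows "line_limit T y (\<lambda>n. mollify (step n) f) f" "line_limit T y (\<lambda>n. steklov (step n) f) f"
proof -
  have c: "continuous_on (UNIV \<times> {y}) f" by (rule continuous_on_subset[OF assms(1)]) (use assms in auto)
  have p: "x_periodic_on (UNIV \<times> {y}) T f" using assms by (auto simp: x_periodic_on_def)
  note u = mollify_uniform[OF c _ p assms(3)]
  have "uniform_limit {0..T} (\<lambda>n x. mollify (step n) f (x, y)) (\<lambda>x. f (x, y)) sequentially"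
    unfolding uniform_limit_iff
  proof (intro allI impI)
    fix e :: real assume e: "0 < e"
    then have "\<forall>\<^sub>F n in sequentially. \<forall>x. \<bar>mollify (step n) f (x, y) - f (x, y)\<bar> \<le> e / 2"
      using u(1)[of "e / 2"] by simp
    then show "\<forall>\<^sub>F n in sequentially. \<forall>x\<in>{0..T}. dist (mollify (step n) f (x, y)) (f (x, y)) < e"
    proof eventually_elim
      case (elim n)
      have "dist (mollify (step n) f (x, y)) (f (x, y)) < e" for x using elim[rule_format, of x] e unfolding dist_real_def by linarith
      then show ?case by blast
    qed
  qed
  then show "line_limit T y (\<lambda>n. mollify (step n) f) f"
    using assms continuous_on_mollify(1)[OF assms(1)] by (auto simp: line_limit_def intro!: continuous_on_strip_line)
  have "uniform_limit {0..T} (\<lambda>n x. steklov (step n) f (x, y)) (\<lambda>x. f (x, y)) sequentially"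
    unfolding uniform_limit_iff
  proof (intro allI impI)
    fix e :: real assume e: "0 < e"
    then have "\<forall>\<^sub>F n in sequentially. \<forall>x. \<bar>steklov (step n) f (x, y) - f (x, y)\<bar> \<le> e / 2"
      using u(2)[of "e / 2"] by simp
    then show "\<forall>\<^sub>F n in sequentially. \<forall>x\<in>{0..T}. dist (steklov (step n) f (x, y)) (f (x, y)) < e"
    proof eventually_elim
      case (elim n)
      have "dist (steklov (step n) f (x, y)) (f (x, y)) < e" for x using elim[rule_format, of x] e unfolding dist_real_def by linarith
      then show ?case by blast
    qed
  qed
  then show "line_limit T y (\<lambda>n. steklov (step n) f) f"
    using assms continuous_on_steklov_strip(1)[OF assms(1)] by (auto simp: line_limit_def intro!: continuous_on_strip_line)
qed

section \<open>The Stokes system on the strip\<close>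

lemma strip_bounded_add:
  assumes "strip_bounded f" "strip_bounded g"
  shows "strip_bounded (\<lambda>z. f z + g z)"
proof -
  obtain C D where "\<And>z. z \<in> strip \<Longrightarrow> \<bar>f z\<bar> \<le> C" "\<And>z. z \<in> strip \<Longrightarrow> \<bar>g z\<bar> \<le> D"
    using assms unfolding strip_bounded_def by blast
  then show ?thesis unfolding strip_bounded_def
    by (intro exI[of _ "C + D"] ballI order_trans[OF abs_triangle_ineq] add_mono)
qed

lemma strip_bounded_mult:
  assumes "strip_bounded f" "strip_bounded g"
  shows "strip_bounded (\<lambda>z. f z * g z)"
proof -
  obtain C D where C: "\<And>z. z \<in> strip \<Longrightarrow> \<bar>f z\<bar> \<le> C" and D: "\<And>z. z \<in> strip \<Longrightarrow> \<bar>g z\<bar> \<le> D"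
    using assms unfolding strip_bounded_def by blast
  have "0 \<le> C" using C[of "(0, 0)"] by simp
  then show ?thesis unfolding strip_bounded_def
    using C D by (intro exI[of _ "C * D"]) (simp add: abs_mult mult_mono)
qed

lemma strip_bounded_const: "strip_bounded (\<lambda>z. c)"
  unfolding strip_bounded_def by auto

lemma strip_bounded_cmult: "strip_bounded f \<Longrightarrow> strip_bounded (\<lambda>z. c * f z)"
  by (rule strip_bounded_mult[OF strip_bounded_const])

lemma strip_bounded_minus: "strip_bounded f \<Longrightarrow> strip_bounded (\<lambda>z. - f z)"
  unfolding strip_bounded_def by simp

lemma strip_bounded_diff: "strip_bounded f \<Longrightarrow> strip_bounded g \<Longrightarrow> strip_bounded (\<lambda>z. f z - g z)"
  using strip_bounded_add[OF _ strip_bounded_minus] by simp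

lemma strip_bounded_cong: "strip_bounded f \<Longrightarrow> (\<And>z. z \<in> strip \<Longrightarrow> g z = f z) \<Longrightarrow> strip_bounded g"
  unfolding strip_bounded_def by simp

lemma strip_bounded_translate: "strip_bounded f \<Longrightarrow> strip_bounded (translate k f)"
  unfolding strip_bounded_def translate_def by (auto simp: strip_def)

lemma strip_bounded_steklov:
  assumes "strip_bounded f" "continuous_on strip f" "0 < h"
  shows "strip_bounded (steklov h f)"
proof -
  obtain C where C: "\<And>z. z \<in> strip \<Longrightarrow> \<bar>f z\<bar> \<le> C" using assms(1) unfolding strip_bounded_def by blast
  have "\<bar>steklov h f (x, y) - 0\<bar> \<le> C" if "y \<in> {-1<..<1}" for x y
    by (rule steklov_bound[OF assms(2)[unfolded strip_def] that assms(3)]) (use that C in auto)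
  then show ?thesis unfolding strip_bounded_def by (intro exI[of _ C]) (auto simp: strip_def)
qed

lemma strip_bounded_mollify:
  assumes "strip_bounded f" "continuous_on strip f" "0 < h"
  shows "strip_bounded (mollify h f)"
  unfolding mollify_def
  by (intro strip_bounded_steklov continuous_on_steklov_strip assms)

lemma strip_bounded_steklov_pdx:
  assumes "has_pdx f f'" "strip_bounded f" "0 < h"
  shows "strip_bounded (steklov h f')"
proof (rule strip_bounded_cong)
  show "strip_bounded (\<lambda>z. (1 / h) * (translate h f z - f z))"
    by (intro strip_bounded_cmult strip_bounded_diff strip_bounded_translate assms)
  show "steklov h f' z = (1 / h) * (translate h f z - f z)" if "z \<in> strip" for z
    using steklov_pdx[OF assms(1,3) that] by simp
qed

lemma strip_bounded_mollify_pdx: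
  assumes "has_pdx f f'" "strip_bounded f" "0 < h"
  shows "strip_bounded (mollify h f')"
  unfolding mollify_def
  by (intro strip_bounded_steklov[OF strip_bounded_steklov[OF strip_bounded_steklov_pdx[OF assms]]]
    continuous_on_steklov_strip has_pdxD(2)[OF assms(1)] assms(3))

text \<open>Periodicity and compactness bound \<open>f\<close> on the line y = 0; from there every
  point is reached over a distance less than 1 in the normal direction.\<close>

lemma strip_bounded_pdy:
  assumes f: "has_pdy f f'" and b: "strip_bounded f'" and per: "x_periodic_on strip T f" and T: "0 < T"
  shows "strip_bounded f"
proof -
  obtain C where C: "\<And>z. z \<in> strip \<Longrightarrow> \<bar>f' z\<bar> \<le> C" using b unfolding strip_bounded_def by blast
  have "continuous_on (UNIV \<times> {0}) f" "x_periodic_on (UNIV \<times> {0}) T f"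
    using has_pdyD(1)[OF f] per by (auto simp: x_periodic_on_def strip_def intro: continuous_on_subset)
  then obtain D where D: "\<And>x. \<bar>f (x, 0)\<bar> \<le> D" using periodic_bounded[of "{0}" f T] T by auto
  have C0: "0 \<le> C" using C[of "(0, 0)"] by simp
  have "\<bar>f (x, y)\<bar> \<le> D + C" if y: "-1 < y" "y < 1" for x y
  proof -
    have "norm (f (x, y) - f (x, 0)) \<le> C * norm (y - 0)"
      by (rule field_differentiable_bound[where S="{-1<..<1}" and f="\<lambda>y. f (x, y)" and f'="\<lambda>y. f' (x, y)"])
         (use y C has_pdyD(3)[OF f] in \<open>auto intro: has_field_derivative_at_within\<close>)
    also have "\<dots> \<le> C * 1" using y C0 by (intro mult_left_mono) auto
    finally show ?thesis using D[of x] by (simp add: abs_le_iff)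
  qed
  then show ?thesis unfolding strip_bounded_def by (intro exI[of _ "D + C"]) auto
qed

lemma x_periodic_on_pdx:
  assumes f: "has_pdx f f'" and per: "x_periodic_on strip T f"
  shows "x_periodic_on strip T f'"
proof -
  have "translate T f z = f z" if "z \<in> strip" for z
    using per that by (cases z) (simp add: x_periodic_on_def translate_def)
  then have "((\<lambda>s. f (s, y)) has_real_derivative translate T f' (x, y)) (at x)" if "-1 < y" "y < 1" for x y
    using has_pdxD(3)[OF has_pdx_translate[OF f, of T] that, of x] that by simp
  then have "translate T f' (x, y) = f' (x, y)" if "-1 < y" "y < 1" for x y
    using DERIV_unique[OF _ has_pdxD(3)[OF f that]] that by blast
  then have "f' (x + T, y) = f' (x, y)" if "-1 < y" "y < 1" for x y
    using that by (simp add: translate_def)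
  then show ?thesis by (simp add: x_periodic_on_def)
qed

lemma x_periodic_on_pdy:
  assumes f: "has_pdy f f'" and per: "x_periodic_on strip T f"
  shows "x_periodic_on strip T f'"
proof -
  have "f' (x + T, y) = f' (x, y)" if y: "-1 < y" "y < 1" for x y
  proof (rule DERIV_unique[OF _ has_pdyD(3)[OF f y]])
    show "((\<lambda>s. f (x, s)) has_real_derivative f' (x + T, y)) (at y)"
    proof (rule has_field_derivative_transform_within_open[OF has_pdyD(3)[OF f y]])
      show "f (x + T, s) = f (x, s)" if "s \<in> {-1<..<1}" for s
        using per that by (simp add: x_periodic_on_def)
    qed (use y in auto)
  qed
  then show ?thesis by (simp add: x_periodic_on_def)
qed

lemma strip_bounded_slice_integrable:
  assumes f: "continuous_on strip f" and b: "strip_bounded f" and T: "0 \<le> T"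
  shows "slice T f integrable_on {-1<..<1}"
proof -
  obtain C where C: "\<And>z. z \<in> strip \<Longrightarrow> \<bar>f z\<bar> \<le> C" using b unfolding strip_bounded_def by blast
  show ?thesis
  proof (rule Ioo_integrableI_bounded[OF continuous_on_slice[OF f] integrable_const_Ioo])
    show "\<bar>slice T f y\<bar> \<le> C * T" if "y \<in> {-1<..<1}" for y
      using slice_abs_le[OF f, of "\<lambda>_. C" y T] that C T by (simp add: slice_const)
  qed
qed

text \<open>Mollification does not commute with products, but both expressions are uniformly close
  to the unmollified product, since all factors are periodic and continuous on the closed strip.
  This commutator is the error \<open>e\<close> in \<open>energy_balance\<close>.\<close>

lemma mollify_product_approx:
  assumes "continuous_on closed_strip a" "continuous_on closed_strip b" "continuous_on closed_strip f" "continuous_on closed_strip g"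
    and "x_periodic_on closed_strip T a" "x_periodic_on closed_strip T b" "x_periodic_on closed_strip T f" "x_periodic_on closed_strip T g"
    and T: "0 < T" and e: "0 < e"
  shows "eventually (\<lambda>n. \<forall>z\<in>strip. \<bar>mollify (step n) (\<lambda>z. a z * f z + g z * b z) z -
      (a z * mollify (step n) f z + mollify (step n) g z * b z)\<bar> \<le> e) sequentially"
proof -
  obtain A where A: "\<And>z. z \<in> strip \<Longrightarrow> \<bar>a z\<bar> \<le> A" using strip_bounded_closed[OF assms(1,5) T] unfolding strip_bounded_def by blast
  obtain B where B: "\<And>z. z \<in> strip \<Longrightarrow> \<bar>b z\<bar> \<le> B" using strip_bounded_closed[OF assms(2,6) T] unfolding strip_bounded_def by blast
  have AB: "0 \<le> A" "0 \<le> B" using A[of "(0,0)"] B[of "(0,0)"] by simp_all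
  \<comment> \<open>The three deviations contribute d, A * d and d * B, which add up to
    \<open>e\<close>.\<close>
  define d where "d = e / (1 + A + B)"
  have d: "0 < d" using e AB by (simp add: d_def)
  let ?G = "\<lambda>z. a z * f z + g z * b z"
  have Gc: "continuous_on closed_strip ?G" using assms by (intro continuous_intros)
  have Gp: "x_periodic_on closed_strip T ?G" using assms by (intro x_periodic_intros)
  have ev: "eventually (\<lambda>n. \<forall>z\<in>strip. \<bar>mollify (step n) k z - k z\<bar> \<le> d) sequentially"
    if "continuous_on closed_strip k" "x_periodic_on closed_strip T k" for k
  proof -
    have "eventually (\<lambda>n. \<forall>x. \<forall>y\<in>{-1..1}. \<bar>mollify (step n) k (x, y) - k (x, y)\<bar> \<le> d) sequentially"
      using mollify_uniform(1)[of "{-1..1}" k T d] that T d by (simp add: closed_strip_def)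
    then show ?thesis by (rule eventually_mono) auto
  qed
  show ?thesis using ev[OF Gc Gp] ev[OF assms(3,7)] ev[OF assms(4,8)]
  proof eventually_elim
    case (elim n)
    show ?case
    proof
      fix z assume z: "z \<in> strip"
      have eq: "mollify (step n) ?G z - (a z * mollify (step n) f z + mollify (step n) g z * b z) =
        (mollify (step n) ?G z - ?G z) - a z * (mollify (step n) f z - f z) - (mollify (step n) g z - g z) * b z"
        by (simp add: algebra_simps)
      have m: "\<bar>a z * (mollify (step n) f z - f z)\<bar> \<le> A * d" "\<bar>(mollify (step n) g z - g z) * b z\<bar> \<le> d * B"
        unfolding abs_mult using elim[THEN bspec, OF z] A[OF z] B[OF z] AB d by (auto intro!: mult_mono)
      have "\<bar>mollify (step n) ?G z - (a z * mollify (step n) f z + mollify (step n) g z * b z)\<bar> \<le> d + A * d + d * B"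
        unfolding eq using elim(1)[THEN bspec, OF z] m by linarith
      also have "d + A * d + d * B = d * (1 + A + B)" by (simp add: algebra_simps)
      also have "\<dots> = e" using AB by (simp add: d_def)
      finally show "\<bar>mollify (step n) ?G z - (a z * mollify (step n) f z + mollify (step n) g z * b z)\<bar> \<le> e" .
    qed
  qed
qed

text \<open>The pressure is split into a periodic part \<open>q\<close> and a constant mean gradient \<open>c\<close>.\<close>

locale stokes =
  fixes T c :: real and z1 z1x z1y z1xx z1yy z2 z2x z2y z2xx z2yy q qx qy f1 f2 :: "real \<times> real \<Rightarrow> real"
  assumes T: "0 < T"
    and z1x: "has_pdx z1 z1x" and z1y: "has_pdy z1 z1y" and z1xx: "has_pdx z1x z1xx" and z1yy: "has_pdy z1y z1yy"
    and z2x: "has_pdx z2 z2x" and z2y: "has_pdy z2 z2y" and z2xx: "has_pdx z2x z2xx" and z2yy: "has_pdy z2y z2yy"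
    and qx: "has_pdx q qx" and qy: "has_pdy q qy"
    and fc: "continuous_on strip f1" "continuous_on strip f2"
    and zc: "continuous_on closed_strip z1" "continuous_on closed_strip z2"
    and zper: "x_periodic_on closed_strip T z1" "x_periodic_on closed_strip T z2"
    and qper: "x_periodic_on strip T q"
    and z0: "\<And>x. z1 (x, 1) = 0" "\<And>x. z1 (x, -1) = 0" "\<And>x. z2 (x, 1) = 0" "\<And>x. z2 (x, -1) = 0"
    and div0: "\<And>z. z \<in> strip \<Longrightarrow> z1x z + z2y z = 0"
    and eq1: "\<And>z. z \<in> strip \<Longrightarrow> z1xx z + z1yy z = qx z + c + f1 z"
    and eq2: "\<And>z. z \<in> strip \<Longrightarrow> z2xx z + z2yy z = qy z + f2 z"
begin

lemmas T0 = less_imp_le[OF T]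
lemmas zper' = zper[THEN x_periodic_on_strip]
lemmas gper = x_periodic_on_pdx[OF z1x zper'(1)] x_periodic_on_pdy[OF z1y zper'(1)]
  x_periodic_on_pdx[OF z2x zper'(2)] x_periodic_on_pdy[OF z2y zper'(2)]

text \<open>The weak form of the system. For a divergence-free field w the pressure term is itself a
  divergence, and the bounds on \<open>z1y\<close>, \<open>z2y\<close> and \<open>q\<close> make the
  fluxes through horizontal lines vanish at the walls together with w.\<close>

lemma test:
  assumes b: "strip_bounded z1y" "strip_bounded z2y" "strip_bounded q"
    and w: "has_pdx w1 w1x" "has_pdy w1 w1y" "has_pdx w2 w2x" "has_pdy w2 w2y"
    and wc: "continuous_on closed_strip w1" "continuous_on closed_strip w2"
    and wper: "x_periodic_on strip T w1" "x_periodic_on strip T w2"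
    and w0: "\<And>x. w1 (x, 1) = 0" "\<And>x. w1 (x, -1) = 0" "\<And>x. w2 (x, 1) = 0" "\<And>x. w2 (x, -1) = 0"
    and wdiv: "\<And>z. z \<in> strip \<Longrightarrow> w1x z + w2y z = 0"
  shows "(slice T (\<lambda>z. z1x z * w1x z + z1y z * w1y z + z2x z * w2x z + z2y z * w2y z + (f1 z + c) * w1 z + f2 z * w2 z)
    has_integral 0) {-1<..<1}"
proof -
  obtain C1 where C1: "\<And>z. z \<in> strip \<Longrightarrow> \<bar>z1y z\<bar> \<le> C1" using b unfolding strip_bounded_def by blast
  obtain C2 where C2: "\<And>z. z \<in> strip \<Longrightarrow> \<bar>z2y z\<bar> \<le> C2" using b unfolding strip_bounded_def by blast
  obtain C3 where C3: "\<And>z. z \<in> strip \<Longrightarrow> \<bar>q z\<bar> \<le> C3" using b unfolding strip_bounded_def by blast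
  note A = has_pdx_diff[OF has_pdx_add[OF has_pdx_mult[OF z1xx w(1)] has_pdx_mult[OF z2xx w(3)]] has_pdx_mult[OF qx w(1)]]
  note B = has_pdy_diff[OF has_pdy_add[OF has_pdy_mult[OF z1yy w(2)] has_pdy_mult[OF z2yy w(4)]] has_pdy_mult[OF qy w(4)]]
  show ?thesis
  proof (rule divergence_has_integral_0[OF A _ B T0, where w="\<lambda>z. \<bar>w1 z\<bar> + \<bar>w2 z\<bar>" and C="C1 + C2 + C3"])
    show "x_periodic_on strip T (\<lambda>z. z1x z * w1 z + z2x z * w2 z - q z * w1 z)"
      by (intro x_periodic_intros gper wper qper)
    show "continuous_on closed_strip (\<lambda>z. \<bar>w1 z\<bar> + \<bar>w2 z\<bar>)" by (intro continuous_intros wc)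
    fix z assume z: "z \<in> strip"
    have "\<bar>z1y z * w1 z + z2y z * w2 z - q z * w2 z\<bar> \<le> \<bar>z1y z\<bar> * \<bar>w1 z\<bar> + \<bar>z2y z\<bar> * \<bar>w2 z\<bar> + \<bar>q z\<bar> * \<bar>w2 z\<bar>"
      unfolding abs_mult[symmetric] by linarith
    also have "\<dots> \<le> C1 * (\<bar>w1 z\<bar> + \<bar>w2 z\<bar>) + C2 * (\<bar>w1 z\<bar> + \<bar>w2 z\<bar>) + C3 * (\<bar>w1 z\<bar> + \<bar>w2 z\<bar>)"
      using C1[OF z] C2[OF z] C3[OF z] by (intro add_mono mult_mono) auto
    finally show "\<bar>z1y z * w1 z + z2y z * w2 z - q z * w2 z\<bar> \<le> (C1 + C2 + C3) * \<bar>\<bar>w1 z\<bar> + \<bar>w2 z\<bar>\<bar>"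
      by (simp add: algebra_simps)
    have eqs: "z1xx z = qx z + c + f1 z - z1yy z" "z2xx z = qy z + f2 z - z2yy z" "w2y z = - w1x z"
      using eq1[OF z] eq2[OF z] wdiv[OF z] by auto
    show "z1xx z * w1 z + z1x z * w1x z + (z2xx z * w2 z + z2x z * w2x z) - (qx z * w1 z + q z * w1x z) +
        (z1yy z * w1 z + z1y z * w1y z + (z2yy z * w2 z + z2y z * w2y z) - (qy z * w2 z + q z * w2y z)) =
        z1x z * w1x z + z1y z * w1y z + z2x z * w2x z + z2y z * w2y z + (f1 z + c) * w1 z + f2 z * w2 z"
      unfolding eqs by (simp add: algebra_simps)
  qed (simp_all add: w0)
qed

lemma mollified:
  assumes h: "0 < h"
  shows "stokes T c (mollify h z1) (mollify h z1x) (mollify h z1y) (mollify h z1xx) (mollify h z1yy)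
    (mollify h z2) (mollify h z2x) (mollify h z2y) (mollify h z2xx) (mollify h z2yy)
    (mollify h q) (mollify h qx) (mollify h qy) (mollify h f1) (mollify h f2)"
proof
  note cs = has_pdxD(2)[OF z1x] has_pdyD(2)[OF z2y] has_pdxD(2)[OF z1xx] has_pdyD(2)[OF z1yy]
    has_pdxD(2)[OF z2xx] has_pdyD(2)[OF z2yy] has_pdxD(2)[OF qx] has_pdyD(2)[OF qy] fc
  fix z assume z: "z \<in> strip"
  have "mollify h z1x z + mollify h z2y z = mollify h (\<lambda>z. z1x z + z2y z) z"
    by (rule mollify_linear(1)[OF cs(1,2) z, symmetric])
  also have "\<dots> = mollify h (\<lambda>z. 0) z" by (rule mollify_cong[OF div0 z])
  finally show "mollify h z1x z + mollify h z2y z = 0" using h by (simp add: mollify_const)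
  have "mollify h z1xx z + mollify h z1yy z = mollify h (\<lambda>z. z1xx z + z1yy z) z"
    by (rule mollify_linear(1)[OF cs(3,4) z, symmetric])
  also have "\<dots> = mollify h (\<lambda>z. qx z + c + f1 z) z" by (rule mollify_cong[OF eq1 z])
  also have "\<dots> = mollify h (\<lambda>z. qx z + c) z + mollify h f1 z"
    by (rule mollify_linear(1)[OF _ cs(9) z]) (intro continuous_intros cs)
  also have "mollify h (\<lambda>z. qx z + c) z = mollify h qx z + c"
    using mollify_linear(1)[OF cs(7) _ z, of "\<lambda>_. c"] h by (simp add: mollify_const)
  finally show "mollify h z1xx z + mollify h z1yy z = mollify h qx z + c + mollify h f1 z" .
  have "mollify h z2xx z + mollify h z2yy z = mollify h (\<lambda>z. z2xx z + z2yy z) z"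
    by (rule mollify_linear(1)[OF cs(5,6) z, symmetric])
  also have "\<dots> = mollify h (\<lambda>z. qy z + f2 z) z" by (rule mollify_cong[OF eq2 z])
  also have "\<dots> = mollify h qy z + mollify h f2 z"
    by (rule mollify_linear(1)[OF cs(8) cs(10) z])
  finally show "mollify h z2xx z + mollify h z2yy z = mollify h qy z + mollify h f2 z" .
next
  fix x
  show "mollify h z1 (x, 1) = 0" "mollify h z1 (x, -1) = 0" "mollify h z2 (x, 1) = 0" "mollify h z2 (x, -1) = 0"
    using z0 by (simp_all add: mollify_def steklov_def average_def)
qed (intro T has_pdx_mollify has_pdy_mollify continuous_on_mollify x_periodic_on_mollify h
    z1x z1y z1xx z1yy z2x z2y z2xx z2yy qx qy fc zc zper qper)+

text \<open>After averaging in \<open>x\<close>, the second momentum equation and incompressibility express the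
  \<open>y\<close>-derivative of \<open>q - z2y + G22\<close> by bounded quantities; the first one then does the same for
  \<open>z1y - G12\<close>.\<close>

lemma mollified_bounds:
  assumes G: "has_pdx G11 G11x" "has_pdy G12 G12y" "has_pdx G21 G21x" "has_pdy G22 G22y"
    and Gb: "strip_bounded G11" "strip_bounded G12" "strip_bounded G21" "strip_bounded G22"
    and Gper: "x_periodic_on strip T G12" "x_periodic_on strip T G22"
    and f: "\<And>z. z \<in> strip \<Longrightarrow> f1 z = G11x z + G12y z" "\<And>z. z \<in> strip \<Longrightarrow> f2 z = G21x z + G22y z"
    and h: "0 < h"
  shows "strip_bounded (mollify h q)" "strip_bounded (mollify h z1y)" "strip_bounded (mollify h z2y)"
    "strip_bounded (mollify h z1x)" "strip_bounded (mollify h z2x)"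
proof -
  let ?S = "\<lambda>f. steklov h (steklov h f)"
  have zb: "strip_bounded z1" "strip_bounded z2"
    using strip_bounded_closed[OF zc(1) zper(1) T] strip_bounded_closed[OF zc(2) zper(2) T] .
  note cs = continuous_on_steklov_strip(1)
  have S1: "strip_bounded (?S z1x)" "strip_bounded (?S z2x)"
    by (intro strip_bounded_steklov cs strip_bounded_steklov_pdx[OF z1x] strip_bounded_steklov_pdx[OF z2x] zb h
      has_pdxD(2)[OF z1x] has_pdxD(2)[OF z2x])+
  show "strip_bounded (mollify h z1x)" "strip_bounded (mollify h z2x)"
    by (intro strip_bounded_mollify_pdx[OF z1x] strip_bounded_mollify_pdx[OF z2x] zb h)+
  \<comment> \<open>Incompressibility converts the normal derivative of \<open>z2\<close> into a
    tangential one.\<close>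
  have z2y_eq: "z2y z = - 1 * z1x z" if "z \<in> strip" for z using div0[OF that] by simp
  show "strip_bounded (mollify h z2y)"
  proof (rule strip_bounded_cong)
    show "strip_bounded (\<lambda>z. (- 1) * mollify h z1x z)"
      by (intro strip_bounded_cmult) fact
    show "mollify h z2y z = (- 1) * mollify h z1x z" if "z \<in> strip" for z
      using mollify_cong[OF z2y_eq that] by (simp only: mollify_cmult)
  qed
  have S2: "strip_bounded (?S z2y)"
  proof (rule strip_bounded_cong)
    show "strip_bounded (\<lambda>z. (- 1) * ?S z1x z)"
      by (intro strip_bounded_cmult S1)
    show "?S z2y z = (- 1) * ?S z1x z" if "z \<in> strip" for z
      using steklov_cong[OF steklov_cong[OF z2y_eq] that] by (simp only: steklov_cmult)
  qed
  define Q where "Q z = q z - z2y z + G22 z" for z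
  note Qy = has_pdy_add[OF has_pdy_diff[OF qy z2yy] G(4), folded Q_def]
  have Qy': "qy z - z2yy z + G22y z = z2xx z - G21x z" if "z \<in> strip" for z
    using eq2[OF that] f(2)[OF that] by simp
  note P = has_pdx_diff[OF z2xx G(3)]
  have "strip_bounded (?S (\<lambda>z. z2xx z - G21x z))"
  proof -
    have b: "strip_bounded (steklov h (\<lambda>z. z2x z - G21 z))"
    proof (rule strip_bounded_cong)
      show "strip_bounded (\<lambda>z. steklov h z2x z - steklov h G21 z)"
        by (intro strip_bounded_diff strip_bounded_steklov_pdx[OF z2x] zb h strip_bounded_steklov Gb has_pdxD(1)[OF G(3)])
      show "steklov h (\<lambda>z. z2x z - G21 z) z = steklov h z2x z - steklov h G21 z" if "z \<in> strip" for z
        by (rule steklov_linear(2)[OF has_pdxD(2)[OF z2x] has_pdxD(1)[OF G(3)] that])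
    qed
    show ?thesis by (rule strip_bounded_steklov_pdx[OF has_pdx_steklov[OF P h] b h])
  qed
  then have "strip_bounded (?S (\<lambda>z. qy z - z2yy z + G22y z))"
    by (rule strip_bounded_cong) (rule steklov_cong[OF steklov_cong[OF Qy']])
  then have Qb: "strip_bounded (?S Q)"
    unfolding Q_def[abs_def]
    by (rule strip_bounded_pdy[OF has_pdy_steklov[OF has_pdy_steklov[OF Qy]], unfolded Q_def[abs_def], OF _ _ T])
       (intro x_periodic_intros qper gper Gper)
  have Sq: "strip_bounded (?S q)"
  proof (rule strip_bounded_cong)
    show "strip_bounded (\<lambda>z. ?S Q z + ?S z2y z - ?S G22 z)"
      by (intro strip_bounded_diff strip_bounded_add Qb S2 strip_bounded_steklov Gb h cs has_pdyD(1)[OF G(4)])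
    fix z assume z: "z \<in> strip"
    note c = has_pdyD(1)[OF qy] has_pdyD(2)[OF z2y] has_pdyD(1)[OF G(4)]
    have c12: "continuous_on strip (\<lambda>z. q z - z2y z)" by (intro continuous_intros c)
    have "?S Q z = steklov h (\<lambda>z. steklov h (\<lambda>z. q z - z2y z) z + steklov h G22 z) z"
      unfolding Q_def[abs_def] by (rule steklov_cong[OF steklov_linear(1)[OF c12 c(3)] z])
    also have "\<dots> = ?S (\<lambda>z. q z - z2y z) z + ?S G22 z" by (rule steklov_linear(1)[OF cs[OF c12] cs[OF c(3)] z])
    also have "?S (\<lambda>z. q z - z2y z) z = steklov h (\<lambda>z. steklov h q z - steklov h z2y z) z"
      by (rule steklov_cong[OF steklov_linear(2)[OF c(1,2)] z])
    also have "\<dots> = ?S q z - ?S z2y z" by (rule steklov_linear(2)[OF cs[OF c(1)] cs[OF c(2)] z])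
    finally show "?S q z = ?S Q z + ?S z2y z - ?S G22 z" by simp
  qed
  show qb: "strip_bounded (mollify h q)"
    unfolding mollify_def by (intro strip_bounded_steklov[OF Sq _ h] cs has_pdxD(1)[OF qx])
  define R where "R z = z1y z - G12 z" for z
  note Ry = has_pdy_diff[OF z1yy G(2), folded R_def]
  \<comment> \<open>The \<open>y\<close>-derivative of \<open>R\<close> equals the
    \<open>x\<close>-derivative of \<open>W\<close> up to the constant \<open>c\<close>. Since
    \<open>W\<close> contains the pressure, which is bounded after two averages, the third average
    is spent here.\<close>
  define W where "W z = q z + G11 z - z1x z" for z
  note Wx = has_pdx_diff[OF has_pdx_add[OF qx G(1)] z1xx, folded W_def]
  have Ry': "z1yy z - G12y z = (qx z + G11x z - z1xx z) + c" if "z \<in> strip" for z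
    using eq1[OF that] f(1)[OF that] by simp
  have SW: "strip_bounded (?S W)"
  proof (rule strip_bounded_cong)
    show "strip_bounded (\<lambda>z. ?S q z + ?S G11 z - ?S z1x z)"
      by (intro strip_bounded_diff strip_bounded_add Sq S1 strip_bounded_steklov Gb h cs has_pdxD(1)[OF G(1)])
    fix z assume z: "z \<in> strip"
    note c = has_pdyD(1)[OF qy] has_pdxD(1)[OF G(1)] has_pdxD(2)[OF z1x]
    have c12: "continuous_on strip (\<lambda>z. q z + G11 z)" by (intro continuous_intros c)
    have "?S W z = steklov h (\<lambda>z. steklov h (\<lambda>z. q z + G11 z) z - steklov h z1x z) z"
      unfolding W_def[abs_def] by (rule steklov_cong[OF steklov_linear(2)[OF c12 c(3)] z])
    also have "\<dots> = ?S (\<lambda>z. q z + G11 z) z - ?S z1x z" by (rule steklov_linear(2)[OF cs[OF c12] cs[OF c(3)] z])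
    also have "?S (\<lambda>z. q z + G11 z) z = steklov h (\<lambda>z. steklov h q z + steklov h G11 z) z"
      by (rule steklov_cong[OF steklov_linear(1)[OF c(1,2)] z])
    also have "\<dots> = ?S q z + ?S G11 z" by (rule steklov_linear(1)[OF cs[OF c(1)] cs[OF c(2)] z])
    finally show "?S W z = ?S q z + ?S G11 z - ?S z1x z" .
  qed
  have "strip_bounded (\<lambda>z. mollify h (\<lambda>z. qx z + G11x z - z1xx z) z + c)"
    unfolding mollify_def
    by (intro strip_bounded_add strip_bounded_const strip_bounded_steklov_pdx[OF has_pdx_steklov[OF has_pdx_steklov[OF Wx h] h] SW h])
  then have "strip_bounded (mollify h (\<lambda>z. z1yy z - G12y z))"
  proof (rule strip_bounded_cong)
    fix z assume z: "z \<in> strip"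
    have "mollify h (\<lambda>z. z1yy z - G12y z) z = mollify h (\<lambda>z. (qx z + G11x z - z1xx z) + c) z"
      by (rule mollify_cong[OF Ry' z])
    also have "\<dots> = mollify h (\<lambda>z. qx z + G11x z - z1xx z) z + mollify h (\<lambda>z. c) z"
      by (rule mollify_linear(1)[OF has_pdxD(2)[OF Wx] _ z]) simp
    finally show "mollify h (\<lambda>z. z1yy z - G12y z) z = mollify h (\<lambda>z. qx z + G11x z - z1xx z) z + c"
      using h by (simp add: mollify_const)
  qed
  then have Rb: "strip_bounded (mollify h R)"
    unfolding R_def[abs_def]
    by (rule strip_bounded_pdy[OF has_pdy_mollify[OF Ry], unfolded R_def[abs_def], OF _ _ T])
       (intro x_periodic_intros x_periodic_on_mollify gper Gper)
  show "strip_bounded (mollify h z1y)"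
  proof (rule strip_bounded_cong)
    show "strip_bounded (\<lambda>z. mollify h R z + mollify h G12 z)"
      by (intro strip_bounded_add Rb strip_bounded_mollify Gb h has_pdyD(1)[OF G(2)])
    show "mollify h z1y z = mollify h R z + mollify h G12 z" if "z \<in> strip" for z
      using mollify_linear(2)[OF has_pdyD(2)[OF z1y] has_pdyD(1)[OF G(2)] that] by (simp add: R_def[abs_def])
  qed
qed

end

section \<open>The energy inequality\<close>

context stokes
begin

definition energy :: "real \<Rightarrow> real" where
  "energy = slice T (\<lambda>z. (z1x z)\<^sup>2 + (z1y z)\<^sup>2 + (z2x z)\<^sup>2 + (z2y z)\<^sup>2)"

text \<open>The integrand is the divergence of a * |z|^2 / 2, because a is divergence-free; |z|^2
  vanishes at the walls.\<close>

lemma transport_integral_0: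
  assumes a: "has_pdx a1 a1x" "has_pdy a2 a2y" "\<And>z. z \<in> strip \<Longrightarrow> a1x z + a2y z = 0"
    and ac: "strip_bounded a2" and aper: "x_periodic_on strip T a1"
  shows "(slice T (\<lambda>z. a1 z * (z1 z * z1x z + z2 z * z2x z) + a2 z * (z1 z * z1y z + z2 z * z2y z)) has_integral 0) {-1<..<1}"
proof -
  obtain C where C: "\<And>z. z \<in> strip \<Longrightarrow> \<bar>a2 z\<bar> \<le> C" using ac unfolding strip_bounded_def by blast
  note sx = has_pdx_add[OF has_pdx_mult[OF z1x z1x] has_pdx_mult[OF z2x z2x]]
  note sy = has_pdy_add[OF has_pdy_mult[OF z1y z1y] has_pdy_mult[OF z2y z2y]]
  note A = has_pdx_cmult[OF has_pdx_mult[OF a(1) sx], of "1/2"]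
  note B = has_pdy_cmult[OF has_pdy_mult[OF a(2) sy], of "1/2"]
  show ?thesis
  proof (rule divergence_has_integral_0[OF A _ B T0, where w="\<lambda>z. z1 z * z1 z + z2 z * z2 z" and C="C / 2"])
    show "x_periodic_on strip T (\<lambda>z. 1 / 2 * (a1 z * (z1 z * z1 z + z2 z * z2 z)))"
      by (intro x_periodic_intros aper zper')
    show "continuous_on closed_strip (\<lambda>z. z1 z * z1 z + z2 z * z2 z)" by (intro continuous_intros zc)
    fix z assume z: "z \<in> strip"
    have "\<bar>a2 z\<bar> * \<bar>z1 z * z1 z + z2 z * z2 z\<bar> \<le> C * \<bar>z1 z * z1 z + z2 z * z2 z\<bar>"
      using C[OF z] by (intro mult_right_mono) auto
    then show "\<bar>1 / 2 * (a2 z * (z1 z * z1 z + z2 z * z2 z))\<bar> \<le> C / 2 * \<bar>z1 z * z1 z + z2 z * z2 z\<bar>"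
      by (simp add: abs_mult)
    have e: "a2y z = - a1x z" using a(3)[OF z] by simp
    show "1 / 2 * (a1x z * (z1 z * z1 z + z2 z * z2 z) + a1 z * (z1x z * z1 z + z1 z * z1x z + (z2x z * z2 z + z2 z * z2x z))) +
       1 / 2 * (a2y z * (z1 z * z1 z + z2 z * z2 z) + a2 z * (z1y z * z1 z + z1 z * z1y z + (z2y z * z2 z + z2 z * z2y z))) =
       a1 z * (z1 z * z1x z + z2 z * z2x z) + a2 z * (z1 z * z1y z + z2 z * z2y z)"
      unfolding e by (simp add: algebra_simps)
  qed (simp_all add: z0)
qed

text \<open>The integrand is the divergence of z * (b . z), because z is divergence-free. The
  identity moves the derivative between b and z in z . (z . grad b).\<close>

lemma stretching_integral_0:
  assumes b: "has_pdx b1 b1x" "has_pdy b1 b1y" "has_pdx b2 b2x" "has_pdy b2 b2y"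
    and bb: "strip_bounded b1" "strip_bounded b2" and bper: "x_periodic_on strip T b1" "x_periodic_on strip T b2"
  shows "(slice T (\<lambda>z. (z1 z * (z1 z * b1x z + z2 z * b1y z) + z2 z * (z1 z * b2x z + z2 z * b2y z)) +
     (z1 z * (b1 z * z1x z + b2 z * z2x z) + z2 z * (b1 z * z1y z + b2 z * z2y z))) has_integral 0) {-1<..<1}"
proof -
  have zb: "strip_bounded z1" "strip_bounded z2"
    using strip_bounded_closed[OF zc(1) zper(1) T] strip_bounded_closed[OF zc(2) zper(2) T] .
  have "strip_bounded (\<lambda>z. b1 z * z1 z + b2 z * z2 z)" by (intro strip_bounded_add strip_bounded_mult bb zb)
  then obtain C where C: "\<And>z. z \<in> strip \<Longrightarrow> \<bar>b1 z * z1 z + b2 z * z2 z\<bar> \<le> C" unfolding strip_bounded_def by blast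
  note sx = has_pdx_add[OF has_pdx_mult[OF b(1) z1x] has_pdx_mult[OF b(3) z2x]]
  note sy = has_pdy_add[OF has_pdy_mult[OF b(2) z1y] has_pdy_mult[OF b(4) z2y]]
  note A = has_pdx_mult[OF z1x sx]
  note B = has_pdy_mult[OF z2y sy]
  show ?thesis
  proof (rule divergence_has_integral_0[OF A _ B T0, where w=z2 and C=C])
    show "x_periodic_on strip T (\<lambda>z. z1 z * (b1 z * z1 z + b2 z * z2 z))"
      by (intro x_periodic_intros bper zper')
    fix z assume z: "z \<in> strip"
    have "\<bar>z2 z\<bar> * \<bar>b1 z * z1 z + b2 z * z2 z\<bar> \<le> \<bar>z2 z\<bar> * C"
      using C[OF z] by (intro mult_left_mono) auto
    then show "\<bar>z2 z * (b1 z * z1 z + b2 z * z2 z)\<bar> \<le> C * \<bar>z2 z\<bar>"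
      by (simp add: abs_mult mult.commute)
    have e: "z2y z = - z1x z" using div0[OF z] by simp
    show "z1x z * (b1 z * z1 z + b2 z * z2 z) + z1 z * (b1x z * z1 z + b1 z * z1x z + (b2x z * z2 z + b2 z * z2x z)) +
       (z2y z * (b1 z * z1 z + b2 z * z2 z) + z2 z * (b1y z * z1 z + b1 z * z1y z + (b2y z * z2 z + b2 z * z2y z))) =
       z1 z * (z1 z * b1x z + z2 z * b1y z) + z2 z * (z1 z * b2x z + z2 z * b2y z) +
       (z1 z * (b1 z * z1x z + b2 z * z2x z) + z2 z * (b1 z * z1y z + b2 z * z2y z))"
      unfolding e by (simp add: algebra_simps)
  qed (simp_all add: z0 zc)
qed

text \<open>Integration by parts for a force in divergence form. The components of G will be
  mollified products: mollification destroys the convective structure and keeps the divergence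
  form.\<close>

lemma flux_integral_0:
  assumes G: "has_pdx G11 G11x" "has_pdy G12 G12y" "has_pdx G21 G21x" "has_pdy G22 G22y"
    and Gb: "strip_bounded G12" "strip_bounded G22"
    and Gper: "x_periodic_on strip T G11" "x_periodic_on strip T G21"
    and f: "\<And>z. z \<in> strip \<Longrightarrow> f1 z = G11x z + G12y z" "\<And>z. z \<in> strip \<Longrightarrow> f2 z = G21x z + G22y z"
  shows "(slice T (\<lambda>z. (f1 z * z1 z + f2 z * z2 z) + (G11 z * z1x z + G12 z * z1y z + G21 z * z2x z + G22 z * z2y z))
    has_integral 0) {-1<..<1}"
proof -
  obtain C1 where C1: "\<And>z. z \<in> strip \<Longrightarrow> \<bar>G12 z\<bar> \<le> C1" using Gb unfolding strip_bounded_def by blast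
  obtain C2 where C2: "\<And>z. z \<in> strip \<Longrightarrow> \<bar>G22 z\<bar> \<le> C2" using Gb unfolding strip_bounded_def by blast
  note A = has_pdx_add[OF has_pdx_mult[OF G(1) z1x] has_pdx_mult[OF G(3) z2x]]
  note B = has_pdy_add[OF has_pdy_mult[OF G(2) z1y] has_pdy_mult[OF G(4) z2y]]
  show ?thesis
  proof (rule divergence_has_integral_0[OF A _ B T0, where w="\<lambda>z. \<bar>z1 z\<bar> + \<bar>z2 z\<bar>" and C="C1 + C2"])
    show "x_periodic_on strip T (\<lambda>z. G11 z * z1 z + G21 z * z2 z)"
      by (intro x_periodic_intros Gper zper')
    show "continuous_on closed_strip (\<lambda>z. \<bar>z1 z\<bar> + \<bar>z2 z\<bar>)" by (intro continuous_intros zc)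
    fix z assume z: "z \<in> strip"
    have "\<bar>G12 z\<bar> * \<bar>z1 z\<bar> \<le> C1 * (\<bar>z1 z\<bar> + \<bar>z2 z\<bar>)" "\<bar>G22 z\<bar> * \<bar>z2 z\<bar> \<le> C2 * (\<bar>z1 z\<bar> + \<bar>z2 z\<bar>)"
      using C1[OF z] C2[OF z] by (auto intro!: mult_mono)
    then show "\<bar>G12 z * z1 z + G22 z * z2 z\<bar> \<le> (C1 + C2) * \<bar>\<bar>z1 z\<bar> + \<bar>z2 z\<bar>\<bar>"
      using abs_triangle_ineq[of "G12 z * z1 z" "G22 z * z2 z"] unfolding abs_mult[symmetric] by (simp add: distrib_right)
    show "G11x z * z1 z + G11 z * z1x z + (G21x z * z2 z + G21 z * z2x z) +
       (G12y z * z1 z + G12 z * z1y z + (G22y z * z2 z + G22 z * z2y z)) =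
       (f1 z * z1 z + f2 z * z2 z) + (G11 z * z1x z + G12 z * z1y z + G21 z * z2x z + G22 z * z2y z)"
      unfolding f[OF z] by (simp add: algebra_simps)
  qed (simp_all add: z0)
qed

end

lemma has_integral_0_slice_add:
  assumes "(slice T f has_integral 0) {-1<..<1}" "(slice T g has_integral 0) {-1<..<1}"
    and "continuous_on strip f" "continuous_on strip g"
  shows "(slice T (\<lambda>z. f z + g z) has_integral 0) {-1<..<1}"
proof -
  have "((\<lambda>y. slice T f y + slice T g y) has_integral 0 + 0) {-1<..<1}"
    by (rule has_integral_add) fact+
  then show ?thesis by (subst has_integral_cong[OF slice_add[OF assms(3,4)]]) auto
qed

lemma has_integral_0_slice_diff:
  assumes "(slice T f has_integral 0) {-1<..<1}" "(slice T g has_integral 0) {-1<..<1}"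
    and "continuous_on strip f" "continuous_on strip g"
  shows "(slice T (\<lambda>z. f z - g z) has_integral 0) {-1<..<1}"
proof -
  have "((\<lambda>y. slice T f y - slice T g y) has_integral 0 - 0) {-1<..<1}"
    by (rule has_integral_diff) fact+
  then show ?thesis by (subst has_integral_cong[OF slice_diff[OF assms(3,4)]]) auto
qed

context stokes
begin

text \<open>The combination (weak form tested with z) - flux + transport + stretching leaves energy
  + c * z1 - R + Q, where R pairs the gradient with the defect between G and the exact product flux.
  The bound |t| <= 1 + t^2 for four components on a strip of height 2 produces 8 * e * T and the
  factor 1 - e.\<close>

lemma energy_balance:
  assumes a: "has_pdx a1 a1x" "has_pdy a2 a2y" "\<And>z. z \<in> strip \<Longrightarrow> a1x z + a2y z = 0"
    and ab: "strip_bounded a1" "strip_bounded a2" and aper: "x_periodic_on strip T a1"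
    and b: "has_pdx b1 b1x" "has_pdy b1 b1y" "has_pdx b2 b2x" "has_pdy b2 b2y"
    and bb: "strip_bounded b1" "strip_bounded b2" and bper: "x_periodic_on strip T b1" "x_periodic_on strip T b2"
    and G: "has_pdx G11 G11x" "has_pdy G12 G12y" "has_pdx G21 G21x" "has_pdy G22 G22y"
    and Gb: "strip_bounded G11" "strip_bounded G12" "strip_bounded G21" "strip_bounded G22"
    and Gper: "x_periodic_on strip T G11" "x_periodic_on strip T G21"
    and f: "\<And>z. z \<in> strip \<Longrightarrow> f1 z = G11x z + G12y z" "\<And>z. z \<in> strip \<Longrightarrow> f2 z = G21x z + G22y z"
    and zb: "strip_bounded z1x" "strip_bounded z1y" "strip_bounded z2x" "strip_bounded z2y" "strip_bounded q"
    and flux: "c * integral {-1<..<1} (slice T z1) = 0"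
    and bint: "slice T (\<lambda>z. \<bar>b1x z\<bar> + \<bar>b1y z\<bar> + \<bar>b2x z\<bar> + \<bar>b2y z\<bar>) integrable_on {-1<..<1}"
    and e: "0 \<le> e"
    and approx: "\<And>z. z \<in> strip \<Longrightarrow> \<bar>G11 z - (a1 z * z1 z + z1 z * b1 z)\<bar> \<le> e"
      "\<And>z. z \<in> strip \<Longrightarrow> \<bar>G12 z - (a2 z * z1 z + z2 z * b1 z)\<bar> \<le> e"
      "\<And>z. z \<in> strip \<Longrightarrow> \<bar>G21 z - (a1 z * z2 z + z1 z * b2 z)\<bar> \<le> e"
      "\<And>z. z \<in> strip \<Longrightarrow> \<bar>G22 z - (a2 z * z2 z + z2 z * b2 z)\<bar> \<le> e"
  defines "Q \<equiv> slice T (\<lambda>z. z1 z * (z1 z * b1x z + z2 z * b1y z) + z2 z * (z1 z * b2x z + z2 z * b2y z))"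
  shows "energy integrable_on {-1<..<1}" "Q integrable_on {-1<..<1}"
    "(1 - e) * integral {-1<..<1} energy \<le> 8 * e * T - integral {-1<..<1} Q"
proof -
  let ?I = "{-1<..<1::real}"
  note c = has_pdxD(1)[OF z1x] has_pdxD(2)[OF z1x] has_pdyD(2)[OF z1y] has_pdxD(1)[OF z2x] has_pdxD(2)[OF z2x] has_pdyD(2)[OF z2y]
    has_pdxD(1)[OF a(1)] has_pdyD(1)[OF a(2)] has_pdxD[OF b(1)] has_pdyD(2)[OF b(2)] has_pdxD[OF b(3)] has_pdyD(2)[OF b(4)]
    has_pdxD(1)[OF G(1)] has_pdyD(1)[OF G(2)] has_pdxD(1)[OF G(3)] has_pdyD(1)[OF G(4)] fc
  have z12b: "strip_bounded z1" "strip_bounded z2"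
    using strip_bounded_closed[OF zc(1) zper(1) T] strip_bounded_closed[OF zc(2) zper(2) T] .
  let ?E = "\<lambda>z. (z1x z)\<^sup>2 + (z1y z)\<^sup>2 + (z2x z)\<^sup>2 + (z2y z)\<^sup>2"
  let ?Q = "\<lambda>z. z1 z * (z1 z * b1x z + z2 z * b1y z) + z2 z * (z1 z * b2x z + z2 z * b2y z)"
  let ?R = "\<lambda>z. (G11 z - (a1 z * z1 z + z1 z * b1 z)) * z1x z + (G12 z - (a2 z * z1 z + z2 z * b1 z)) * z1y z +
     (G21 z - (a1 z * z2 z + z1 z * b2 z)) * z2x z + (G22 z - (a2 z * z2 z + z2 z * b2 z)) * z2y z"
  note t1 = test[OF zb(2,4,5) z1x z1y z2x z2y zc zper', OF z0 div0]
  note t2 = flux_integral_0[OF G Gb(2,4) Gper, OF f]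
  note t3 = transport_integral_0[OF a ab(2) aper]
  note t4 = stretching_integral_0[OF b bb bper]
  let ?t1 = "\<lambda>z. z1x z * z1x z + z1y z * z1y z + z2x z * z2x z + z2y z * z2y z + (f1 z + c) * z1 z + f2 z * z2 z"
  let ?t2 = "\<lambda>z. (f1 z * z1 z + f2 z * z2 z) + (G11 z * z1x z + G12 z * z1y z + G21 z * z2x z + G22 z * z2y z)"
  let ?t3 = "\<lambda>z. a1 z * (z1 z * z1x z + z2 z * z2x z) + a2 z * (z1 z * z1y z + z2 z * z2y z)"
  let ?t4 = "\<lambda>z. ?Q z + (z1 z * (b1 z * z1x z + b2 z * z2x z) + z2 z * (b1 z * z1y z + b2 z * z2y z))"
  have ct: "continuous_on strip ?t1" "continuous_on strip ?t2" "continuous_on strip ?t3" "continuous_on strip ?t4"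
    by (intro continuous_intros c)+
  note s1 = has_integral_0_slice_diff[OF t1 t2 ct(1,2)]
  note s2 = has_integral_0_slice_add[OF s1 t3 continuous_on_diff[OF ct(1,2)] ct(3)]
  note s3 = has_integral_0_slice_add[OF s2 t4 continuous_on_add[OF continuous_on_diff[OF ct(1,2)] ct(3)] ct(4)]
  have "(\<lambda>z. ?t1 z - ?t2 z + ?t3 z + ?t4 z) = (\<lambda>z. ?E z + c * z1 z - ?R z + ?Q z)"
    by (rule ext) (simp add: algebra_simps power2_eq_square)
  then have bal: "(slice T (\<lambda>z. ?E z + c * z1 z - ?R z + ?Q z) has_integral 0) ?I"
    using s3 by simp
  have Ec: "continuous_on strip ?E" and Qc: "continuous_on strip ?Q" and Rc: "continuous_on strip ?R"
    by (intro continuous_intros c)+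
  have Rb: "strip_bounded ?R" and Eb: "strip_bounded ?E"
    unfolding power2_eq_square
    by (intro strip_bounded_add strip_bounded_mult strip_bounded_diff zb Gb ab bb z12b)+
  show Ei: "energy integrable_on ?I" unfolding energy_def
    by (rule strip_bounded_slice_integrable[OF Ec Eb T0])
  have Ri: "slice T ?R integrable_on ?I"
    by (rule strip_bounded_slice_integrable[OF Rc Rb T0])
  have zi: "slice T z1 integrable_on ?I"
    by (rule strip_bounded_slice_integrable[OF c(1) z12b(1) T0])
  have czi: "((\<lambda>y. c * slice T z1 y) has_integral 0) ?I"
    using has_integral_mult_right[OF integrable_integral[OF zi], of c] flux by simp
  have "slice T (\<lambda>z. ?E z + c * z1 z - ?R z + ?Q z) y = energy y + c * slice T z1 y - slice T ?R y + Q y" if "y \<in> ?I" for y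
  proof -
    have 1: "slice T (\<lambda>z. ?E z + c * z1 z - ?R z + ?Q z) y = slice T (\<lambda>z. ?E z + c * z1 z - ?R z) y + slice T ?Q y"
      by (rule slice_add[OF _ Qc]) (use that in \<open>auto intro!: continuous_intros c\<close>)
    have 2: "slice T (\<lambda>z. ?E z + c * z1 z - ?R z) y = slice T (\<lambda>z. ?E z + c * z1 z) y - slice T ?R y"
      by (rule slice_diff[OF _ Rc]) (use that in \<open>auto intro!: continuous_intros c\<close>)
    have 3: "slice T (\<lambda>z. ?E z + c * z1 z) y = slice T ?E y + slice T (\<lambda>z. c * z1 z) y"
      by (rule slice_add[OF Ec]) (use that in \<open>auto intro!: continuous_intros c\<close>)
    show ?thesis using 1 2 3 by (simp add: slice_cmult energy_def Q_def)
  qed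
  then have "((\<lambda>y. energy y + c * slice T z1 y - slice T ?R y + Q y) has_integral 0) ?I"
    using bal by (subst (asm) has_integral_cong) auto
  from has_integral_diff[OF has_integral_add[OF has_integral_diff[OF this czi] integrable_integral[OF Ri]] integrable_integral[OF Ei]]
  have Qhi: "(Q has_integral integral ?I (slice T ?R) - integral ?I energy) ?I"
    by (simp add: algebra_simps)
  then show "Q integrable_on ?I" by blast
  have "integral ?I (slice T ?R) \<le> integral ?I (\<lambda>y. e * (4 * T + energy y))"
  proof (rule integral_le[OF Ri])
    show "(\<lambda>y. e * (4 * T + energy y)) integrable_on ?I"
      by (intro integrable_on_mult_right integrable_add Ei integrable_const_Ioo)
    fix y :: real assume y: "y \<in> ?I"
    have sq: "\<bar>t\<bar> \<le> 1 + t\<^sup>2" for t :: real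
      using zero_le_power2[of "\<bar>t\<bar> - 1"] abs_ge_zero[of t] by (simp add: power2_diff)
    have tm: "r * t \<le> e * (1 + t\<^sup>2)" if "\<bar>r\<bar> \<le> e" for r t
    proof -
      have "r * t \<le> \<bar>r\<bar> * \<bar>t\<bar>" by (simp add: abs_mult[symmetric])
      also have "\<dots> \<le> e * (1 + t\<^sup>2)" using that sq[of t] e by (intro mult_mono) auto
      finally show ?thesis .
    qed
    have "slice T ?R y \<le> slice T (\<lambda>z. e * (4 + ?E z)) y"
    proof (rule slice_mono[OF Rc])
      fix x
      have z: "(x, y) \<in> strip" using y by simp
      show "?R (x, y) \<le> e * (4 + ?E (x, y))"
        using add_mono[OF add_mono[OF add_mono[OF tm[OF approx(1)[OF z], of "z1x (x, y)"] tm[OF approx(2)[OF z], of "z1y (x, y)"]]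
           tm[OF approx(3)[OF z], of "z2x (x, y)"]] tm[OF approx(4)[OF z], of "z2y (x, y)"]]
        by (simp add: algebra_simps)
    qed (use y Ec in \<open>auto intro!: continuous_on_mult_left continuous_on_add continuous_on_const\<close>)
    also have "\<dots> = e * (4 * T + energy y)"
      using slice_add[OF _ Ec, of "\<lambda>_. 4" y T] y T0 by (simp add: slice_cmult slice_const energy_def)
    finally show "slice T ?R y \<le> e * (4 * T + energy y)" .
  qed
  also have "\<dots> = e * (8 * T + integral ?I energy)"
  proof -
    have "integral ?I (\<lambda>y. 4 * T + energy y) = integral ?I (\<lambda>y. 4 * T) + integral ?I energy"
      by (rule integral_add[OF integrable_const_Ioo Ei])
    also have "integral ?I (\<lambda>y. 4 * T) = 8 * T" unfolding integral_open_interval_real[symmetric] by simp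
    finally show ?thesis by simp
  qed
  finally show "(1 - e) * integral ?I energy \<le> 8 * e * T - integral ?I Q"
    using integral_unique[OF Qhi] by (simp add: algebra_simps)
qed

text \<open>Here a transports and b is the field that is stretched: (u, U) for the deviation and
  (translated u, u) for difference quotients. Since \<open>energy\<close> is reached only by lower
  semicontinuity, an inequality remains of the balance.\<close>

theorem energy_inequality:
  assumes a: "has_pdx a1 a1x" "has_pdy a2 a2y" "\<And>z. z \<in> strip \<Longrightarrow> a1x z + a2y z = 0"
    and b: "has_pdx b1 b1x" "has_pdy b1 b1y" "has_pdx b2 b2x" "has_pdy b2 b2y"
    and ac: "continuous_on closed_strip a1" "continuous_on closed_strip a2"
    and bc: "continuous_on closed_strip b1" "continuous_on closed_strip b2"
    and aper: "x_periodic_on closed_strip T a1" "x_periodic_on closed_strip T a2"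
    and bper: "x_periodic_on closed_strip T b1" "x_periodic_on closed_strip T b2"
    and f: "\<And>z. z \<in> strip \<Longrightarrow> f1 z = a1 z * z1x z + a2 z * z1y z + (z1 z * b1x z + z2 z * b1y z)"
      "\<And>z. z \<in> strip \<Longrightarrow> f2 z = a1 z * z2x z + a2 z * z2y z + (z1 z * b2x z + z2 z * b2y z)"
    and flux: "c * integral {-1<..<1} (slice T z1) = 0"
    and bint: "slice T (\<lambda>z. \<bar>b1x z\<bar> + \<bar>b1y z\<bar> + \<bar>b2x z\<bar> + \<bar>b2y z\<bar>) integrable_on {-1<..<1}"
  defines "Q \<equiv> slice T (\<lambda>z. z1 z * (z1 z * b1x z + z2 z * b1y z) + z2 z * (z1 z * b2x z + z2 z * b2y z))"
  shows "energy integrable_on {-1<..<1}" "integral {-1<..<1} energy \<le> - integral {-1<..<1} Q"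
proof -
  let ?I = "{-1<..<1::real}"
  let ?G11 = "\<lambda>z. a1 z * z1 z + z1 z * b1 z" and ?G12 = "\<lambda>z. a2 z * z1 z + z2 z * b1 z"
  let ?G21 = "\<lambda>z. a1 z * z2 z + z1 z * b2 z" and ?G22 = "\<lambda>z. a2 z * z2 z + z2 z * b2 z"
  note aper' = aper[THEN x_periodic_on_strip] and bper' = bper[THEN x_periodic_on_strip]
  have bd: "strip_bounded g" if "continuous_on closed_strip g" "x_periodic_on closed_strip T g" for g
    using strip_bounded_closed[OF that T] .
  note zb = bd[OF zc(1) zper(1)] bd[OF zc(2) zper(2)] and ab = bd[OF ac(1) aper(1)] bd[OF ac(2) aper(2)]
    and bb = bd[OF bc(1) bper(1)] bd[OF bc(2) bper(2)]
  note G = has_pdx_add[OF has_pdx_mult[OF a(1) z1x] has_pdx_mult[OF z1x b(1)]]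
    has_pdy_add[OF has_pdy_mult[OF a(2) z1y] has_pdy_mult[OF z2y b(2)]]
    has_pdx_add[OF has_pdx_mult[OF a(1) z2x] has_pdx_mult[OF z1x b(3)]]
    has_pdy_add[OF has_pdy_mult[OF a(2) z2y] has_pdy_mult[OF z2y b(4)]]
  have Gc: "continuous_on closed_strip ?G11" "continuous_on closed_strip ?G12" "continuous_on closed_strip ?G21" "continuous_on closed_strip ?G22"
    by (intro continuous_intros ac bc zc)+
  have Gp: "x_periodic_on closed_strip T ?G11" "x_periodic_on closed_strip T ?G12" "x_periodic_on closed_strip T ?G21" "x_periodic_on closed_strip T ?G22"
    by (intro x_periodic_intros aper bper zper)+
  note Gp' = Gp[THEN x_periodic_on_strip]
  note Gb = bd[OF Gc(1) Gp(1)] bd[OF Gc(2) Gp(2)] bd[OF Gc(3) Gp(3)] bd[OF Gc(4) Gp(4)]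
  \<comment> \<open>Both a and z are divergence-free, so the force is the divergence of the products
    \<open>?G11\<close> to \<open>?G22\<close>; this is the form that
    \<open>mollified_bounds\<close> works with.\<close>
  have fG: "f1 z = (a1x z * z1 z + a1 z * z1x z + (z1x z * b1 z + z1 z * b1x z)) + (a2y z * z1 z + a2 z * z1y z + (z2y z * b1 z + z2 z * b1y z))"
    "f2 z = (a1x z * z2 z + a1 z * z2x z + (z1x z * b2 z + z1 z * b2x z)) + (a2y z * z2 z + a2 z * z2y z + (z2y z * b2 z + z2 z * b2y z))"
    if z: "z \<in> strip" for z
  proof -
    have e: "z2y z = - z1x z" "a2y z = - a1x z" using a(3)[OF z] div0[OF z] by auto
    show "f1 z = (a1x z * z1 z + a1 z * z1x z + (z1x z * b1 z + z1 z * b1x z)) + (a2y z * z1 z + a2 z * z1y z + (z2y z * b1 z + z2 z * b1y z))"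
      "f2 z = (a1x z * z2 z + a1 z * z2x z + (z1x z * b2 z + z1 z * b2x z)) + (a2y z * z2 z + a2 z * z2y z + (z2y z * b2 z + z2 z * b2y z))"
      unfolding f[OF z] e by (simp_all add: algebra_simps)
  qed
  define Qn where "Qn n = slice T (\<lambda>z. mollify (step n) z1 z * (mollify (step n) z1 z * b1x z + mollify (step n) z2 z * b1y z) +
      mollify (step n) z2 z * (mollify (step n) z1 z * b2x z + mollify (step n) z2 z * b2y z))" for n
  define En where "En n = slice T (\<lambda>z. (mollify (step n) z1x z)\<^sup>2 + (mollify (step n) z1y z)\<^sup>2 +
      (mollify (step n) z2x z)\<^sup>2 + (mollify (step n) z2y z)\<^sup>2)" for n
  have bal: "En n integrable_on ?I \<and> Qn n integrable_on ?I \<and> (1 - e) * integral ?I (En n) \<le> 8 * e * T - integral ?I (Qn n)"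
    if e: "0 \<le> e" and approx: "\<forall>z\<in>strip. \<bar>mollify (step n) ?G11 z - (a1 z * mollify (step n) z1 z + mollify (step n) z1 z * b1 z)\<bar> \<le> e"
      "\<forall>z\<in>strip. \<bar>mollify (step n) ?G12 z - (a2 z * mollify (step n) z1 z + mollify (step n) z2 z * b1 z)\<bar> \<le> e"
      "\<forall>z\<in>strip. \<bar>mollify (step n) ?G21 z - (a1 z * mollify (step n) z2 z + mollify (step n) z1 z * b2 z)\<bar> \<le> e"
      "\<forall>z\<in>strip. \<bar>mollify (step n) ?G22 z - (a2 z * mollify (step n) z2 z + mollify (step n) z2 z * b2 z)\<bar> \<le> e" for n e
  proof -
    interpret M: stokes T c "mollify (step n) z1" "mollify (step n) z1x" "mollify (step n) z1y" "mollify (step n) z1xx" "mollify (step n) z1yy"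
      "mollify (step n) z2" "mollify (step n) z2x" "mollify (step n) z2y" "mollify (step n) z2xx" "mollify (step n) z2yy"
      "mollify (step n) q" "mollify (step n) qx" "mollify (step n) qy" "mollify (step n) f1" "mollify (step n) f2"
      by (rule mollified) simp
    have sn: "0 < step n" by simp
    note MG = has_pdx_mollify[OF G(1) sn] has_pdy_mollify[OF G(2)] has_pdx_mollify[OF G(3) sn] has_pdy_mollify[OF G(4)]
    note MGb = strip_bounded_mollify[OF Gb(1) continuous_on_strip_if_closed[OF Gc(1)] sn]
      strip_bounded_mollify[OF Gb(2) continuous_on_strip_if_closed[OF Gc(2)] sn]
      strip_bounded_mollify[OF Gb(3) continuous_on_strip_if_closed[OF Gc(3)] sn]
      strip_bounded_mollify[OF Gb(4) continuous_on_strip_if_closed[OF Gc(4)] sn]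
    note bnd = mollified_bounds[OF G Gb Gp'(2,4), OF fG sn, simplified]
    have mf1: "mollify (step n) f1 z = mollify (step n) (\<lambda>z. a1x z * z1 z + a1 z * z1x z + (z1x z * b1 z + z1 z * b1x z)) z +
        mollify (step n) (\<lambda>z. a2y z * z1 z + a2 z * z1y z + (z2y z * b1 z + z2 z * b1y z)) z" if z: "z \<in> strip" for z
      by (rule trans[OF mollify_cong[OF fG(1) z] mollify_linear(1)[OF has_pdxD(2)[OF G(1)] has_pdyD(2)[OF G(2)] z]])
    have mf2: "mollify (step n) f2 z = mollify (step n) (\<lambda>z. a1x z * z2 z + a1 z * z2x z + (z1x z * b2 z + z1 z * b2x z)) z +
        mollify (step n) (\<lambda>z. a2y z * z2 z + a2 z * z2y z + (z2y z * b2 z + z2 z * b2y z)) z" if z: "z \<in> strip" for z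
      by (rule trans[OF mollify_cong[OF fG(2) z] mollify_linear(1)[OF has_pdxD(2)[OF G(3)] has_pdyD(2)[OF G(4)] z]])
    have sl: "slice T (mollify (step n) z1) y = slice T z1 y" if "y \<in> ?I" for y
      by (rule slice_mollify(1)[OF has_pdxD(1)[OF z1x] zper'(1) sn T]) (use that in auto)
    have flux': "c * integral ?I (slice T (mollify (step n) z1)) = 0"
      using flux integral_cong[of ?I "slice T (mollify (step n) z1)" "slice T z1", OF sl] by simp
    show ?thesis
      using M.energy_balance[OF a ab aper'(1) b bb bper' MG MGb x_periodic_on_mollify(1)[OF Gp'(1)] x_periodic_on_mollify(1)[OF Gp'(3)],
        OF _ mf1 mf2 bnd(4) bnd(2) bnd(5) bnd(3) bnd(1) flux' bint e, OF _ _ _ bspec[OF approx(1)] bspec[OF approx(2)] bspec[OF approx(3)] bspec[OF approx(4)]]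
      by (simp add: Qn_def En_def M.energy_def)
  qed
  have En0: "0 \<le> En n y" if "y \<in> ?I" for n y
    unfolding En_def
    by (rule slice_nonneg)
       (use that in \<open>auto intro!: continuous_intros continuous_on_mollify has_pdxD(2)[OF z1x] has_pdyD(2)[OF z1y] has_pdxD(2)[OF z2x] has_pdyD(2)[OF z2y]\<close>)
  have Elim: "(\<lambda>n. En n y) \<longlonglongrightarrow> energy y" if "y \<in> ?I" for y
    unfolding En_def energy_def
    using that by (intro line_limit_slice line_limit_add line_limit_power2 line_limit_mollify T gper
      has_pdxD(2)[OF z1x] has_pdyD(2)[OF z1y] has_pdxD(2)[OF z2x] has_pdyD(2)[OF z2y]) auto
  obtain C where C: "\<And>x y. y \<in> {-1..1} \<Longrightarrow> \<bar>z1 (x, y)\<bar> \<le> C" "\<And>x y. y \<in> {-1..1} \<Longrightarrow> \<bar>z2 (x, y)\<bar> \<le> C"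
  proof -
    obtain C1 C2 where "\<forall>x. \<forall>y\<in>{-1..1}. \<bar>z1 (x, y)\<bar> \<le> C1" "\<forall>x. \<forall>y\<in>{-1..1}. \<bar>z2 (x, y)\<bar> \<le> C2"
      using periodic_bounded[of "{-1..1}" z1 T] periodic_bounded[of "{-1..1}" z2 T] zc zper T
      unfolding closed_strip_def by auto
    then show ?thesis using that[of "max C1 C2"] by (meson max.coboundedI1 max.coboundedI2)
  qed
  have C0: "0 \<le> C" using C(1)[of 0 0] by simp
  have MC: "\<bar>mollify (step n) z1 (x, y)\<bar> \<le> C" "\<bar>mollify (step n) z2 (x, y)\<bar> \<le> C" if "y \<in> ?I" for n x y
    using mollify_bound[of "{-1..1}" z1 y "step n" x 0 C] mollify_bound[of "{-1..1}" z2 y "step n" x 0 C] C zc that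
    unfolding closed_strip_def by auto
  note bcs = has_pdxD(2)[OF b(1)] has_pdyD(2)[OF b(2)] has_pdxD(2)[OF b(3)] has_pdyD(2)[OF b(4)]
  note zcs = has_pdxD(1)[OF z1x] has_pdxD(1)[OF z2x]
  \<comment> \<open>The averaged velocities keep the bound \<open>C\<close>, so one multiple of the
    integrable gradient of b dominates all \<open>Qn\<close>.\<close>
  have Qle: "\<bar>Qn n y\<bar> \<le> C\<^sup>2 * slice T (\<lambda>z. \<bar>b1x z\<bar> + \<bar>b1y z\<bar> + \<bar>b2x z\<bar> + \<bar>b2y z\<bar>) y" if y: "y \<in> ?I" for n y
    unfolding Qn_def slice_cmult[symmetric]
  proof (rule slice_abs_le)
    fix x
    let ?p = "mollify (step n) z1 (x, y)" and ?q = "mollify (step n) z2 (x, y)"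
    have prod: "\<bar>u * v * w\<bar> \<le> C\<^sup>2 * \<bar>w\<bar>" if "\<bar>u\<bar> \<le> C" "\<bar>v\<bar> \<le> C" for u v w
      unfolding abs_mult power2_eq_square using that C0 by (intro mult_mono) auto
    note P = MC[OF y, of n x]
    have "\<bar>?p * ?p * b1x (x,y) + ?p * ?q * b1y (x,y) + ?q * ?p * b2x (x,y) + ?q * ?q * b2y (x,y)\<bar> \<le>
      C\<^sup>2 * \<bar>b1x (x,y)\<bar> + C\<^sup>2 * \<bar>b1y (x,y)\<bar> + C\<^sup>2 * \<bar>b2x (x,y)\<bar> + C\<^sup>2 * \<bar>b2y (x,y)\<bar>"
      using prod[OF P(1) P(1), of "b1x (x,y)"] prod[OF P(1) P(2), of "b1y (x,y)"] prod[OF P(2) P(1), of "b2x (x,y)"] prod[OF P(2) P(2), of "b2y (x,y)"]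
      by linarith
    also have "\<dots> = C\<^sup>2 * (\<bar>b1x (x,y)\<bar> + \<bar>b1y (x,y)\<bar> + \<bar>b2x (x,y)\<bar> + \<bar>b2y (x,y)\<bar>)" by (simp only: distrib_left)
    finally show "\<bar>?p * (?p * b1x (x,y) + ?q * b1y (x,y)) + ?q * (?p * b2x (x,y) + ?q * b2y (x,y))\<bar> \<le>
        C\<^sup>2 * (\<bar>b1x (x,y)\<bar> + \<bar>b1y (x,y)\<bar> + \<bar>b2x (x,y)\<bar> + \<bar>b2y (x,y)\<bar>)"
      by (simp only: distrib_left mult.assoc add.assoc)
  qed (use y in \<open>auto intro!: continuous_intros continuous_on_mollify bcs zcs\<close>)
  have Qlim: "(\<lambda>n. Qn n y) \<longlonglongrightarrow> Q y" if "y \<in> ?I" for y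
    unfolding Qn_def Q_def
    using that by (intro line_limit_slice line_limit_add line_limit_mult line_limit_mollify line_limit_const T zper' bcs zcs) auto
  have Qc: "continuous_on ?I (Qn n)" for n
    unfolding Qn_def by (intro continuous_on_slice continuous_intros continuous_on_mollify bcs zcs)
  have hi: "(\<lambda>y. C\<^sup>2 * slice T (\<lambda>z. \<bar>b1x z\<bar> + \<bar>b1y z\<bar> + \<bar>b2x z\<bar> + \<bar>b2y z\<bar>) y) integrable_on ?I"
    by (intro integrable_on_mult_right bint)
  have Qi: "Qn n integrable_on ?I" for n
    by (rule Ioo_integrableI_bounded[OF Qc hi]) (use Qle in auto)
  have QI: "(\<lambda>n. integral ?I (Qn n)) \<longlonglongrightarrow> integral ?I Q"
    by (rule dominated_convergence(2)[OF Qi hi _ Qlim]) (use Qle in auto)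
  \<comment> \<open>First n tends to infinity with the tolerance \<open>e\<close> fixed;
    \<open>e\<close> is sent to 0 afterwards.\<close>
  have main: "energy integrable_on ?I \<and> (1 - e) * integral ?I energy \<le> 8 * e * T - integral ?I Q" if e: "0 < e" "e < 1" for e
  proof -
    have "eventually (\<lambda>n. En n integrable_on ?I \<and> Qn n integrable_on ?I \<and> (1 - e) * integral ?I (En n) \<le> 8 * e * T - integral ?I (Qn n)) sequentially"
      using mollify_product_approx[OF ac(1) bc(1) zc(1) zc(1) aper(1) bper(1) zper(1) zper(1) T e(1)]
        mollify_product_approx[OF ac(2) bc(1) zc(1) zc(2) aper(2) bper(1) zper(1) zper(2) T e(1)]
        mollify_product_approx[OF ac(1) bc(2) zc(2) zc(1) aper(1) bper(2) zper(2) zper(1) T e(1)]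
        mollify_product_approx[OF ac(2) bc(2) zc(2) zc(2) aper(2) bper(2) zper(2) zper(2) T e(1)]
    proof eventually_elim
      case (elim n)
      show ?case by (rule bal[OF less_imp_le[OF e(1)] elim])
    qed
    then obtain N where N: "\<And>n. n \<ge> N \<Longrightarrow> En n integrable_on ?I \<and> (1 - e) * integral ?I (En n) \<le> 8 * e * T - integral ?I (Qn n)"
      unfolding eventually_sequentially by blast
    have "(\<lambda>n. (8 * e * T - integral ?I (Qn (n + N))) / (1 - e)) \<longlonglongrightarrow> (8 * e * T - integral ?I Q) / (1 - e)"
      using LIMSEQ_ignore_initial_segment[OF QI, of N] e by (intro tendsto_intros) auto
    moreover have "integral ?I (En (n + N)) \<le> (8 * e * T - integral ?I (Qn (n + N))) / (1 - e)" for n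
      using N[of "n + N"] e by (simp add: pos_le_divide_eq mult.commute)
    moreover have "(\<lambda>n. En (n + N) y) \<longlonglongrightarrow> energy y" if "y \<in> ?I" for y
      by (rule LIMSEQ_ignore_initial_segment[OF Elim[OF that]])
    moreover have "En (n + N) integrable_on ?I" for n using N[of "n + N"] by simp
    ultimately have "energy integrable_on ?I" "integral ?I energy \<le> (8 * e * T - integral ?I Q) / (1 - e)"
      by (intro fatou_Ioo[of "\<lambda>n. En (n + N)" "-1" 1 energy "\<lambda>n. (8 * e * T - integral ?I (Qn (n + N))) / (1 - e)" "(8 * e * T - integral ?I Q) / (1 - e)"]; simp add: En0)+
    then show ?thesis using e by (simp add: pos_le_divide_eq mult.commute)
  qed
  show Ei: "energy integrable_on ?I" using main[of "1/2"] by simp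
  show "integral ?I energy \<le> - integral ?I Q"
  proof (rule field_le_epsilon)
    fix d :: real assume d: "0 < d"
    let ?S = "8 * T + \<bar>integral ?I energy\<bar> + 1"
    \<comment> \<open>The first entry keeps \<open>e\<close> below 1, the second makes the total
      error at most \<open>d\<close>.\<close>
    define e where "e = min (1/2) (d / ?S)"
    have S: "0 < ?S" using T by simp
    have e: "0 < e" "e < 1" using d S by (auto simp: e_def)
    have "e * ?S \<le> d / ?S * ?S" unfolding e_def using S by (intro mult_right_mono) auto
    also have "\<dots> = d" using S by simp
    finally have eS: "e * ?S \<le> d" .
    have "integral ?I energy \<le> 8 * e * T - integral ?I Q + e * integral ?I energy"
      using main[OF e] by (simp add: algebra_simps)
    also have "e * integral ?I energy \<le> e * \<bar>integral ?I energy\<bar>" using e by (intro mult_left_mono) auto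
    also have "8 * e * T - integral ?I Q + e * \<bar>integral ?I energy\<bar> \<le> - integral ?I Q + e * ?S"
      using e by (simp add: algebra_simps)
    finally show "integral ?I energy \<le> - integral ?I Q + d" using eS by simp
  qed
qed

end

section \<open>Tangential differences\<close>

context stokes
begin

text \<open>The constant pressure gradient cancels in a difference, so the new system has the
  constant 0 and the flux condition of \<open>energy_inequality\<close> becomes trivial.\<close>

lemma difference_quotient:
  "stokes T 0 (\<lambda>z. (translate k z1 z - z1 z) / k) (\<lambda>z. (translate k z1x z - z1x z) / k) (\<lambda>z. (translate k z1y z - z1y z) / k)
    (\<lambda>z. (translate k z1xx z - z1xx z) / k) (\<lambda>z. (translate k z1yy z - z1yy z) / k)
    (\<lambda>z. (translate k z2 z - z2 z) / k) (\<lambda>z. (translate k z2x z - z2x z) / k) (\<lambda>z. (translate k z2y z - z2y z) / k)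
    (\<lambda>z. (translate k z2xx z - z2xx z) / k) (\<lambda>z. (translate k z2yy z - z2yy z) / k)
    (\<lambda>z. (translate k q z - q z) / k) (\<lambda>z. (translate k qx z - qx z) / k) (\<lambda>z. (translate k qy z - qy z) / k)
    (\<lambda>z. (translate k f1 z - f1 z) / k) (\<lambda>z. (translate k f2 z - f2 z) / k)"
proof
  fix z :: "real \<times> real" assume z: "z \<in> strip"
  then have tz: "(fst z + k, snd z) \<in> strip" by (auto simp: strip_def)
  show "(translate k z1x z - z1x z) / k + (translate k z2y z - z2y z) / k = 0"
    using div0[OF z] div0[OF tz] unfolding translate_def add_divide_distrib[symmetric] divide_eq_0_iff by linarith
  show "(translate k z1xx z - z1xx z) / k + (translate k z1yy z - z1yy z) / k =
      (translate k qx z - qx z) / k + 0 + (translate k f1 z - f1 z) / k"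
    using eq1[OF z] eq1[OF tz] unfolding translate_def add_divide_distrib[symmetric] add_0_right by (intro arg_cong2[where f="(/)"]) auto
  show "(translate k z2xx z - z2xx z) / k + (translate k z2yy z - z2yy z) / k =
      (translate k qy z - qy z) / k + (translate k f2 z - f2 z) / k"
    using eq2[OF z] eq2[OF tz] unfolding translate_def add_divide_distrib[symmetric] by (intro arg_cong2[where f="(/)"]) auto
next
  have tc: "continuous_on strip (\<lambda>z. (translate k g z - g z) / k)" if "continuous_on strip g" for g
  proof (cases "k = 0")
    case False
    then show ?thesis using that continuous_on_translate_strip[of "{-1<..<1}" g k] by (auto simp: strip_def intro!: continuous_intros)
  qed simp
  show "continuous_on strip (\<lambda>z. (translate k f1 z - f1 z) / k)" "continuous_on strip (\<lambda>z. (translate k f2 z - f2 z) / k)"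
    by (intro tc fc)+
  have tc': "continuous_on closed_strip (\<lambda>z. (translate k g z - g z) / k)" if "continuous_on closed_strip g" for g
  proof (cases "k = 0")
    case False
    then show ?thesis using that continuous_on_translate_strip[of "{-1..1}" g k] by (auto simp: closed_strip_def intro!: continuous_intros)
  qed simp
  show "continuous_on closed_strip (\<lambda>z. (translate k z1 z - z1 z) / k)" "continuous_on closed_strip (\<lambda>z. (translate k z2 z - z2 z) / k)"
    by (intro tc' zc)+
next
  fix x
  show "(translate k z1 (x, 1) - z1 (x, 1)) / k = 0" "(translate k z1 (x, -1) - z1 (x, -1)) / k = 0"
    "(translate k z2 (x, 1) - z2 (x, 1)) / k = 0" "(translate k z2 (x, -1) - z2 (x, -1)) / k = 0"
    by (simp_all add: translate_def z0)
qed (intro T pd_intros x_periodic_intros z1x z1y z1xx z1yy z2x z2y z2xx z2yy qx qy zper qper)+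

text \<open>Testing the averaged problem with \<open>w\<close>, the \<open>x\<close>-derivative of its velocity: the viscous
  term is an exact \<open>x\<close>-derivative.\<close>

lemma translation_identity:
  assumes bnd: "\<And>h. 0 < h \<Longrightarrow> strip_bounded (mollify h z1y)" "\<And>h. 0 < h \<Longrightarrow> strip_bounded (mollify h z2y)"
      "\<And>h. 0 < h \<Longrightarrow> strip_bounded (mollify h q)"
    and fper: "x_periodic_on strip T f1" "x_periodic_on strip T f2"
    and int: "slice T (\<lambda>z. (f1 z)\<^sup>2 + (f2 z)\<^sup>2 + ((z1x z)\<^sup>2 + (z2x z)\<^sup>2)) integrable_on {-1<..<1}"
  shows "(slice T (\<lambda>z. f1 z * z1x z + f2 z * z2x z) has_integral 0) {-1<..<1}"
proof -
  let ?I = "{-1<..<1::real}"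
  note zcs = has_pdxD(2)[OF z1x] has_pdxD(2)[OF z2x]
  define F where "F n = slice T (\<lambda>z. mollify (step n) f1 z * mollify (step n) z1x z + mollify (step n) f2 z * mollify (step n) z2x z)" for n
  have F0: "(F n has_integral 0) ?I" for n
  proof -
    define h where "h = step n"
    have h: "0 < h" by (simp add: h_def)
    interpret M: stokes T c "mollify h z1" "mollify h z1x" "mollify h z1y" "mollify h z1xx" "mollify h z1yy"
      "mollify h z2" "mollify h z2x" "mollify h z2y" "mollify h z2xx" "mollify h z2yy"
      "mollify h q" "mollify h qx" "mollify h qy" "mollify h f1" "mollify h f2"
      by (rule mollified[OF h])
    let ?S = "\<lambda>f. steklov h (steklov h f)"
    \<comment> \<open>\<open>?w f\<close> is the derivative of the triple average of
      \<open>f\<close>, written as a difference quotient of the double average: in this form it is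
      continuous up to the walls, and zero there, whenever \<open>f\<close> is.\<close>
    let ?w = "\<lambda>f z. (translate h (?S f) z - ?S f z) / h"
    have sx: "has_pdx (?S f) (?S f')" if "has_pdx f f'" for f f' using that h by (intro has_pdx_steklov)
    have sy: "has_pdy (?S f) (?S f')" if "has_pdy f f'" for f f' using that by (intro has_pdy_steklov)
    have wx: "has_pdx (?w f) (?w f')" if "has_pdx f f'" for f f' by (intro pd_intros sx that)
    have wy: "has_pdy (?w f) (?w f')" if "has_pdy f f'" for f f' by (intro pd_intros sy that)
    have wM: "?w f z = mollify h f' z" if "has_pdx f f'" "z \<in> strip" for f f' z
      unfolding mollify_def by (rule steklov_pdx[OF sx[OF that(1)] h that(2), symmetric])
    have xM: "has_pdx (mollify h g) (?w g)" if "continuous_on strip g" for g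
      unfolding mollify_def by (rule has_pdx_steklov_quotient[OF continuous_on_steklov_strip(1)[OF continuous_on_steklov_strip(1)[OF that]] h])
    have wc: "continuous_on closed_strip (?w f)" if "continuous_on closed_strip f" for f
    proof -
      have "continuous_on closed_strip (?S f)" by (intro continuous_on_steklov_strip that)
      then show ?thesis using h continuous_on_translate_strip[of "{-1..1}" "?S f" h]
        by (auto simp: closed_strip_def intro!: continuous_intros)
    qed
    have wp: "x_periodic_on strip T (?w f)" if "x_periodic_on strip T f" for f
      by (intro x_periodic_intros that)
    have w0: "?w f (x, t) = 0" if "\<And>x. f (x, t) = 0" for f x t
      using that by (simp add: translate_def steklov_def average_def)
    have dw: "?w z1x z + ?w z2y z = 0" if z: "z \<in> strip" for z
    proof -
      have d: "?S z1x z + ?S z2y z = 0" if z: "z \<in> strip" for z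
      proof -
        have "?S z1x z + ?S z2y z = steklov h (\<lambda>z. steklov h z1x z + steklov h z2y z) z"
          by (rule steklov_linear(1)[OF _ _ z, symmetric]) (intro continuous_on_steklov_strip zcs has_pdyD(2)[OF z2y])+
        also have "\<dots> = ?S (\<lambda>z. z1x z + z2y z) z"
          by (rule steklov_cong[OF _ z]) (rule steklov_linear(1)[OF zcs(1) has_pdyD(2)[OF z2y], symmetric])
        also have "\<dots> = ?S (\<lambda>z. 0) z" by (rule steklov_cong[OF steklov_cong[OF div0] z])
        finally show ?thesis using steklov_const[OF h] by (simp add: steklov_def average_def)
      qed
      have "(fst z + h, snd z) \<in> strip" using z by (auto simp: strip_def)
      from d[OF this] d[OF z] show ?thesis
        unfolding translate_def add_divide_distrib[symmetric] divide_eq_0_iff by linarith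
    qed
    have t: "(slice T (\<lambda>z. mollify h z1x z * ?w z1x z + mollify h z1y z * ?w z1y z + mollify h z2x z * ?w z2x z + mollify h z2y z * ?w z2y z +
       (mollify h f1 z + c) * ?w z1 z + mollify h f2 z * ?w z2 z) has_integral 0) ?I"
      by (rule M.test[OF bnd(1)[OF h] bnd(2)[OF h] bnd(3)[OF h] wx[OF z1x] wy[OF z1y] wx[OF z2x] wy[OF z2y]
        wc[OF zc(1)] wc[OF zc(2)] wp[OF zper'(1)] wp[OF zper'(2)]
        w0[of z1, OF z0(1)] w0[of z1, OF z0(2)] w0[of z2, OF z0(3)] w0[of z2, OF z0(4)] dw])
    have eq: "slice T (\<lambda>z. mollify h z1x z * ?w z1x z + mollify h z1y z * ?w z1y z + mollify h z2x z * ?w z2x z + mollify h z2y z * ?w z2y z +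
       (mollify h f1 z + c) * ?w z1 z + mollify h f2 z * ?w z2 z) y = F n y" if y: "y \<in> ?I" for y
    proof -
      note g = zcs has_pdyD(2)[OF z1y] has_pdyD(2)[OF z2y]
      let ?m = "mollify h"
      \<comment> \<open>The viscous terms and the constant \<open>c\<close> together form the
        \<open>x\<close>-derivative of this function, whose integral over a period is 0.\<close>
      let ?E = "\<lambda>z. 1/2 * (?m z1x z * ?m z1x z + ?m z1y z * ?m z1y z + ?m z2x z * ?m z2x z + ?m z2y z * ?m z2y z) + c * ?m z1 z"
      note E = has_pdx_add[OF has_pdx_cmult[OF has_pdx_add[OF has_pdx_add[OF has_pdx_add[OF has_pdx_mult[OF xM[OF g(1)] xM[OF g(1)]]
        has_pdx_mult[OF xM[OF g(3)] xM[OF g(3)]]] has_pdx_mult[OF xM[OF g(2)] xM[OF g(2)]]] has_pdx_mult[OF xM[OF g(4)] xM[OF g(4)]]], of "1/2"]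
        has_pdx_cmult[OF xM[OF has_pdxD(1)[OF z1x]], of c]]
      have Ep: "x_periodic_on strip T ?E" by (intro x_periodic_intros x_periodic_on_mollify gper zper')
      have "slice T (\<lambda>z. mollify h z1x z * ?w z1x z + mollify h z1y z * ?w z1y z + mollify h z2x z * ?w z2x z + mollify h z2y z * ?w z2y z +
         (mollify h f1 z + c) * ?w z1 z + mollify h f2 z * ?w z2 z) y =
        slice T (\<lambda>z. (1/2 * (?w z1x z * ?m z1x z + ?m z1x z * ?w z1x z + (?w z1y z * ?m z1y z + ?m z1y z * ?w z1y z) +
            (?w z2x z * ?m z2x z + ?m z2x z * ?w z2x z) + (?w z2y z * ?m z2y z + ?m z2y z * ?w z2y z)) + c * ?w z1 z)
           + (?m f1 z * ?m z1x z + ?m f2 z * ?m z2x z)) y"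
        by (rule slice_cong) (use y wM[OF z1x] wM[OF z2x] in \<open>simp add: algebra_simps\<close>)
      also have "\<dots> = 0 + F n y"
        unfolding F_def h_def[symmetric]
        by (subst slice_add[OF has_pdxD(2)[OF E]])
           (use y slice_pdx_eq_0[OF E Ep T0, of y] in \<open>auto intro!: continuous_intros continuous_on_mollify fc zcs\<close>)
      finally show ?thesis by simp
    qed
    show ?thesis using t by (subst (asm) has_integral_cong[OF eq]) auto
  qed
  have Flim: "(\<lambda>n. F n y) \<longlonglongrightarrow> slice T (\<lambda>z. f1 z * z1x z + f2 z * z2x z) y" if "y \<in> ?I" for y
    unfolding F_def
    using that by (intro line_limit_slice line_limit_add line_limit_mult line_limit_mollify T gper fper fc zcs) auto
  have sc: "continuous_on strip (\<lambda>z. (g1 z)\<^sup>2 + (g2 z)\<^sup>2 + ((g3 z)\<^sup>2 + (g4 z)\<^sup>2))"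
    if "continuous_on strip g1" "continuous_on strip g2" "continuous_on strip g3" "continuous_on strip g4" for g1 g2 g3 g4 :: "real \<times> real \<Rightarrow> real"
    using that by (intro continuous_intros)
  have Fle: "\<bar>F n y\<bar> \<le> slice T (\<lambda>z. (f1 z)\<^sup>2 + (f2 z)\<^sup>2 + ((z1x z)\<^sup>2 + (z2x z)\<^sup>2)) y" if y: "y \<in> ?I" for n y
  proof -
    have y': "-1 < y" "y < 1" using y by auto
    note mc = continuous_on_mollify(1)[where h="step n"]
    let ?m = "mollify (step n)"
    have split: "slice T (\<lambda>z. (g1 z)\<^sup>2 + (g2 z)\<^sup>2 + ((g3 z)\<^sup>2 + (g4 z)\<^sup>2)) y =
       slice T (\<lambda>z. (g1 z)\<^sup>2) y + slice T (\<lambda>z. (g2 z)\<^sup>2) y + (slice T (\<lambda>z. (g3 z)\<^sup>2) y + slice T (\<lambda>z. (g4 z)\<^sup>2) y)"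
      if "continuous_on strip g1" "continuous_on strip g2" "continuous_on strip g3" "continuous_on strip g4" for g1 g2 g3 g4 :: "real \<times> real \<Rightarrow> real"
      using that y' by (simp add: slice_add continuous_intros)
    \<comment> \<open>Young's inequality makes the majorant quadratic, and averaging does not
      increase the integral of a square over a line; so the majorant becomes independent of
      \<open>n\<close>.\<close>
    have am: "\<bar>a * b + e * d\<bar> \<le> a\<^sup>2 + e\<^sup>2 + (b\<^sup>2 + d\<^sup>2)" for a b e d :: real
    proof -
      have "2 * \<bar>a * b\<bar> \<le> a\<^sup>2 + b\<^sup>2" "2 * \<bar>e * d\<bar> \<le> e\<^sup>2 + d\<^sup>2"
        using sum_squares_bound[of "\<bar>a\<bar>" "\<bar>b\<bar>"] sum_squares_bound[of "\<bar>e\<bar>" "\<bar>d\<bar>"] by (simp_all add: abs_mult mult.assoc)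
      then show ?thesis using abs_triangle_ineq[of "a * b" "e * d"] by linarith
    qed
    have "\<bar>F n y\<bar> \<le> slice T (\<lambda>z. (?m f1 z)\<^sup>2 + (?m f2 z)\<^sup>2 + ((?m z1x z)\<^sup>2 + (?m z2x z)\<^sup>2)) y"
      unfolding F_def by (rule slice_abs_le[OF _ sc y' am]) (intro continuous_intros mc fc zcs)+
    also have "\<dots> \<le> slice T (\<lambda>z. (f1 z)\<^sup>2 + (f2 z)\<^sup>2 + ((z1x z)\<^sup>2 + (z2x z)\<^sup>2)) y"
      unfolding split[OF mc[OF fc(1)] mc[OF fc(2)] mc[OF zcs(1)] mc[OF zcs(2)]] split[OF fc zcs]
      by (intro add_mono slice_mollify(2) fc zcs fper gper T y') simp_all
    finally show ?thesis .
  qed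
  have Fi: "F n integrable_on ?I" for n using F0 by blast
  have "slice T (\<lambda>z. f1 z * z1x z + f2 z * z2x z) integrable_on ?I"
    by (rule dominated_convergence(1)[OF Fi int _ Flim]) (use Fle in \<open>simp only: real_norm_def\<close>)
  moreover have "(\<lambda>n. integral ?I (F n)) \<longlonglongrightarrow> integral ?I (slice T (\<lambda>z. f1 z * z1x z + f2 z * z2x z))"
    by (rule dominated_convergence(2)[OF Fi int _ Flim]) (use Fle in \<open>simp only: real_norm_def\<close>)
  then have "(\<lambda>n. 0) \<longlonglongrightarrow> integral ?I (slice T (\<lambda>z. f1 z * z1x z + f2 z * z2x z))"
    using integral_unique[OF F0] by simp
  then have "integral ?I (slice T (\<lambda>z. f1 z * z1x z + f2 z * z2x z)) = 0"
    using LIMSEQ_unique[OF tendsto_const] by metis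
  ultimately show ?thesis by (metis integrable_integral)
qed

end

section \<open>Classical derivatives and the mean pressure drop\<close>

lemma C1_on_strip_has_pd:
  assumes "C1_on strip f"
  shows "has_pdx f (pdx f)" "has_pdy f (pdy f)"
proof -
  have op: "open strip" unfolding strip_def by (intro open_Times) auto
  have diff: "f differentiable at (x, y)" if "-1 < y" "y < 1" for x y
    using assms that differentiable_on_eq_differentiable_at[OF op, of f] unfolding C1_on_def by auto
  have fc: "continuous_on strip f" using assms differentiable_imp_continuous_on unfolding C1_on_def by blast
  have "((\<lambda>s. f (s, y)) has_real_derivative pdx f (x, y)) (at x)" if "-1 < y" "y < 1" for x y
  proof -
    have "(\<lambda>s. (s, y)) differentiable at x" by (auto simp: differentiable_def intro!: derivative_eq_intros)
    then have "(f \<circ> (\<lambda>s. (s, y))) differentiable at x"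
      using diff[OF that] by (intro differentiable_chain_at) auto
    then have "(\<lambda>s. f (s, y)) differentiable at x" by (simp add: o_def)
    then show ?thesis by (simp add: pdx_def DERIV_deriv_iff_real_differentiable)
  qed
  then show "has_pdx f (pdx f)" using assms fc by (simp add: has_pdx_def C1_on_def)
  have "((\<lambda>s. f (x, s)) has_real_derivative pdy f (x, y)) (at y)" if "-1 < y" "y < 1" for x y
  proof -
    have "(\<lambda>s. (x, s)) differentiable at y" by (auto simp: differentiable_def intro!: derivative_eq_intros)
    then have "(f \<circ> (\<lambda>s. (x, s))) differentiable at y"
      using diff[OF that] by (intro differentiable_chain_at) auto
    then have "(\<lambda>s. f (x, s)) differentiable at y" by (simp add: o_def)
    then show ?thesis by (simp add: pdy_def DERIV_deriv_iff_real_differentiable)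
  qed
  then show "has_pdy f (pdy f)" using assms fc by (simp add: has_pdy_def C1_on_def)
qed

lemma has_pd_fst: "has_pdx (\<lambda>z. fst z) (\<lambda>z. 1)" "has_pdy (\<lambda>z. fst z) (\<lambda>z. 0)"
  by (auto simp: has_pdx_def has_pdy_def intro!: continuous_intros derivative_eq_intros)

text \<open>The increment of \<open>p\<close> over one period has zero gradient on the connected
  strip, hence is a constant; \<kappa> / T is the mean pressure gradient.\<close>

lemma pressure_drop:
  assumes p: "has_pdx p px" "has_pdy p py" and per: "x_periodic_on strip T px" "x_periodic_on strip T py"
  obtains \<kappa> where "\<And>x y. -1 < y \<Longrightarrow> y < 1 \<Longrightarrow> p (x + T, y) - p (x, y) = \<kappa>"
proof -
  define g where "g z = translate T p z - p z" for z
  have gx: "has_pdx g (\<lambda>z. translate T px z - px z)" and gy: "has_pdy g (\<lambda>z. translate T py z - py z)"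
    unfolding g_def[abs_def] by (intro pd_intros p)+
  have 0: "translate T px (x, y) - px (x, y) = 0" "translate T py (x, y) - py (x, y) = 0" if "-1 < y" "y < 1" for x y
    using per that by (simp_all add: translate_def x_periodic_on_def)
  have "g (x, y) = g (0, 0)" if y: "-1 < y" "y < 1" for x y
  proof -
    have "((\<lambda>s. g (s, y)) has_real_derivative 0) (at s)" for s
      using has_pdxD(3)[OF gx y, of s] 0[OF y] by simp
    then have 1: "g (x, y) = g (0, y)" using DERIV_isconst_all[of "\<lambda>s. g (s, y)"] by blast
    have "((\<lambda>s. g (0, s)) has_real_derivative 0) (at s within {-1<..<1})" if "s \<in> {-1<..<1}" for s
      using has_pdyD(3)[OF gy, of s 0] 0[of s] that by (auto intro: has_field_derivative_at_within)
    then have "\<exists>c. \<forall>s\<in>{-1<..<1}. g (0, s) = c"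
      by (intro has_field_derivative_zero_constant) auto
    then have "g (0, y) = g (0, 0)" using y by auto
    with 1 show ?thesis by simp
  qed
  then show ?thesis using that[of "g (0, 0)"] by (simp add: g_def translate_def)
qed

section \<open>Deviation from the Poiseuille flow\<close>

text \<open>The integral of (f + t * f')^2 over a line is nonnegative, which is the quadratic
  condition of \<open>vanishing_ends_le\<close>.\<close>

lemma slice_square_le_dist:
  assumes f: "has_pdy f f'" and c: "continuous_on closed_strip f" and f0: "\<And>x. f (x, 1) = 0" "\<And>x. f (x, -1) = 0"
    and i: "slice T (\<lambda>z. (f' z)\<^sup>2) integrable_on {-1<..<1}" and y: "y \<in> {-1<..<1}"
  shows "slice T (\<lambda>z. (f z)\<^sup>2) y \<le> (1 - \<bar>y\<bar>) * integral {-1<..<1} (slice T (\<lambda>z. (f' z)\<^sup>2))"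
proof (rule vanishing_ends_le[where a'="slice T (\<lambda>z. f' z * f z + f z * f' z)", OF _ _ _ _ _ i y])
  show "continuous_on {-1..1} (slice T (\<lambda>z. (f z)\<^sup>2))" by (intro continuous_on_slice_closed continuous_intros c)
  show "slice T (\<lambda>z. (f z)\<^sup>2) (- 1) = 0" "slice T (\<lambda>z. (f z)\<^sup>2) 1 = 0" by (simp_all add: slice_def f0)
  fix y :: real assume y: "y \<in> {-1<..<1}"
  show "(slice T (\<lambda>z. (f z)\<^sup>2) has_real_derivative slice T (\<lambda>z. f' z * f z + f z * f' z) y) (at y)"
    unfolding power2_eq_square by (rule DERIV_slice[OF has_pdy_mult[OF f f]]) (use y in auto)
  fix t :: real
  note fc = has_pdyD(1)[OF f] has_pdyD(2)[OF f]
  have "0 \<le> slice T (\<lambda>z. (f z + t * f' z)\<^sup>2) y"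
    by (rule slice_nonneg) (use y in \<open>auto intro!: continuous_intros fc\<close>)
  also have "(\<lambda>z. (f z + t * f' z)\<^sup>2) = (\<lambda>z. (f z)\<^sup>2 + t * (f' z * f z + f z * f' z) + t\<^sup>2 * (f' z)\<^sup>2)"
    by (simp add: power2_eq_square algebra_simps)
  also have "slice T \<dots> y = slice T (\<lambda>z. (f z)\<^sup>2 + t * (f' z * f z + f z * f' z)) y + slice T (\<lambda>z. t\<^sup>2 * (f' z)\<^sup>2) y"
    by (rule slice_add) (use y in \<open>auto intro!: continuous_intros fc\<close>)
  also have "slice T (\<lambda>z. (f z)\<^sup>2 + t * (f' z * f z + f z * f' z)) y = slice T (\<lambda>z. (f z)\<^sup>2) y + slice T (\<lambda>z. t * (f' z * f z + f z * f' z)) y"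
    by (rule slice_add) (use y in \<open>auto intro!: continuous_intros fc\<close>)
  finally show "0 \<le> slice T (\<lambda>z. (f z)\<^sup>2) y + t * slice T (\<lambda>z. f' z * f z + f z * f' z) y + t\<^sup>2 * slice T (\<lambda>z. (f' z)\<^sup>2) y"
    by (simp add: slice_cmult)
qed

lemma slice_sup_square_le:
  assumes f: "has_pdx f f'" and T: "0 < T" and y: "-1 < y" "y < 1" and x: "x \<in> {0..T}"
  shows "(f (x, y))\<^sup>2 \<le> slice T (\<lambda>z. (f z)\<^sup>2) y / T + 2 * sqrt (slice T (\<lambda>z. (f z)\<^sup>2) y * slice T (\<lambda>z. (f' z)\<^sup>2) y)"
  unfolding slice_def
  by (rule sup_square_le[OF has_pdxD(3)[OF f y] continuous_on_strip_line[OF has_pdxD(2)[OF f] y] T x])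

lemma slice_poincare:
  assumes f: "has_pdx f f'" and T: "0 < T" and y: "-1 < y" "y < 1" and 0: "slice T f y = 0"
  shows "slice T (\<lambda>z. (f z)\<^sup>2) y \<le> T\<^sup>2 * slice T (\<lambda>z. (f' z)\<^sup>2) y"
  unfolding slice_def
  by (rule poincare_mean_zero[OF has_pdxD(3)[OF f y] continuous_on_strip_line[OF has_pdxD(2)[OF f] y] T])
     (use 0 in \<open>simp add: slice_def\<close>)

lemma slice_square_nonneg:
  "continuous_on strip f \<Longrightarrow> -1 < y \<Longrightarrow> y < 1 \<Longrightarrow> 0 \<le> slice T (\<lambda>z. (f z)\<^sup>2) y"
  by (rule slice_nonneg) (auto intro!: continuous_intros)

text \<open>By the Poincare inequality the mean term of \<open>slice_sup_square_le\<close> is at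
  most the geometric mean of the two integrals; hence 3 = 1 + 2, and no power of \<open>T\<close>
  remains.\<close>

lemma slice_sup_square_mean_zero:
  assumes f: "has_pdx f f'" and T: "0 < T" and y: "-1 < y" "y < 1" and x: "x \<in> {0..T}" and 0: "slice T f y = 0"
  shows "(f (x, y))\<^sup>2 \<le> 3 * sqrt (slice T (\<lambda>z. (f z)\<^sup>2) y * slice T (\<lambda>z. (f' z)\<^sup>2) y)"
proof -
  let ?a = "slice T (\<lambda>z. (f z)\<^sup>2) y" and ?b = "slice T (\<lambda>z. (f' z)\<^sup>2) y"
  have nn: "0 \<le> ?a" "0 \<le> ?b" using slice_square_nonneg[OF has_pdxD(1)[OF f] y] slice_square_nonneg[OF has_pdxD(2)[OF f] y] by auto
  have "(?a / T)\<^sup>2 = ?a * (?a / T\<^sup>2)" by (simp add: power2_eq_square)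
  also have "\<dots> \<le> ?a * ?b"
    using slice_poincare[OF f T y 0] T nn by (intro mult_left_mono) (auto simp: divide_le_eq mult.commute)
  finally have "?a / T \<le> sqrt (?a * ?b)" by (rule real_le_rsqrt)
  then show ?thesis using slice_sup_square_le[OF f T y x] by linarith
qed

section \<open>The flow and its deviation from the Poiseuille profile\<close>

locale ns_flow =
  fixes L \<Phi> :: real and u1 u2 p :: "real \<times> real \<Rightarrow> real"
  assumes sol: "NS0_solution L \<Phi> u1 u2 p" and L: "0 < L" and Phi: "0 \<le> \<Phi>"
begin

definition "T = 2 * L * pi"
abbreviation "I \<equiv> {-1<..<1::real}"
definition v1 :: "real \<times> real \<Rightarrow> real" where "v1 z = u1 z - poiseuille \<Phi> (snd z)"
definition X1 :: "real \<times> real \<Rightarrow> real" where "X1 = pdx u1"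
definition X2 :: "real \<times> real \<Rightarrow> real" where "X2 = pdx u2"
text \<open>The added term is minus the derivative of U, so this is the \<open>y\<close>-derivative
  of \<open>v1\<close>. Since U depends on y only and has no second component, \<open>X1\<close>,
  \<open>X2\<close> and \<open>Y2\<close> belong to u and to the deviation alike.\<close>

definition Y1 :: "real \<times> real \<Rightarrow> real" where "Y1 z = pdy u1 z + 3/2 * \<Phi> * snd z"
definition Y2 :: "real \<times> real \<Rightarrow> real" where "Y2 = pdy u2"
definition f1 :: "real \<times> real \<Rightarrow> real" where "f1 z = u1 z * X1 z + u2 z * pdy u1 z"
definition f2 :: "real \<times> real \<Rightarrow> real" where "f2 z = u1 z * X2 z + u2 z * Y2 z"

lemma T: "0 < T" using L by (simp add: T_def)
lemmas T0 = less_imp_le[OF T]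

lemma u_pd: "has_pdx u1 X1" "has_pdy u1 (pdy u1)" "has_pdx u2 X2" "has_pdy u2 Y2"
    "has_pdx X1 (pdx X1)" "has_pdx X2 (pdx X2)" "has_pdy (pdy u1) (pdy (pdy u1))" "has_pdy Y2 (pdy Y2)"
    "has_pdx p (pdx p)" "has_pdy p (pdy p)"
  using sol C1_on_strip_has_pd unfolding NS0_solution_def C2_on_def X1_def X2_def Y2_def by blast+

lemma u_closed: "continuous_on closed_strip u1" "continuous_on closed_strip u2"
    "x_periodic_on closed_strip T u1" "x_periodic_on closed_strip T u2"
    "x_periodic_on strip T (pdx p)" "x_periodic_on strip T (pdy p)"
  using sol unfolding NS0_solution_def T_def by blast+

lemma u_boundary: "u1 (x, -1) = 0" "u1 (x, 1) = 0" "u2 (x, -1) = 0" "u2 (x, 1) = 0"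
  using sol unfolding NS0_solution_def by blast+

lemma u_eqs: assumes "z \<in> strip"
  shows "f1 z + pdx p z = pdx X1 z + pdy (pdy u1) z" "f2 z + pdy p z = pdx X2 z + pdy Y2 z" "X1 z + Y2 z = 0"
  using sol assms unfolding NS0_solution_def f1_def f2_def X1_def X2_def Y2_def laplacian_def by blast+

lemma has_pd_poiseuille:
  "has_pdx (\<lambda>z. poiseuille \<Phi> (snd z)) (\<lambda>z. 0)" "has_pdy (\<lambda>z. poiseuille \<Phi> (snd z)) (\<lambda>z. - (3/2) * \<Phi> * snd z)"
proof -
  have c: "continuous_on S (poiseuille \<Phi>)" for S unfolding poiseuille_def by (intro continuous_intros)
  show "has_pdx (\<lambda>z. poiseuille \<Phi> (snd z)) (\<lambda>z. 0)" by (rule has_pdx_snd[OF c])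
  show "has_pdy (\<lambda>z. poiseuille \<Phi> (snd z)) (\<lambda>z. - (3/2) * \<Phi> * snd z)"
    by (rule has_pdy_snd[where g'="\<lambda>y. - (3/2) * \<Phi> * y"])
       (auto simp: poiseuille_def intro!: derivative_eq_intros continuous_intros)
qed

lemma has_pdy_snd_cmult: "has_pdy (\<lambda>z. c * snd z) (\<lambda>z. c)"
  by (rule has_pdy_snd[where g="\<lambda>y. c * y" and g'="\<lambda>y. c"]) (auto intro!: derivative_eq_intros)

lemma v1_pd: "has_pdx v1 X1" "has_pdy v1 Y1" "has_pdy Y1 (\<lambda>z. pdy (pdy u1) z + 3/2 * \<Phi>)"
proof -
  show "has_pdx v1 X1"
    using has_pdx_diff[OF u_pd(1) has_pd_poiseuille(1)] by (simp add: v1_def[abs_def])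
  show "has_pdy v1 Y1"
    using has_pdy_diff[OF u_pd(2) has_pd_poiseuille(2)] by (simp add: v1_def[abs_def] Y1_def[abs_def])
  show "has_pdy Y1 (\<lambda>z. pdy (pdy u1) z + 3/2 * \<Phi>)"
    using has_pdy_add[OF u_pd(7) has_pdy_snd_cmult[of "3/2 * \<Phi>"]] by (simp add: Y1_def[abs_def])
qed

lemma v1_closed: "continuous_on closed_strip v1" "x_periodic_on closed_strip T v1"
  "v1 (x, -1) = 0" "v1 (x, 1) = 0"
proof -
  show "continuous_on closed_strip v1"
    unfolding v1_def[abs_def] poiseuille_def by (intro continuous_intros u_closed)
  show "x_periodic_on closed_strip T v1"
    unfolding v1_def[abs_def] by (intro x_periodic_intros(2) u_closed) (simp add: x_periodic_on_def)
qed (simp_all add: v1_def u_boundary poiseuille_def)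

lemma cs: "continuous_on strip v1" "continuous_on strip u1" "continuous_on strip u2" "continuous_on strip X1" "continuous_on strip X2"
   "continuous_on strip Y1" "continuous_on strip Y2" "continuous_on strip (pdy u1)" "continuous_on strip f1" "continuous_on strip f2"
proof -
  note c = has_pdxD(1)[OF u_pd(1)] has_pdxD(1)[OF u_pd(3)] has_pdxD(2)[OF u_pd(1)] has_pdxD(2)[OF u_pd(3)]
    has_pdyD(2)[OF u_pd(2)] has_pdyD(2)[OF u_pd(4)]
  show "continuous_on strip f1" "continuous_on strip f2"
    unfolding f1_def[abs_def] f2_def[abs_def] by (intro continuous_intros c)+
qed (fact has_pdxD(1)[OF v1_pd(1)] has_pdyD(2)[OF v1_pd(2)] has_pdxD(1)[OF u_pd(1)] has_pdxD(1)[OF u_pd(3)]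
    has_pdxD(2)[OF u_pd(1)] has_pdxD(2)[OF u_pd(3)] has_pdyD(2)[OF u_pd(2)] has_pdyD(2)[OF u_pd(4)])+

lemma pers: "x_periodic_on strip T v1" "x_periodic_on strip T u1" "x_periodic_on strip T u2"
   "x_periodic_on strip T X1" "x_periodic_on strip T X2" "x_periodic_on strip T Y1" "x_periodic_on strip T Y2" "x_periodic_on strip T (pdy u1)"
   "x_periodic_on strip T f1" "x_periodic_on strip T f2"
proof -
  show 1: "x_periodic_on strip T v1" "x_periodic_on strip T u1" "x_periodic_on strip T u2"
    using v1_closed(2) u_closed(3,4) by (auto intro: x_periodic_on_strip)
  show 2: "x_periodic_on strip T X1" "x_periodic_on strip T X2" "x_periodic_on strip T Y1" "x_periodic_on strip T Y2" "x_periodic_on strip T (pdy u1)"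
    using x_periodic_on_pdx[OF u_pd(1) 1(2)] x_periodic_on_pdx[OF u_pd(3) 1(3)] x_periodic_on_pdy[OF v1_pd(2) 1(1)]
      x_periodic_on_pdy[OF u_pd(4) 1(3)] x_periodic_on_pdy[OF u_pd(2) 1(2)] by auto
  show "x_periodic_on strip T f1" "x_periodic_on strip T f2"
    unfolding f1_def[abs_def] f2_def[abs_def] by (intro x_periodic_intros 1 2)+
qed

lemma stokes_v:
  obtains c q qx qy where "stokes T c v1 X1 Y1 (pdx X1) (\<lambda>z. pdy (pdy u1) z + 3/2 * \<Phi>)
    u2 X2 Y2 (pdx X2) (pdy Y2) q qx qy f1 f2"
proof -
  obtain \<kappa> where k: "\<And>x y. -1 < y \<Longrightarrow> y < 1 \<Longrightarrow> p (x + T, y) - p (x, y) = \<kappa>"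
    using pressure_drop[OF u_pd(9,10) u_closed(5,6)] by metis
  \<comment> \<open>\<kappa> / T is the mean gradient removed from \<open>p\<close> to make it
    periodic; 3/2 * \<Phi> is minus the Laplacian of U, added to both sides.\<close>
  have "stokes T (\<kappa> / T + 3/2 * \<Phi>) v1 X1 Y1 (pdx X1) (\<lambda>z. pdy (pdy u1) z + 3/2 * \<Phi>)
    u2 X2 Y2 (pdx X2) (pdy Y2) (\<lambda>z. p z - \<kappa> / T * fst z) (\<lambda>z. pdx p z - \<kappa> / T * 1) (\<lambda>z. pdy p z - \<kappa> / T * 0) f1 f2"
  proof (unfold_locales)
    show "has_pdx (\<lambda>z. p z - \<kappa> / T * fst z) (\<lambda>z. pdx p z - \<kappa> / T * 1)"
      "has_pdy (\<lambda>z. p z - \<kappa> / T * fst z) (\<lambda>z. pdy p z - \<kappa> / T * 0)"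
      by (intro pd_intros u_pd has_pd_fst)+
    show "x_periodic_on strip T (\<lambda>z. p z - \<kappa> / T * fst z)"
      unfolding x_periodic_on_def
    proof (intro allI impI)
      fix x y assume "(x, y) \<in> strip"
      then have "p (x + T, y) = p (x, y) + \<kappa>" using k[of y x] by simp
      then show "p (x + T, y) - \<kappa> / T * fst (x + T, y) = p (x, y) - \<kappa> / T * fst (x, y)"
        using T by (simp add: field_simps)
    qed
    fix z assume z: "z \<in> strip"
    show "X1 z + Y2 z = 0"
      "pdx X1 z + (pdy (pdy u1) z + 3/2 * \<Phi>) = pdx p z - \<kappa> / T * 1 + (\<kappa> / T + 3/2 * \<Phi>) + f1 z"
      "pdx X2 z + pdy Y2 z = pdy p z - \<kappa> / T * 0 + f2 z"
      using u_eqs[OF z] by auto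
  qed (simp_all only: T u_pd v1_pd u_closed v1_closed cs u_boundary)
  then show ?thesis using that by blast
qed

lemma integral_poiseuille: "integral {-1..1} (poiseuille \<Phi>) = \<Phi>"
proof -
  let ?F = "\<lambda>y. 3/4 * \<Phi> * (y - y^3/3)"
  have "(poiseuille \<Phi> has_integral (?F 1 - ?F (-1))) {-1..1}"
    by (rule fundamental_theorem_of_calculus)
       (auto simp: poiseuille_def has_real_derivative_iff_has_vector_derivative[symmetric] intro!: derivative_eq_intros)
  then show ?thesis by (simp add: integral_unique)
qed

text \<open>U carries the whole flux, so the deviation has none and the constant pressure gradient
  does no work on it.\<close>

lemma flux_v1: "integral I (slice T v1) = 0"
proof -
  have c: "continuous_on (cbox (0::real, -1::real) (T, 1)) (\<lambda>(x, y). v1 (x, y))"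
    using continuous_on_subset[OF v1_closed(1), of "cbox (0, -1) (T, 1)"]
    by (auto simp: cbox_Pair_eq closed_strip_def)
  have swap: "integral {-1..1} (slice T v1) = integral {0..T} (\<lambda>x. integral {-1..1} (\<lambda>y. v1 (x, y)))"
    using integral_swap_continuous[OF c] by (simp add: slice_def[abs_def] cbox_interval)
  have "integral {-1..1} (\<lambda>y. v1 (x, y)) = 0" for x
  proof -
    have i: "(\<lambda>y. u1 (x, y)) integrable_on {-1..1}"
      by (intro integrable_continuous_real continuous_on_compose2[OF u_closed(1)]) (auto intro!: continuous_intros)
    have j: "poiseuille \<Phi> integrable_on {-1..1}"
      unfolding poiseuille_def[abs_def] by (intro integrable_continuous_real continuous_intros)
    have "integral {-1..1} (\<lambda>y. u1 (x, y)) = \<Phi>" using sol unfolding NS0_solution_def by blast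
    then show ?thesis using integral_diff[OF i j] integral_poiseuille by (simp add: v1_def)
  qed
  with swap have "integral {-1..1} (slice T v1) = 0" by simp
  then show ?thesis by (simp only: integral_open_interval_real)
qed

text \<open>By incompressibility the \<open>y\<close>-derivative of this integral is minus that of
  \<open>X1\<close> over a period, which is 0; the integral itself starts from 0 at the
  wall.\<close>

lemma slice_u2: assumes y: "y \<in> I" shows "slice T u2 y = 0"
proof -
  have "(slice T Y2 has_integral (slice T u2 y - slice T u2 (-1))) {-1..y}"
    by (rule fundamental_theorem_of_calculus_interior)
       (use y in \<open>auto simp: has_real_derivative_iff_has_vector_derivative[symmetric]
          intro!: DERIV_slice[OF u_pd(4)] continuous_on_subset[OF continuous_on_slice_closed[OF u_closed(2)]]\<close>)
  then have "(slice T Y2 has_integral (slice T u2 y)) {-1<..<y}"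
    by (simp add: slice_def u_boundary has_integral_Icc_iff_Ioo)
  moreover have "slice T Y2 s = 0" if "s \<in> {-1<..<y}" for s
  proof -
    have s: "-1 < s" "s < 1" using that y by auto
    have "slice T Y2 s = slice T (\<lambda>z. - X1 z) s"
      by (rule slice_cong) (use u_eqs(3)[of "(x, s)" for x] s in \<open>simp add: eq_neg_iff_add_eq_0 add.commute\<close>)
    also have "\<dots> = 0" using slice_pdx_eq_0[OF u_pd(1) pers(2) T0 s] by (simp add: slice_minus)
    finally show ?thesis .
  qed
  ultimately have "((\<lambda>s. 0) has_integral (slice T u2 y)) {-1<..<y}"
    by (subst (asm) has_integral_cong) auto
  then show ?thesis by (metis has_integral_0 has_integral_unique)
qed

definition "dissipation = slice T (\<lambda>z. (X1 z)\<^sup>2 + (Y1 z)\<^sup>2 + (X2 z)\<^sup>2 + (Y2 z)\<^sup>2)"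

text \<open>The case a = u, b = U of the energy inequality. Of the stretching term only v1 * u2 * U'
  survives, with U' = -3/2 * \<Phi> * y.\<close>

lemma dissipation_bound:
  shows "dissipation integrable_on I"
    "integral I dissipation \<le> 3/2 * \<Phi> * integral I (\<lambda>y. y * slice T (\<lambda>z. v1 z * u2 z) y)"
proof -
  obtain c q qx qy where st: "stokes T c v1 X1 Y1 (pdx X1) (\<lambda>z. pdy (pdy u1) z + 3/2 * \<Phi>) u2 X2 Y2 (pdx X2) (pdy Y2) q qx qy f1 f2"
    by (rule stokes_v)
  then interpret S: stokes T c v1 X1 Y1 "pdx X1" "\<lambda>z. pdy (pdy u1) z + 3/2 * \<Phi>" u2 X2 Y2 "pdx X2" "pdy Y2" q qx qy f1 f2 .
  let ?b = "\<lambda>z. poiseuille \<Phi> (snd z)" and ?by = "\<lambda>z::real\<times>real. - (3/2) * \<Phi> * snd z"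
  have bc: "continuous_on closed_strip ?b" unfolding poiseuille_def by (intro continuous_intros)
  have bp: "x_periodic_on closed_strip T ?b" by (simp add: x_periodic_on_def)
  have bint: "slice T (\<lambda>z. \<bar>0\<bar> + \<bar>?by z\<bar> + \<bar>0\<bar> + \<bar>0\<bar>) integrable_on I"
  proof -
    have "continuous_on {-1..1} (slice T (\<lambda>z. \<bar>0\<bar> + \<bar>?by z\<bar> + \<bar>0\<bar> + \<bar>0\<bar>))"
      by (intro continuous_on_slice_closed continuous_intros)
    then show ?thesis by (simp add: integrable_continuous_real integrable_on_Icc_iff_Ioo[symmetric])
  qed
  have e1: "f1 z = u1 z * X1 z + u2 z * Y1 z + (v1 z * 0 + u2 z * ?by z)"
    and e2: "f2 z = u1 z * X2 z + u2 z * Y2 z + (v1 z * 0 + u2 z * 0)" if "z \<in> strip" for z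
    by (simp_all add: f1_def f2_def Y1_def algebra_simps)
  have fl: "c * integral I (slice T v1) = 0" by (simp add: flux_v1)
  note E = S.energy_inequality[OF u_pd(1) u_pd(4) u_eqs(3) has_pd_poiseuille has_pdx_const[of 0] has_pdy_const[of 0]
    u_closed(1,2) bc continuous_on_const u_closed(3,4) bp x_periodic_intros(8), OF _ e1 e2 fl bint]
  have en: "S.energy = dissipation" by (simp add: S.energy_def dissipation_def)
  show "dissipation integrable_on I" using E(1) en by simp
  have "integral I dissipation \<le> - integral I (slice T (\<lambda>z. v1 z * (v1 z * 0 + u2 z * ?by z) + u2 z * (v1 z * 0 + u2 z * 0)))"
    using E(2) en by simp
  also have "slice T (\<lambda>z. v1 z * (v1 z * 0 + u2 z * ?by z) + u2 z * (v1 z * 0 + u2 z * 0)) =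
      (\<lambda>y. (- (3/2) * \<Phi>) * (y * slice T (\<lambda>z. v1 z * u2 z) y))"
  proof
    fix y
    have "slice T (\<lambda>z. v1 z * (v1 z * 0 + u2 z * ?by z) + u2 z * (v1 z * 0 + u2 z * 0)) y =
      slice T (\<lambda>z. (- (3/2) * \<Phi> * snd z) * (v1 z * u2 z)) y"
      by (rule slice_cong) (simp add: algebra_simps)
    then show "slice T (\<lambda>z. v1 z * (v1 z * 0 + u2 z * ?by z) + u2 z * (v1 z * 0 + u2 z * 0)) y =
      (- (3/2) * \<Phi>) * (y * slice T (\<lambda>z. v1 z * u2 z) y)"
      using slice_snd_mult[of T "\<lambda>y. - (3/2) * \<Phi> * y" "\<lambda>z. v1 z * u2 z" y] by simp
  qed
  finally show "integral I dissipation \<le> 3/2 * \<Phi> * integral I (\<lambda>y. y * slice T (\<lambda>z. v1 z * u2 z) y)"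
    by simp
qed

end

section \<open>A bound for the tangential derivative\<close>

lemma abs_diff_sum_le: "\<bar>a + b + c - d\<bar> \<le> \<bar>a\<bar> + \<bar>b\<bar> + \<bar>c\<bar> + \<bar>d :: real\<bar>"
  by linarith

lemma three_sqrt_mult: "3 * sqrt a * sqrt b = sqrt (9 * (a * b))"
proof -
  have "sqrt 9 = (3::real)" by (rule real_sqrt_unique) auto
  then show ?thesis by (simp only: real_sqrt_mult mult.assoc)
qed

text \<open>With \<delta> = 1 / (3 * sqrt \<Phi>) the interpolation leaves H / 6, and the
  arithmetic-geometric step leaves H / 4. The remaining 7/12 of \<open>H\<close> gives the factors
  27/7 and 216/7, rounded up to 4 and 33.\<close>

lemma gradient_bound_arith:
  fixes \<Phi> W E D H J :: real
  assumes p: "0 < \<Phi>" "0 \<le> W" "0 \<le> E" "0 \<le> D" "0 \<le> H"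
    and J: "\<And>\<delta>. 0 < \<delta> \<Longrightarrow> J \<le> W / \<delta> + 2 * \<delta>\<^sup>2 * H"
    and H: "H \<le> 3/4 * \<Phi> * J + 3 * sqrt (2 * sqrt (E * H)) * sqrt (D * sqrt (E * H))"
  shows "H \<le> 4 * (\<Phi> * sqrt \<Phi>) * W + 33 * (E * D)"
proof -
  let ?s = "sqrt \<Phi>"
  have s: "0 < ?s" "?s * ?s = \<Phi>" using p by simp_all
  define \<delta> where "\<delta> = 1 / (3 * ?s)"
  have d: "0 < \<delta>" "\<delta>\<^sup>2 = 1 / (9 * \<Phi>)" using s by (simp_all add: \<delta>_def power2_eq_square)
  have "3/4 * \<Phi> * J \<le> 3/4 * \<Phi> * (W / \<delta> + 2 * \<delta>\<^sup>2 * H)" using J[OF d(1)] p by (intro mult_left_mono) auto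
  also have "\<dots> = 9/4 * (\<Phi> * ?s) * W + H / 6"
    unfolding d(2) using p s by (simp add: \<delta>_def field_simps)
  finally have 1: "3/4 * \<Phi> * J \<le> 9/4 * (\<Phi> * ?s) * W + H / 6" .
  have EH: "0 \<le> E * H" using p by simp
  have "3 * sqrt (2 * sqrt (E * H)) * sqrt (D * sqrt (E * H)) = sqrt (9 * ((2 * sqrt (E * H)) * (D * sqrt (E * H))))"
    by (rule three_sqrt_mult)
  also have "9 * ((2 * sqrt (E * H)) * (D * sqrt (E * H))) = 18 * D * (sqrt (E * H))\<^sup>2" by (simp add: power2_eq_square)
  also have "\<dots> = (H / 2) * (36 * (E * D))" using EH by simp
  also have "sqrt ((H / 2) * (36 * (E * D))) \<le> (H / 2 + 36 * (E * D)) / 2"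
    using p by (intro arith_geo_mean_sqrt) auto
  finally have 2: "3 * sqrt (2 * sqrt (E * H)) * sqrt (D * sqrt (E * H)) \<le> (H / 2 + 36 * (E * D)) / 2" .
  have nn: "0 \<le> (\<Phi> * ?s) * W" "0 \<le> E * D" using p s by simp_all
  define A B where "A = (\<Phi> * ?s) * W" and "B = E * D"
  have "H \<le> 9/4 * A + H / 6 + (H / 2 + 36 * B) / 2" using H 1 2 unfolding A_def B_def mult.assoc by linarith
  then have "H \<le> 4 * A + 33 * B" using nn unfolding A_def[symmetric] B_def[symmetric] by argo
  then show ?thesis unfolding A_def B_def by (simp only: mult.assoc)
qed

context ns_flow
begin

text \<open>\<open>xi\<close> is the energy of X on a line. \<open>weighted\<close> is the W of the
  overview; its weight is U without the factor 3/4 * \<Phi>.\<close>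

definition "xi = slice T (\<lambda>z. (X1 z)\<^sup>2 + (X2 z)\<^sup>2)"
definition "weighted = integral I (\<lambda>y. (1 - y\<^sup>2) * xi y)"

lemma dissipation_continuous: "continuous_on strip (\<lambda>z. (X1 z)\<^sup>2 + (Y1 z)\<^sup>2 + (X2 z)\<^sup>2 + (Y2 z)\<^sup>2)"
  by (intro continuous_intros cs)

text \<open>The dissipation is the basic function of the gradient with a known integral up to the
  walls; integrability of other expressions in the gradient is obtained by comparison with
  it.\<close>

lemma dissipation_dominates:
  assumes f: "continuous_on strip f" and k: "0 \<le> k" "0 \<le> m"
    and le: "\<And>z. z \<in> strip \<Longrightarrow> \<bar>f z\<bar> \<le> k * ((X1 z)\<^sup>2 + (Y1 z)\<^sup>2 + (X2 z)\<^sup>2 + (Y2 z)\<^sup>2) + m"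
  shows "slice T f integrable_on I" "y \<in> I \<Longrightarrow> \<bar>slice T f y\<bar> \<le> k * dissipation y + m * T"
proof -
  show le': "\<bar>slice T f y\<bar> \<le> k * dissipation y + m * T" if y: "y \<in> I" for y
  proof -
    have "\<bar>slice T f y\<bar> \<le> slice T (\<lambda>z. k * ((X1 z)\<^sup>2 + (Y1 z)\<^sup>2 + (X2 z)\<^sup>2 + (Y2 z)\<^sup>2) + m) y"
      by (rule slice_abs_le[OF f]) (use y le in \<open>auto intro!: continuous_intros cs\<close>)
    also have "\<dots> = slice T (\<lambda>z. k * ((X1 z)\<^sup>2 + (Y1 z)\<^sup>2 + (X2 z)\<^sup>2 + (Y2 z)\<^sup>2)) y + slice T (\<lambda>z. m) y"
      by (rule slice_add) (use y in \<open>auto intro!: continuous_intros cs\<close>)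
    finally show ?thesis using T0 by (simp add: slice_cmult slice_const dissipation_def)
  qed
  show "slice T f integrable_on I"
    by (rule Ioo_integrableI_bounded[OF continuous_on_slice[OF f] _ le'])
       (intro integrable_add integrable_on_mult_right dissipation_bound(1) integrable_const_Ioo)
qed

lemma xi_facts:
  "continuous_on I xi" "y \<in> I \<Longrightarrow> 0 \<le> xi y" "y \<in> I \<Longrightarrow> xi y \<le> dissipation y" "xi integrable_on I"
proof -
  have c: "continuous_on strip (\<lambda>z. (X1 z)\<^sup>2 + (X2 z)\<^sup>2)" by (intro continuous_intros cs)
  show "continuous_on I xi" unfolding xi_def by (rule continuous_on_slice[OF c])
  show "0 \<le> xi y" if "y \<in> I" for y unfolding xi_def by (rule slice_nonneg[OF c]) (use that in auto)
  show "xi y \<le> dissipation y" if "y \<in> I" for y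
    unfolding xi_def dissipation_def by (rule slice_mono[OF c dissipation_continuous]) (use that in auto)
  show "xi integrable_on I" unfolding xi_def
    by (rule dissipation_dominates(1)[OF c, of 1 0]) auto
qed

lemma one_minus_square_bounds:
  fixes y :: real assumes "y \<in> I"
  shows "0 \<le> 1 - y\<^sup>2" "1 - y\<^sup>2 \<le> 1" "1 - \<bar>y\<bar> \<le> 1 - y\<^sup>2"
  using assms mult_left_le[of "\<bar>y\<bar>" "\<bar>y\<bar>"] by (auto simp: power2_eq_square abs_le_iff)

lemma weighted_integrable:
  assumes "continuous_on I f" "f integrable_on I" "\<And>y. y \<in> I \<Longrightarrow> 0 \<le> f y"
  shows "(\<lambda>y. (1 - y\<^sup>2) * f y) integrable_on I"
proof (rule Ioo_integrableI_bounded[OF _ assms(2)])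
  show "\<bar>(1 - y\<^sup>2) * f y\<bar> \<le> f y" if "y \<in> I" for y
    using one_minus_square_bounds[OF that] assms(3)[OF that] by (simp add: abs_mult mult_left_le_one_le)
qed (intro continuous_intros assms)

lemma weighted_bounds: "0 \<le> weighted" "weighted \<le> integral I xi"
proof -
  have i: "(\<lambda>y. (1 - y\<^sup>2) * xi y) integrable_on I" by (rule weighted_integrable) (auto simp: xi_facts)
  have b: "0 \<le> (1 - y\<^sup>2) * xi y" "(1 - y\<^sup>2) * xi y \<le> xi y" if "y \<in> I" for y
    using one_minus_square_bounds[OF that] xi_facts(2)[OF that] by (auto simp: mult_left_le_one_le)
  show "0 \<le> weighted" unfolding weighted_def by (rule integral_nonneg[OF i]) (use b in auto)
  show "weighted \<le> integral I xi" unfolding weighted_def by (rule integral_le[OF i xi_facts(4)]) (use b in auto)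
qed

text \<open>The bound is first shown for difference quotients, whose energy is finite, uniformly in
  the increment \<open>k\<close>.\<close>

lemma difference_quotient_line_bound:
  assumes k: "0 < k" and P: "0 < \<Phi>" and y: "y \<in> I"
  shows "slice T (\<lambda>z. (steklov k X1 z)\<^sup>2 + (steklov k X2 z)\<^sup>2) y
    \<le> (1 - \<bar>y\<bar>) * (4 * (\<Phi> * sqrt \<Phi>) * weighted + 33 * (integral I xi * integral I dissipation))"
proof -
  obtain c q qx qy where st: "stokes T c v1 X1 Y1 (pdx X1) (\<lambda>z. pdy (pdy u1) z + 3/2 * \<Phi>) u2 X2 Y2 (pdx X2) (pdy Y2) q qx qy f1 f2"
    by (rule stokes_v)
  let ?d = "\<lambda>f z. (translate k f z - f z) / k"
  interpret S: stokes T 0 "?d v1" "?d X1" "?d Y1" "?d (pdx X1)" "?d (\<lambda>z. pdy (pdy u1) z + 3/2 * \<Phi>)"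
     "?d u2" "?d X2" "?d Y2" "?d (pdx X2)" "?d (pdy Y2)" "?d q" "?d qx" "?d qy" "?d f1" "?d f2"
    by (rule stokes.difference_quotient[OF st])
  define d1 where "d1 = ?d v1"
  define d2 where "d2 = ?d u2"
  define d1x where "d1x = ?d X1" define d1y where "d1y = ?d Y1"
  define d2x where "d2x = ?d X2" define d2y where "d2y = ?d Y2"
  note ddef = d1_def[symmetric] d2_def[symmetric] d1x_def[symmetric] d1y_def[symmetric] d2x_def[symmetric] d2y_def[symmetric]
  note dpd = S.z1x[unfolded ddef] S.z1y[unfolded ddef] S.z2x[unfolded ddef] S.z2y[unfolded ddef]
  note dcs = has_pdxD(1)[OF dpd(1)] has_pdxD(2)[OF dpd(1)] has_pdyD(2)[OF dpd(2)] has_pdxD(1)[OF dpd(3)] has_pdxD(2)[OF dpd(3)] has_pdyD(2)[OF dpd(4)]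
  note dcl = S.zc[unfolded ddef]
  have d0: "d1 (x, 1) = 0" "d1 (x, -1) = 0" "d2 (x, 1) = 0" "d2 (x, -1) = 0" for x
    using S.z0 by (simp_all add: d1_def d2_def)
  \<comment> \<open>The stretching term of the differenced problem; here the full gradient of u
    appears.\<close>
  let ?Q = "\<lambda>z. d1 z * (d1 z * X1 z + d2 z * pdy u1 z) + d2 z * (d1 z * X2 z + d2 z * Y2 z)"
  have en: "S.energy integrable_on I" "integral I S.energy \<le> - integral I (slice T ?Q)"
  proof -
    have bint: "slice T (\<lambda>z. \<bar>X1 z\<bar> + \<bar>pdy u1 z\<bar> + \<bar>X2 z\<bar> + \<bar>Y2 z\<bar>) integrable_on I"
    proof (rule dissipation_dominates(1)[where k=1 and m="4 + 3/2 * \<Phi>"])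
      show "continuous_on strip (\<lambda>z. \<bar>X1 z\<bar> + \<bar>pdy u1 z\<bar> + \<bar>X2 z\<bar> + \<bar>Y2 z\<bar>)" by (intro continuous_intros cs)
      fix z assume z: "z \<in> strip"
      have sq: "\<bar>t\<bar> \<le> 1 + t\<^sup>2" for t :: real
        using zero_le_power2[of "\<bar>t\<bar> - 1"] abs_ge_zero[of t] by (simp add: power2_diff)
      have "\<bar>snd z\<bar> \<le> 1" using z by (auto simp: strip_def)
      then have "\<bar>3/2 * \<Phi> * snd z\<bar> \<le> 3/2 * \<Phi> * 1" unfolding abs_mult using P by (intro mult_mono) auto
      then have "\<bar>pdy u1 z\<bar> \<le> \<bar>Y1 z\<bar> + 3/2 * \<Phi>" unfolding Y1_def by linarith
      then have pu: "\<bar>pdy u1 z\<bar> \<le> 1 + (Y1 z)\<^sup>2 + 3/2 * \<Phi>" using sq[of "Y1 z"] by linarith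
      have "\<bar>X1 z\<bar> + \<bar>pdy u1 z\<bar> + \<bar>X2 z\<bar> + \<bar>Y2 z\<bar> \<le> (1 + (X1 z)\<^sup>2) + (1 + (Y1 z)\<^sup>2 + 3/2 * \<Phi>) + (1 + (X2 z)\<^sup>2) + (1 + (Y2 z)\<^sup>2)"
        by (intro add_mono sq pu)
      then show "\<bar>\<bar>X1 z\<bar> + \<bar>pdy u1 z\<bar> + \<bar>X2 z\<bar> + \<bar>Y2 z\<bar>\<bar> \<le> 1 * ((X1 z)\<^sup>2 + (Y1 z)\<^sup>2 + (X2 z)\<^sup>2 + (Y2 z)\<^sup>2) + (4 + 3/2 * \<Phi>)"
        by (simp add: algebra_simps)
    qed (use P in auto)
    have tr: "v1 (fst z + k, snd z) = u1 (fst z + k, snd z) - poiseuille \<Phi> (snd z)"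
      "Y1 (fst z + k, snd z) = pdy u1 (fst z + k, snd z) + 3/2 * \<Phi> * snd z" for z
      by (simp_all add: v1_def Y1_def)
    \<comment> \<open>A discrete product rule: the translated velocity transports the difference,
      and the difference stretches u.\<close>
    have e1: "?d f1 z = translate k u1 z * d1x z + translate k u2 z * d1y z + (d1 z * X1 z + d2 z * pdy u1 z)" for z
      unfolding d1x_def d1y_def d1_def d2_def f1_def translate_def tr v1_def Y1_def using k by (simp add: field_simps)
    have e2: "?d f2 z = translate k u1 z * d2x z + translate k u2 z * d2y z + (d1 z * X2 z + d2 z * Y2 z)" for z
      unfolding d2x_def d2y_def d1_def d2_def f2_def translate_def tr v1_def using k by (simp add: field_simps)
    have div: "translate k X1 z + translate k Y2 z = 0" if "z \<in> strip" for z
      using u_eqs(3)[of "(fst z + k, snd z)"] that by (auto simp: translate_def strip_def)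
    have tc: "continuous_on closed_strip (translate k u1)" "continuous_on closed_strip (translate k u2)"
      using continuous_on_translate_strip[of "{-1..1}" _ k] u_closed(1,2) by (auto simp: closed_strip_def)
    have z0: "0 * integral I (slice T (?d v1)) = 0" by simp
    note E = S.energy_inequality[OF has_pdx_translate[OF u_pd(1), of k] has_pdy_translate[OF u_pd(4), of k] div u_pd(1,2,3,4)
      tc u_closed(1,2) x_periodic_intros(10)[OF u_closed(3)] x_periodic_intros(10)[OF u_closed(4)] u_closed(3,4), OF _
      e1[unfolded d1_def d2_def d1x_def d1y_def] e2[unfolded d1_def d2_def d2x_def d2y_def] z0 bint]
    show "S.energy integrable_on I" "integral I S.energy \<le> - integral I (slice T ?Q)"
      using E unfolding d1_def d2_def by simp_all
  qed
  define e where "e = slice T (\<lambda>z. (d1x z)\<^sup>2 + (d1y z)\<^sup>2 + (d2x z)\<^sup>2 + (d2y z)\<^sup>2)"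
  have Se: "S.energy = e" by (simp add: S.energy_def e_def d1x_def d1y_def d2x_def d2y_def)
  note en = en[unfolded Se]
  define eta where "eta = slice T (\<lambda>z. (d1 z)\<^sup>2 + (d2 z)\<^sup>2)"
  \<comment> \<open>The difference quotient is the average of the derivative. Averages contract the
    square integral on a line, so \<open>eta\<close> is at most \<open>xi\<close>, independently of
    \<open>k\<close>.\<close>
  have dst: "d1 z = steklov k X1 z" "d2 z = steklov k X2 z" if "z \<in> strip" for z
    using steklov_pdx[OF v1_pd(1) k that] steklov_pdx[OF u_pd(3) k that] by (simp_all add: d1_def d2_def)
  have ec: "continuous_on strip (\<lambda>z. (d1x z)\<^sup>2 + (d1y z)\<^sup>2 + (d2x z)\<^sup>2 + (d2y z)\<^sup>2)" by (intro continuous_intros dcs)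
  have etac: "continuous_on strip (\<lambda>z. (d1 z)\<^sup>2 + (d2 z)\<^sup>2)" by (intro continuous_intros dcs)
  have eI: "continuous_on I e" unfolding e_def by (rule continuous_on_slice[OF ec])
  have etaI: "continuous_on I eta" unfolding eta_def by (rule continuous_on_slice[OF etac])
  have etaC: "continuous_on {-1..1} eta" unfolding eta_def by (intro continuous_on_slice_closed continuous_intros dcl)
  have e0: "0 \<le> e y" and eta0: "0 \<le> eta y" if "y \<in> I" for y
    unfolding e_def eta_def using that by (auto intro!: slice_nonneg ec etac)
  have etai: "eta integrable_on I"
    using integrable_continuous_real[OF etaC] by (simp add: integrable_on_Icc_iff_Ioo)
  have eta_xi: "eta y \<le> xi y" if y: "y \<in> I" for y
  proof -
    have y': "-1 < y" "y < 1" using y by auto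
    have "eta y = slice T (\<lambda>z. (steklov k X1 z)\<^sup>2 + (steklov k X2 z)\<^sup>2) y"
      unfolding eta_def by (rule slice_cong) (use y' dst in simp)
    also have "\<dots> = slice T (\<lambda>z. (steklov k X1 z)\<^sup>2) y + slice T (\<lambda>z. (steklov k X2 z)\<^sup>2) y"
      by (rule slice_add[OF _ _ y']) (intro continuous_intros continuous_on_steklov_strip cs)+
    also have "\<dots> \<le> slice T (\<lambda>z. (X1 z)\<^sup>2) y + slice T (\<lambda>z. (X2 z)\<^sup>2) y"
      by (intro add_mono slice_steklov(2) cs pers k T y')
    also have "\<dots> = xi y" unfolding xi_def
      by (rule slice_add[OF _ _ y', symmetric]) (intro continuous_intros cs)+
    finally show ?thesis .
  qed
  let ?H = "integral I e" and ?E = "integral I xi" and ?D = "integral I dissipation" and ?J = "integral I eta"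
  have H0: "0 \<le> ?H" by (rule integral_nonneg[OF en(1)]) (use e0 in auto)
  have E0: "0 \<le> ?E" by (rule integral_nonneg) (use xi_facts in auto)
  have J0: "0 \<le> ?J" by (rule integral_nonneg[OF etai]) (use eta0 in auto)
  have JE: "?J \<le> ?E" by (rule integral_le[OF etai xi_facts(4)]) (use eta_xi in auto)
  have D0: "0 \<le> ?D" by (rule integral_nonneg[OF dissipation_bound(1)]) (use xi_facts(2,3) order_trans in blast)
  have dist: "eta y \<le> (1 - \<bar>y\<bar>) * ?H" if y: "y \<in> I" for y
  proof -
    have y': "-1 < y" "y < 1" using y by auto
    have i: "slice T (\<lambda>z. (d1y z)\<^sup>2) integrable_on I" "slice T (\<lambda>z. (d2y z)\<^sup>2) integrable_on I"
      by (rule Ioo_integrableI_bounded[OF _ en(1)];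
          auto simp: e_def intro!: continuous_on_slice slice_abs_le continuous_intros dcs)+
    have "integral I (slice T (\<lambda>z. (d1y z)\<^sup>2)) + integral I (slice T (\<lambda>z. (d2y z)\<^sup>2)) =
        integral I (\<lambda>y. slice T (\<lambda>z. (d1y z)\<^sup>2) y + slice T (\<lambda>z. (d2y z)\<^sup>2) y)"
      by (rule integral_add[OF i, symmetric])
    also have "\<dots> \<le> ?H"
    proof (rule integral_le[OF integrable_add[OF i] en(1)])
      fix y assume y: "y \<in> I"
      have "slice T (\<lambda>z. (d1y z)\<^sup>2) y + slice T (\<lambda>z. (d2y z)\<^sup>2) y = slice T (\<lambda>z. (d1y z)\<^sup>2 + (d2y z)\<^sup>2) y"
        by (rule slice_add[symmetric]) (use y in \<open>auto intro!: continuous_intros dcs\<close>)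
      also have "\<dots> \<le> e y" unfolding e_def
        by (rule slice_mono[OF _ ec]) (use y in \<open>auto intro!: continuous_intros dcs\<close>)
      finally show "slice T (\<lambda>z. (d1y z)\<^sup>2) y + slice T (\<lambda>z. (d2y z)\<^sup>2) y \<le> e y" .
    qed
    finally have le: "integral I (slice T (\<lambda>z. (d1y z)\<^sup>2)) + integral I (slice T (\<lambda>z. (d2y z)\<^sup>2)) \<le> ?H" .
    have "eta y = slice T (\<lambda>z. (d1 z)\<^sup>2) y + slice T (\<lambda>z. (d2 z)\<^sup>2) y"
      unfolding eta_def by (rule slice_add[OF _ _ y']) (intro continuous_intros dcs)+
    also have "\<dots> \<le> (1 - \<bar>y\<bar>) * integral I (slice T (\<lambda>z. (d1y z)\<^sup>2)) + (1 - \<bar>y\<bar>) * integral I (slice T (\<lambda>z. (d2y z)\<^sup>2))"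
      by (intro add_mono slice_square_le_dist[OF dpd(2) dcl(1) d0(1,2) i(1) y] slice_square_le_dist[OF dpd(4) dcl(2) d0(3,4) i(2) y])
    also have "\<dots> \<le> (1 - \<bar>y\<bar>) * ?H"
      unfolding distrib_left[symmetric] using y le by (intro mult_left_mono) auto
    finally show ?thesis .
  qed
  have sup: "eta y \<le> 2 * sqrt (?E * ?H)" if y: "y \<in> I" for y
  proof -
    have "eta y \<le> 2 * sqrt (?J * ?H)"
    proof (rule vanishing_ends_sup_le[OF etaC _ _ _ eta0 e0 eI en(1) y, where a'="slice T (\<lambda>z. (d1y z * d1 z + d1 z * d1y z) + (d2y z * d2 z + d2 z * d2y z))"])
      show "eta 1 = 0" by (simp add: eta_def slice_def d0)
      fix y assume y: "y \<in> I"
      then have y': "-1 < y" "y < 1" by auto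
      show "(eta has_real_derivative slice T (\<lambda>z. (d1y z * d1 z + d1 z * d1y z) + (d2y z * d2 z + d2 z * d2y z)) y) (at y)"
        unfolding eta_def power2_eq_square
        by (rule DERIV_slice[OF has_pdy_add[OF has_pdy_mult[OF dpd(2) dpd(2)] has_pdy_mult[OF dpd(4) dpd(4)]] y'])
      let ?s = "\<lambda>z. sqrt ((d1 z)\<^sup>2 + (d2 z)\<^sup>2)" and ?r = "\<lambda>z. sqrt ((d1x z)\<^sup>2 + (d1y z)\<^sup>2 + (d2x z)\<^sup>2 + (d2y z)\<^sup>2)"
      have sr: "continuous_on strip ?s" "continuous_on strip ?r" by (intro continuous_intros dcs)+
      have "\<bar>slice T (\<lambda>z. (d1y z * d1 z + d1 z * d1y z) + (d2y z * d2 z + d2 z * d2y z)) y\<bar> \<le> slice T (\<lambda>z. 2 * \<bar>?s z * ?r z\<bar>) y"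
      proof (rule slice_abs_le[OF _ _ y'])
        fix x :: real
        let ?z = "(x, y)"
        have "\<bar>d1 ?z * d1y ?z + d2 ?z * d2y ?z\<bar> \<le> sqrt (((d1 ?z)\<^sup>2 + (d2 ?z)\<^sup>2) * ((d1y ?z)\<^sup>2 + (d2y ?z)\<^sup>2))"
        proof (rule real_le_rsqrt)
          have "0 \<le> (d1 ?z * d2y ?z - d2 ?z * d1y ?z)\<^sup>2" by simp
          then show "\<bar>d1 ?z * d1y ?z + d2 ?z * d2y ?z\<bar>\<^sup>2 \<le> ((d1 ?z)\<^sup>2 + (d2 ?z)\<^sup>2) * ((d1y ?z)\<^sup>2 + (d2y ?z)\<^sup>2)"
            by (simp add: power2_eq_square algebra_simps)
        qed
        also have "\<dots> \<le> sqrt (((d1 ?z)\<^sup>2 + (d2 ?z)\<^sup>2) * ((d1x ?z)\<^sup>2 + (d1y ?z)\<^sup>2 + (d2x ?z)\<^sup>2 + (d2y ?z)\<^sup>2))"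
          by (intro real_sqrt_le_mono mult_left_mono) auto
        also have "\<dots> = \<bar>?s ?z * ?r ?z\<bar>" by (simp add: real_sqrt_mult)
        finally show "\<bar>(d1y ?z * d1 ?z + d1 ?z * d1y ?z) + (d2y ?z * d2 ?z + d2 ?z * d2y ?z)\<bar> \<le> 2 * \<bar>?s ?z * ?r ?z\<bar>"
          by (simp add: mult.commute)
      qed (intro continuous_intros dcs sr)+
      also have "\<dots> = 2 * slice T (\<lambda>z. \<bar>?s z * ?r z\<bar>) y" by (rule slice_cmult)
      also have "\<dots> \<le> 2 * sqrt (slice T (\<lambda>z. (?s z)\<^sup>2) y * slice T (\<lambda>z. (?r z)\<^sup>2) y)"
        using slice_cauchy_schwarz(2)[OF sr y', of T] by simp
      also have "\<dots> = 2 * sqrt (eta y * e y)" by (simp add: eta_def e_def)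
      finally show "\<bar>slice T (\<lambda>z. (d1y z * d1 z + d1 z * d1y z) + (d2y z * d2 z + d2 z * d2y z)) y\<bar> \<le> 2 * sqrt (eta y * e y)" .
    qed
    also have "\<dots> \<le> 2 * sqrt (?E * ?H)" using JE H0 by (intro mult_left_mono real_sqrt_le_mono mult_right_mono) auto
    finally show ?thesis .
  qed
  \<comment> \<open>The first term comes from U', by |3/2 * \<Phi> * y * d1 * d2| <= 3/4 * \<Phi> *
    |d|^2; the second from the gradient of the deviation, with one factor |d| estimated by its
    maximum on the line.\<close>
  define bnd where "bnd y = 3/4 * \<Phi> * eta y + 3 * sqrt (2 * sqrt (?E * ?H)) * sqrt (dissipation y * sqrt (eta y * e y))" for y
  have Qc: "continuous_on strip ?Q" by (intro continuous_intros dcs cs)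
  have Dc: "continuous_on I dissipation" unfolding dissipation_def by (rule continuous_on_slice[OF dissipation_continuous])
  have Dn: "0 \<le> dissipation y" if "y \<in> I" for y using xi_facts(2,3)[OF that] by linarith
  have Qle: "\<bar>slice T ?Q y\<bar> \<le> bnd y" if y: "y \<in> I" for y
  proof -
    have y': "-1 < y" "y < 1" using y by auto
    let ?s = "\<lambda>z. sqrt ((d1 z)\<^sup>2 + (d2 z)\<^sup>2)" and ?g = "\<lambda>z. \<bar>X1 z\<bar> + \<bar>X2 z\<bar> / 2 + \<bar>Y1 z\<bar> / 2"
    \<comment> \<open>Each component has mean zero, so its square is at most 3 * sqrt (eta y * e y);
      two components make 6.\<close>
    define N where "N = sqrt (6 * sqrt (eta y * e y))"
    have sg: "continuous_on strip ?s" "continuous_on strip ?g" by (intro continuous_intros dcs cs ballI; simp)+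
    have mz: "slice T d1 y = 0" "slice T d2 y = 0"
    proof -
      have sd: "slice T (?d f) y = 0" if "continuous_on strip f" "x_periodic_on strip T f" for f
      proof -
        have tc: "continuous_on strip (translate k f)" using continuous_on_translate_strip[of "{-1<..<1}" f k] that by (simp add: strip_def)
        have "slice T (?d f) y = slice T (\<lambda>z. 1 / k * (translate k f z - f z)) y" by simp
        also have "\<dots> = 1 / k * (slice T (translate k f) y - slice T f y)"
          unfolding slice_cmult by (simp add: slice_diff[OF tc that(1) y'])
        also have "\<dots> = 0" using slice_translate[OF that T y'] by simp
        finally show ?thesis .
      qed
      show "slice T d1 y = 0" "slice T d2 y = 0" unfolding d1_def d2_def by (intro sd cs pers)+
    qed
    have sN: "?s (x, y) \<le> N" if x: "x \<in> {0..T}" for x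
    proof -
      have le: "slice T (\<lambda>z. (d1 z)\<^sup>2) y \<le> eta y" "slice T (\<lambda>z. (d2 z)\<^sup>2) y \<le> eta y"
        "slice T (\<lambda>z. (d1x z)\<^sup>2) y \<le> e y" "slice T (\<lambda>z. (d2x z)\<^sup>2) y \<le> e y"
        unfolding eta_def e_def using y' by (auto intro!: slice_mono continuous_intros dcs)
      note nn = slice_square_nonneg[OF dcs(1) y'] slice_square_nonneg[OF dcs(4) y'] slice_square_nonneg[OF dcs(2) y'] slice_square_nonneg[OF dcs(5) y']
      have "(d1 (x, y))\<^sup>2 \<le> 3 * sqrt (slice T (\<lambda>z. (d1 z)\<^sup>2) y * slice T (\<lambda>z. (d1x z)\<^sup>2) y)"
        by (rule slice_sup_square_mean_zero[OF dpd(1) T y' x mz(1)])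
      also have "\<dots> \<le> 3 * sqrt (eta y * e y)"
        using le nn eta0[OF y] by (intro mult_left_mono real_sqrt_le_mono mult_mono) auto
      finally have 1: "(d1 (x, y))\<^sup>2 \<le> 3 * sqrt (eta y * e y)" .
      have "(d2 (x, y))\<^sup>2 \<le> 3 * sqrt (slice T (\<lambda>z. (d2 z)\<^sup>2) y * slice T (\<lambda>z. (d2x z)\<^sup>2) y)"
        by (rule slice_sup_square_mean_zero[OF dpd(3) T y' x mz(2)])
      also have "\<dots> \<le> 3 * sqrt (eta y * e y)"
        using le nn eta0[OF y] by (intro mult_left_mono real_sqrt_le_mono mult_mono) auto
      finally have 2: "(d2 (x, y))\<^sup>2 \<le> 3 * sqrt (eta y * e y)" .
      show ?thesis unfolding N_def using 1 2 by (intro real_sqrt_le_mono) auto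
    qed
    have N0: "0 \<le> N" using eta0[OF y] e0[OF y] by (simp add: N_def)
    have "\<bar>slice T ?Q y\<bar> \<le> slice T (\<lambda>z. 3/4 * \<Phi> * ((d1 z)\<^sup>2 + (d2 z)\<^sup>2) + N * \<bar>?s z * ?g z\<bar>) y"
    proof (rule slice_abs_le[OF Qc _ y'])
      fix x assume x: "x \<in> {0..T}"
      let ?z = "(x, y)"
      have z: "?z \<in> strip" using y' by simp
      let ?n = "(d1 ?z)\<^sup>2 + (d2 ?z)\<^sup>2"
      have Yz: "Y2 ?z = - X1 ?z" using u_eqs(3)[OF z] by simp
      have pu: "pdy u1 ?z = Y1 ?z - 3/2 * \<Phi> * y" by (simp add: Y1_def)
      have m: "\<bar>d1 ?z * d2 ?z\<bar> \<le> ?n / 2"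
        using sum_squares_bound[of "\<bar>d1 ?z\<bar>" "\<bar>d2 ?z\<bar>"] by (simp add: abs_mult mult.assoc)
      have eq: "?Q ?z = X1 ?z * ((d1 ?z)\<^sup>2 - (d2 ?z)\<^sup>2) + (d1 ?z * d2 ?z) * X2 ?z + (d1 ?z * d2 ?z) * Y1 ?z - 3/2 * \<Phi> * (y * (d1 ?z * d2 ?z))"
        unfolding Yz pu by (simp add: power2_eq_square algebra_simps)
      have a1: "\<bar>X1 ?z * ((d1 ?z)\<^sup>2 - (d2 ?z)\<^sup>2)\<bar> \<le> \<bar>X1 ?z\<bar> * ?n"
        unfolding abs_mult by (intro mult_left_mono) (auto simp: abs_le_iff)
      have a2: "\<bar>(d1 ?z * d2 ?z) * X2 ?z\<bar> \<le> ?n / 2 * \<bar>X2 ?z\<bar>" "\<bar>(d1 ?z * d2 ?z) * Y1 ?z\<bar> \<le> ?n / 2 * \<bar>Y1 ?z\<bar>"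
        unfolding abs_mult[of "d1 ?z * d2 ?z"] by (intro mult_right_mono m abs_ge_zero)+
      have "\<bar>y * (d1 ?z * d2 ?z)\<bar> \<le> 1 * (?n / 2)" unfolding abs_mult[of y] using y' by (intro mult_mono m) auto
      then have a3: "\<bar>3/2 * \<Phi> * (y * (d1 ?z * d2 ?z))\<bar> \<le> 3/2 * \<Phi> * (?n / 2)"
        unfolding abs_mult[of "3/2 * \<Phi>"] using P by (intro mult_mono) auto
      have "\<bar>?Q ?z\<bar> \<le> \<bar>X1 ?z\<bar> * ?n + ?n / 2 * \<bar>X2 ?z\<bar> + ?n / 2 * \<bar>Y1 ?z\<bar> + 3/2 * \<Phi> * (?n / 2)"
        unfolding eq by (rule order_trans[OF abs_diff_sum_le]) (intro add_mono a1 a2 a3)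
      also have "\<dots> = 3/4 * \<Phi> * ?n + ?n * ?g ?z" by (simp add: field_simps)
      also have "?n = ?s ?z * ?s ?z" by simp
      also have "3/4 * \<Phi> * (?s ?z * ?s ?z) + ?s ?z * ?s ?z * ?g ?z \<le> 3/4 * \<Phi> * (?s ?z * ?s ?z) + N * \<bar>?s ?z * ?g ?z\<bar>"
      proof -
        have nn: "0 \<le> ?s ?z * ?g ?z" by (intro mult_nonneg_nonneg) auto
        have "?s ?z * (?s ?z * ?g ?z) \<le> N * (?s ?z * ?g ?z)"
          by (intro mult_right_mono sN[OF x] nn)
        then show ?thesis unfolding abs_of_nonneg[OF nn] mult.assoc[of "?s ?z" "?s ?z" "?g ?z"] by (rule add_left_mono)
      qed
      finally show "\<bar>?Q ?z\<bar> \<le> 3/4 * \<Phi> * ?n + N * \<bar>?s ?z * ?g ?z\<bar>" by simp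
    qed (intro continuous_intros dcs sg)
    also have "\<dots> = slice T (\<lambda>z. 3/4 * \<Phi> * ((d1 z)\<^sup>2 + (d2 z)\<^sup>2)) y + slice T (\<lambda>z. N * \<bar>?s z * ?g z\<bar>) y"
      by (rule slice_add[OF _ _ y']) (intro continuous_intros dcs sg)+
    also have "\<dots> = 3/4 * \<Phi> * eta y + N * slice T (\<lambda>z. \<bar>?s z * ?g z\<bar>) y"
      unfolding slice_cmult eta_def ..
    also have "slice T (\<lambda>z. \<bar>?s z * ?g z\<bar>) y \<le> sqrt (eta y * (3/2 * dissipation y))"
    proof -
      have "slice T (\<lambda>z. (?g z)\<^sup>2) y \<le> slice T (\<lambda>z. 3/2 * ((X1 z)\<^sup>2 + (Y1 z)\<^sup>2 + (X2 z)\<^sup>2 + (Y2 z)\<^sup>2)) y"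
      proof (rule slice_mono[OF _ _ y'])
        have "(a + b / 2 + c / 2)\<^sup>2 \<le> 3/2 * (a\<^sup>2 + c\<^sup>2 + b\<^sup>2 + w\<^sup>2)" for a b c w :: real
        proof -
          \<comment> \<open>Apart from the term in \<open>w\<close> this is Lagrange's identity for
            the vector (1, 1/2, 1/2), whose squared length is 3/2.\<close>
          have "0 \<le> (a / 2 - b)\<^sup>2 + (a / 2 - c)\<^sup>2 + (b - c)\<^sup>2 / 4 + 3/2 * w\<^sup>2" by simp
          then show ?thesis by (simp add: power2_eq_square field_simps)
        qed
        from this[of "\<bar>X1 (x, y)\<bar>" "\<bar>X2 (x, y)\<bar>" "\<bar>Y1 (x, y)\<bar>" "Y2 (x, y)" for x]
        show "(?g (x, y))\<^sup>2 \<le> 3/2 * ((X1 (x, y))\<^sup>2 + (Y1 (x, y))\<^sup>2 + (X2 (x, y))\<^sup>2 + (Y2 (x, y))\<^sup>2)" for x by simp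
      qed (intro continuous_intros cs ballI; simp)+
      then have g: "slice T (\<lambda>z. (?g z)\<^sup>2) y \<le> 3/2 * dissipation y" by (simp only: slice_cmult dissipation_def)
      have "slice T (\<lambda>z. \<bar>?s z * ?g z\<bar>) y \<le> sqrt (slice T (\<lambda>z. (?s z)\<^sup>2) y * slice T (\<lambda>z. (?g z)\<^sup>2) y)"
        by (rule slice_cauchy_schwarz(2)[OF sg y'])
      also have "slice T (\<lambda>z. (?s z)\<^sup>2) y = eta y" by (simp add: eta_def)
      also have "sqrt (eta y * slice T (\<lambda>z. (?g z)\<^sup>2) y) \<le> sqrt (eta y * (3/2 * dissipation y))"
        by (intro real_sqrt_le_mono mult_left_mono g eta0 y)
      finally show ?thesis .
    qed
    also have "N * sqrt (eta y * (3/2 * dissipation y)) \<le> 3 * sqrt (2 * sqrt (?E * ?H)) * sqrt (dissipation y * sqrt (eta y * e y))"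
    proof -
      \<comment> \<open>The constants combine to 6 * 3/2 = 9; one factor \<open>eta y\<close> is
        then replaced by its bound \<open>sup\<close>, which is uniform in y.\<close>
      have "N * sqrt (eta y * (3/2 * dissipation y)) = sqrt (9 * (eta y * (dissipation y * sqrt (eta y * e y))))"
        unfolding N_def real_sqrt_mult[symmetric] by (simp add: mult_ac)
      also have "\<dots> \<le> sqrt (9 * ((2 * sqrt (?E * ?H)) * (dissipation y * sqrt (eta y * e y))))"
        using sup[OF y] Dn[OF y] eta0[OF y] e0[OF y] by (intro real_sqrt_le_mono mult_left_mono mult_right_mono) auto
      also have "\<dots> = 3 * sqrt (2 * sqrt (?E * ?H)) * sqrt (dissipation y * sqrt (eta y * e y))"
        by (rule three_sqrt_mult[symmetric])
      finally show ?thesis .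
    qed
    finally show ?thesis using N0 by (simp add: bnd_def mult_left_mono)
  qed
  have r1: "(\<lambda>y. sqrt (eta y * e y)) integrable_on I" "integral I (\<lambda>y. sqrt (eta y * e y)) \<le> sqrt (?J * ?H)"
    by (rule integral_sqrt_mult_le[OF etaI eI eta0 e0 etai en(1)]; assumption)+
  have rc: "continuous_on I (\<lambda>y. sqrt (eta y * e y))" by (intro continuous_intros etaI eI)
  have rn: "0 \<le> sqrt (eta y * e y)" if "y \<in> I" for y using eta0[OF that] e0[OF that] by simp
  have r2: "(\<lambda>y. sqrt (dissipation y * sqrt (eta y * e y))) integrable_on I"
    "integral I (\<lambda>y. sqrt (dissipation y * sqrt (eta y * e y))) \<le> sqrt (?D * integral I (\<lambda>y. sqrt (eta y * e y)))"
    by (rule integral_sqrt_mult_le[OF Dc rc Dn rn dissipation_bound(1) r1(1)]; assumption)+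
  have bi: "bnd integrable_on I" unfolding bnd_def
    by (intro integrable_add integrable_on_mult_right etai r2(1))
  have Qi: "slice T ?Q integrable_on I"
    by (rule Ioo_integrableI_bounded[OF continuous_on_slice[OF Qc] bi Qle])
  have "?H \<le> \<bar>integral I (slice T ?Q)\<bar>" using en(2) by linarith
  also have "\<dots> \<le> integral I bnd" by (rule integral_abs_bound_Ioo[OF Qi bi Qle])
  also have "\<dots> = 3/4 * \<Phi> * ?J + 3 * sqrt (2 * sqrt (?E * ?H)) * integral I (\<lambda>y. sqrt (dissipation y * sqrt (eta y * e y)))"
    unfolding bnd_def using etai r2(1) by (subst integral_add) (auto intro: integrable_on_mult_right)
  also have "\<dots> \<le> 3/4 * \<Phi> * ?J + 3 * sqrt (2 * sqrt (?E * ?H)) * sqrt (?D * sqrt (?E * ?H))"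
  proof -
    have "sqrt (?J * ?H) \<le> sqrt (?E * ?H)" using JE H0 by (intro real_sqrt_le_mono mult_right_mono) auto
    then have "integral I (\<lambda>y. sqrt (eta y * e y)) \<le> sqrt (?E * ?H)" using r1(2) by linarith
    then have "sqrt (?D * integral I (\<lambda>y. sqrt (eta y * e y))) \<le> sqrt (?D * sqrt (?E * ?H))"
      using D0 by (intro real_sqrt_le_mono mult_left_mono) auto
    then have "integral I (\<lambda>y. sqrt (dissipation y * sqrt (eta y * e y))) \<le> sqrt (?D * sqrt (?E * ?H))" using r2(2) by linarith
    then show ?thesis using E0 H0 by (intro add_left_mono mult_left_mono) auto
  qed
  finally have Hle: "?H \<le> 3/4 * \<Phi> * ?J + 3 * sqrt (2 * sqrt (?E * ?H)) * sqrt (?D * sqrt (?E * ?H))" .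
  have wle: "integral I (\<lambda>y. (1 - y\<^sup>2) * eta y) \<le> weighted"
    unfolding weighted_def
    by (rule integral_le[OF weighted_integrable[OF etaI etai eta0] weighted_integrable[OF xi_facts(1,4,2)]])
       (use eta_xi one_minus_square_bounds in \<open>auto intro!: mult_left_mono\<close>)
  have Jle: "?J \<le> weighted / \<delta> + 2 * \<delta>\<^sup>2 * ?H" if "0 < \<delta>" for \<delta>
    using integral_le_weighted[OF etaI eta0 dist etai that] divide_right_mono[OF wle less_imp_le[OF that]] by linarith
  have Hfin: "?H \<le> 4 * (\<Phi> * sqrt \<Phi>) * weighted + 33 * (?E * ?D)"
    by (rule gradient_bound_arith[OF P weighted_bounds(1) E0 D0 H0 Jle Hle])
  have "slice T (\<lambda>z. (steklov k X1 z)\<^sup>2 + (steklov k X2 z)\<^sup>2) y = eta y"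
    unfolding eta_def by (rule slice_cong) (use y dst in simp)
  also have "\<dots> \<le> (1 - \<bar>y\<bar>) * ?H" by (rule dist[OF y])
  also have "\<dots> \<le> (1 - \<bar>y\<bar>) * (4 * (\<Phi> * sqrt \<Phi>) * weighted + 33 * (?E * ?D))"
    using y Hfin by (intro mult_left_mono) auto
  finally show ?thesis .
qed

lemma gradient_line_bound:
  assumes P: "0 < \<Phi>" and y: "y \<in> I"
  shows "xi y \<le> (1 - \<bar>y\<bar>) * (4 * (\<Phi> * sqrt \<Phi>) * weighted + 33 * (integral I xi * integral I dissipation))"
proof (rule LIMSEQ_le_const2)
  show "(\<lambda>n. slice T (\<lambda>z. (steklov (step n) X1 z)\<^sup>2 + (steklov (step n) X2 z)\<^sup>2) y) \<longlonglongrightarrow> xi y"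
    unfolding xi_def
    using y by (intro line_limit_slice line_limit_add line_limit_power2 line_limit_mollify T cs pers) auto
qed (use difference_quotient_line_bound[OF step_pos P y] in blast)

end

section \<open>The momentum identity\<close>

context ns_flow
begin

definition "alpha = slice T (\<lambda>z. (u2 z)\<^sup>2)"
text \<open>This is (v . grad v) . X, the cubic term.\<close>

definition N :: "real \<times> real \<Rightarrow> real" where
  "N z = v1 z * ((X1 z)\<^sup>2 + (X2 z)\<^sup>2) + u2 z * (X1 z * Y1 z + X2 z * Y2 z)"

text \<open>The integrand is the \<open>y\<close>-derivative of g * u2^2. The choices g = y - y^3
  and g = 3/4 * \<Phi> * y will be used.\<close>

lemma u2_square_divergence:
  assumes g: "\<And>y. y \<in> I \<Longrightarrow> (g has_real_derivative g' y) (at y)" "continuous_on I g'"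
    and gb: "\<And>y. y \<in> I \<Longrightarrow> \<bar>g y\<bar> \<le> C"
  shows "(slice T (\<lambda>z. g' (snd z) * (u2 z)\<^sup>2 + g (snd z) * (2 * (u2 z * Y2 z))) has_integral 0) I"
proof -
  obtain D where D: "\<And>z. z \<in> strip \<Longrightarrow> \<bar>u2 z\<bar> \<le> D"
    using strip_bounded_closed[OF u_closed(2,4) T] unfolding strip_bounded_def by blast
  note B = has_pdy_mult[OF has_pdy_snd[OF g] has_pdy_mult[OF u_pd(4) u_pd(4)]]
  show ?thesis
  proof (rule divergence_has_integral_0[OF has_pdx_const[of 0] x_periodic_intros(8) B T0 u_closed(2) u_boundary(4,3), where C="C * D"])
    fix z assume z: "z \<in> strip"
    then have y: "snd z \<in> I" by (auto simp: strip_def)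
    have C0: "0 \<le> C" using gb[OF y] by linarith
    have "\<bar>g (snd z)\<bar> * \<bar>u2 z\<bar> \<le> C * D" using gb[OF y] D[OF z] C0 by (intro mult_mono) auto
    then have "\<bar>g (snd z)\<bar> * \<bar>u2 z\<bar> * \<bar>u2 z\<bar> \<le> C * D * \<bar>u2 z\<bar>" by (intro mult_right_mono) auto
    then show "\<bar>g (snd z) * (u2 z * u2 z)\<bar> \<le> C * D * \<bar>u2 z\<bar>" by (simp add: abs_mult mult.assoc)
    show "0 + (g' (snd z) * (u2 z * u2 z) + g (snd z) * (Y2 z * u2 z + u2 z * Y2 z)) =
      g' (snd z) * (u2 z)\<^sup>2 + g (snd z) * (2 * (u2 z * Y2 z))"
      by (simp add: power2_eq_square algebra_simps)
  qed
qed

lemma alpha_facts: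
  "continuous_on I alpha" "y \<in> I \<Longrightarrow> 0 \<le> alpha y" "alpha integrable_on I"
proof -
  show "0 \<le> alpha y" if "y \<in> I" for y unfolding alpha_def using that cs(3) by (intro slice_square_nonneg) auto
  have c: "continuous_on {-1..1} alpha" unfolding alpha_def by (intro continuous_on_slice_closed continuous_intros u_closed)
  show "continuous_on I alpha" by (rule continuous_on_subset[OF c]) auto
  show "alpha integrable_on I"
    using integrable_continuous_real[OF c] by (simp only: integrable_on_Icc_iff_Ioo)
qed

lemma xi_split:
  assumes y: "y \<in> I"
  shows "xi y = slice T (\<lambda>z. (X1 z)\<^sup>2) y + slice T (\<lambda>z. (X2 z)\<^sup>2) y"
    "0 \<le> slice T (\<lambda>z. (X1 z)\<^sup>2) y" "0 \<le> slice T (\<lambda>z. (X2 z)\<^sup>2) y"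
    "slice T (\<lambda>z. (Y2 z)\<^sup>2) y = slice T (\<lambda>z. (X1 z)\<^sup>2) y"
proof -
  have y': "-1 < y" "y < 1" using y by auto
  show "xi y = slice T (\<lambda>z. (X1 z)\<^sup>2) y + slice T (\<lambda>z. (X2 z)\<^sup>2) y"
    unfolding xi_def by (rule slice_add[OF _ _ y']) (intro continuous_intros cs)+
  show "0 \<le> slice T (\<lambda>z. (X1 z)\<^sup>2) y" "0 \<le> slice T (\<lambda>z. (X2 z)\<^sup>2) y"
    by (intro slice_square_nonneg cs y')+
  show "slice T (\<lambda>z. (Y2 z)\<^sup>2) y = slice T (\<lambda>z. (X1 z)\<^sup>2) y"
  proof (rule slice_cong)
    fix x
    have "Y2 (x, y) = - X1 (x, y)" using u_eqs(3)[of "(x, y)"] y' by simp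
    then show "(Y2 (x, y))\<^sup>2 = (X1 (x, y))\<^sup>2" by simp
  qed
qed

lemma xi_weighted_integrable: "(\<lambda>y. (1 - y\<^sup>2) * xi y) integrable_on I"
  by (rule weighted_integrable[OF xi_facts(1,4,2)])

text \<open>Multiplying by \<open>y - y^3\<close> trades the weight \<open>1 - y^2\<close> on the right-hand side for a full
  power of the period.\<close>

lemma alpha_integral_le:
  assumes T3: "T \<le> 1/3"
  shows "integral I alpha \<le> T * weighted"
proof -
  let ?K = "slice T (\<lambda>z. (1 - 3 * (snd z)\<^sup>2) * (u2 z)\<^sup>2 + (snd z - snd z ^ 3) * (2 * (u2 z * Y2 z)))"
  have K: "(?K has_integral 0) I"
  proof (rule u2_square_divergence[where g="\<lambda>y. y - y^3" and g'="\<lambda>y. 1 - 3 * y\<^sup>2" and C=2])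
    show "\<bar>y - y^3\<bar> \<le> 2" if "y \<in> I" for y
    proof -
      have "\<bar>y\<bar> \<le> 1" "\<bar>y^3\<bar> \<le> 1" using that power_le_one[of "\<bar>y\<bar>" 3] by (auto simp: power_abs)
      then show ?thesis by linarith
    qed
  qed (auto intro!: derivative_eq_intros continuous_intros simp: power2_eq_square)
  have "integral I (\<lambda>y. 2 * alpha y) \<le> integral I (\<lambda>y. 2 * T * ((1 - y\<^sup>2) * xi y) - ?K y)"
  proof (rule integral_le)
    show "(\<lambda>y. 2 * alpha y) integrable_on I" by (intro integrable_on_mult_right alpha_facts)
    show "(\<lambda>y. 2 * T * ((1 - y\<^sup>2) * xi y) - ?K y) integrable_on I"
      using K by (intro integrable_diff integrable_on_mult_right xi_weighted_integrable) blast
    fix y assume y: "y \<in> I"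
    then have y': "-1 < y" "y < 1" by auto
    let ?p = "slice T (\<lambda>z. 2 * (u2 z * Y2 z)) y"
    have Ky: "?K y = (1 - 3 * y\<^sup>2) * alpha y + (y - y^3) * ?p"
    proof -
      have "?K y = slice T (\<lambda>z. (1 - 3 * (snd z)\<^sup>2) * (u2 z)\<^sup>2) y + slice T (\<lambda>z. (snd z - snd z ^ 3) * (2 * (u2 z * Y2 z))) y"
        by (rule slice_add[OF _ _ y']) (intro continuous_intros cs)+
      then show ?thesis
        by (simp only: slice_snd_mult[of T "\<lambda>y. 1 - 3 * y\<^sup>2"] slice_snd_mult[of T "\<lambda>y. y - y^3"] alpha_def)
    qed
    have p: "\<bar>?p\<bar> \<le> alpha y / T + T * slice T (\<lambda>z. (X1 z)\<^sup>2) y"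
    proof -
      have "\<bar>?p\<bar> \<le> slice T (\<lambda>z. 1 / T * (u2 z)\<^sup>2 + T * (Y2 z)\<^sup>2) y"
      proof (rule slice_abs_le[OF _ _ y'])
        have "2 * (\<bar>a\<bar> * \<bar>b\<bar>) \<le> 1 / T * a\<^sup>2 + T * b\<^sup>2" for a b
        proof -
          \<comment> \<open>Young's inequality with the weight \<open>T\<close>, which matches the
            Poincare bound of \<open>alpha\<close> by T^2 times the integral of X2^2.\<close>
          have "0 \<le> (\<bar>a\<bar> - T * \<bar>b\<bar>)\<^sup>2 / T" using T by simp
          also have "\<dots> = 1 / T * a\<^sup>2 + T * b\<^sup>2 - 2 * (\<bar>a\<bar> * \<bar>b\<bar>)"
            using T by (simp add: power2_diff field_simps power2_eq_square)
          finally show ?thesis by simp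
        qed
        then show "\<bar>2 * (u2 (x, y) * Y2 (x, y))\<bar> \<le> 1 / T * (u2 (x, y))\<^sup>2 + T * (Y2 (x, y))\<^sup>2" for x
          by (simp add: abs_mult)
      qed (intro continuous_intros cs)+
      also have "\<dots> = slice T (\<lambda>z. 1 / T * (u2 z)\<^sup>2) y + slice T (\<lambda>z. T * (Y2 z)\<^sup>2) y"
        by (rule slice_add[OF _ _ y']) (intro continuous_intros cs)+
      also have "\<dots> = alpha y / T + T * slice T (\<lambda>z. (X1 z)\<^sup>2) y"
        unfolding slice_cmult xi_split(4)[OF y] alpha_def by simp
      finally show ?thesis .
    qed
    note w = one_minus_square_bounds[OF y]
    have "(y - y^3) * ?p \<le> \<bar>y\<bar> * (1 - y\<^sup>2) * \<bar>?p\<bar>"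
    proof -
      have "y - y^3 = y * (1 - y\<^sup>2)" by (simp add: power2_eq_square power3_eq_cube algebra_simps)
      then have "\<bar>(y - y^3) * ?p\<bar> = \<bar>y\<bar> * (1 - y\<^sup>2) * \<bar>?p\<bar>" using w by (simp add: abs_mult)
      then show ?thesis by linarith
    qed
    also have "\<dots> \<le> 1 * (1 - y\<^sup>2) * (alpha y / T + T * slice T (\<lambda>z. (X1 z)\<^sup>2) y)"
      using w y p by (intro mult_mono mult_nonneg_nonneg) auto
    finally have yp: "(y - y^3) * ?p \<le> (1 - y\<^sup>2) * (alpha y / T + T * slice T (\<lambda>z. (X1 z)\<^sup>2) y)" by simp
    have al: "alpha y \<le> T\<^sup>2 * slice T (\<lambda>z. (X2 z)\<^sup>2) y"
      unfolding alpha_def by (rule slice_poincare[OF u_pd(3) T y' slice_u2[OF y]])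
    then have aT: "alpha y / T \<le> T * slice T (\<lambda>z. (X2 z)\<^sup>2) y"
      using T by (simp add: divide_le_eq power2_eq_square mult_ac)
    have "3 * alpha y \<le> 3 * T\<^sup>2 * slice T (\<lambda>z. (X2 z)\<^sup>2) y" using al by simp
    \<comment> \<open>Here T <= 1/3 enters, as 3 * T^2 <= T.\<close>
    also have "\<dots> \<le> T * slice T (\<lambda>z. (X2 z)\<^sup>2) y"
      using T3 T xi_split(3)[OF y] by (intro mult_right_mono) (auto simp: power2_eq_square)
    finally have a3: "3 * alpha y \<le> T * slice T (\<lambda>z. (X2 z)\<^sup>2) y" .
    \<comment> \<open>The cubic was chosen for 1 - 3 * y^2 = 3 * (1 - y^2) - 2: after adding 2 *
      \<open>alpha y\<close>, every term carries the weight 1 - y^2.\<close>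
    have "2 * alpha y + ?K y = (1 - y\<^sup>2) * (3 * alpha y) + (y - y^3) * ?p" unfolding Ky by (simp add: algebra_simps)
    also have "\<dots> \<le> (1 - y\<^sup>2) * (3 * alpha y) + (1 - y\<^sup>2) * (alpha y / T + T * slice T (\<lambda>z. (X1 z)\<^sup>2) y)"
      using yp by simp
    also have "\<dots> = (1 - y\<^sup>2) * (3 * alpha y + (alpha y / T + T * slice T (\<lambda>z. (X1 z)\<^sup>2) y))" by (simp only: distrib_left)
    also have "\<dots> \<le> (1 - y\<^sup>2) * (2 * T * xi y)"
    proof (rule mult_left_mono[OF _ w(1)])
      have "0 \<le> T * slice T (\<lambda>z. (X1 z)\<^sup>2) y" using T xi_split(2)[OF y] by simp
      then show "3 * alpha y + (alpha y / T + T * slice T (\<lambda>z. (X1 z)\<^sup>2) y) \<le> 2 * T * xi y"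
        using a3 aT unfolding xi_split(1)[OF y] by (simp add: distrib_left)
    qed
    also have "(1 - y\<^sup>2) * (2 * T * xi y) = 2 * T * ((1 - y\<^sup>2) * xi y)" by (simp only: mult_ac)
    finally show "2 * alpha y \<le> 2 * T * ((1 - y\<^sup>2) * xi y) - ?K y" unfolding le_diff_eq .
  qed
  also have "\<dots> = 2 * T * weighted"
    unfolding weighted_def using integral_unique[OF K] has_integral_integrable[OF K]
    by (subst integral_diff) (auto intro: integrable_on_mult_right xi_weighted_integrable)
  finally show ?thesis by simp
qed

text \<open>With u = U + v, the vanishing integral of (u . grad u) . X splits into U * |X|^2, the
  cubic term and U' * u2 * X1. Incompressibility turns the last into 3/4 * \<Phi> * y times the
  \<open>y\<close>-derivative of u2^2, so it contributes -3/4 * \<Phi> times the integral of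
  \<open>alpha\<close>.\<close>

lemma momentum_identity:
  "slice T N integrable_on I" "3/4 * \<Phi> * (weighted - integral I alpha) = - integral I (slice T N)"
proof -
  obtain c q qx qy where st: "stokes T c v1 X1 Y1 (pdx X1) (\<lambda>z. pdy (pdy u1) z + 3/2 * \<Phi>) u2 X2 Y2 (pdx X2) (pdy Y2) q qx qy f1 f2"
    by (rule stokes_v)
  then interpret S: stokes T c v1 X1 Y1 "pdx X1" "\<lambda>z. pdy (pdy u1) z + 3/2 * \<Phi>" u2 X2 Y2 "pdx X2" "pdy Y2" q qx qy f1 f2 .
  have ub: "strip_bounded u1" "strip_bounded u2"
    using strip_bounded_closed[OF u_closed(1,3) T] strip_bounded_closed[OF u_closed(2,4) T] .
  note G = has_pdx_mult[OF u_pd(1) u_pd(1)] has_pdy_mult[OF u_pd(2) u_pd(4)] has_pdx_mult[OF u_pd(1) u_pd(3)] has_pdy_mult[OF u_pd(4) u_pd(4)]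
  have F1: "f1 z = (X1 z * u1 z + u1 z * X1 z) + (pdy u1 z * u2 z + u1 z * Y2 z)"
    and F2: "f2 z = (X1 z * u2 z + u1 z * X2 z) + (Y2 z * u2 z + u2 z * Y2 z)" if "z \<in> strip" for z
  proof -
    have e: "Y2 z = - X1 z" using u_eqs(3)[OF that] by simp
    show "f1 z = (X1 z * u1 z + u1 z * X1 z) + (pdy u1 z * u2 z + u1 z * Y2 z)"
      "f2 z = (X1 z * u2 z + u1 z * X2 z) + (Y2 z * u2 z + u2 z * Y2 z)"
      unfolding f1_def f2_def e by (simp_all add: algebra_simps)
  qed
  note bnd = S.mollified_bounds[OF G strip_bounded_mult[OF ub(1) ub(1)] strip_bounded_mult[OF ub(1) ub(2)]
    strip_bounded_mult[OF ub(1) ub(2)] strip_bounded_mult[OF ub(2) ub(2)]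
    x_periodic_intros(3)[OF pers(2,3)] x_periodic_intros(3)[OF pers(3,3)], OF F1 F2]
  obtain B where B: "\<And>z. z \<in> strip \<Longrightarrow> \<bar>u1 z\<bar> \<le> B" "\<And>z. z \<in> strip \<Longrightarrow> \<bar>u2 z\<bar> \<le> B"
  proof -
    obtain B1 B2 where "\<And>z. z \<in> strip \<Longrightarrow> \<bar>u1 z\<bar> \<le> B1" "\<And>z. z \<in> strip \<Longrightarrow> \<bar>u2 z\<bar> \<le> B2"
      using ub unfolding strip_bounded_def by blast
    then show ?thesis using that[of "max B1 B2"] by (meson max.coboundedI1 max.coboundedI2)
  qed
  \<comment> \<open>u is bounded, so the convective term is square integrable because the gradient
    is; \<open>translation_identity\<close> uses this for dominated convergence.\<close>
  have int: "slice T (\<lambda>z. (f1 z)\<^sup>2 + (f2 z)\<^sup>2 + ((X1 z)\<^sup>2 + (X2 z)\<^sup>2)) integrable_on I"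
  proof (rule dissipation_dominates(1)[where k="3 * B\<^sup>2 + 1" and m="3 * B\<^sup>2 * (3/2 * \<Phi>)\<^sup>2"])
    show "continuous_on strip (\<lambda>z. (f1 z)\<^sup>2 + (f2 z)\<^sup>2 + ((X1 z)\<^sup>2 + (X2 z)\<^sup>2))" by (intro continuous_intros cs)
    fix z assume z: "z \<in> strip"
    have sq: "(a * b)\<^sup>2 \<le> B\<^sup>2 * b\<^sup>2" if "\<bar>a\<bar> \<le> B" for a b :: real
      unfolding power_mult_distrib using that by (intro mult_right_mono) (auto intro: abs_le_square_iff[THEN iffD1] simp: abs_le_square_iff[symmetric])
    have s3: "(a + (b - c))\<^sup>2 \<le> 3 * (a\<^sup>2 + b\<^sup>2 + c\<^sup>2)" for a b c :: real
    proof -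
      have "0 \<le> (a - b)\<^sup>2 + (a + c)\<^sup>2 + (b + c)\<^sup>2" by simp
      then show ?thesis by (simp add: power2_eq_square algebra_simps)
    qed
    have y1: "(snd z)\<^sup>2 \<le> 1" using z by (auto simp: strip_def abs_square_le_1)
    have "f1 z = u1 z * X1 z + (u2 z * Y1 z - u2 z * (3/2 * \<Phi> * snd z))"
      by (simp add: f1_def Y1_def algebra_simps)
    then have "(f1 z)\<^sup>2 \<le> 3 * ((u1 z * X1 z)\<^sup>2 + (u2 z * Y1 z)\<^sup>2 + (u2 z * (3/2 * \<Phi> * snd z))\<^sup>2)" using s3 by simp
    also have "\<dots> \<le> 3 * (B\<^sup>2 * (X1 z)\<^sup>2 + B\<^sup>2 * (Y1 z)\<^sup>2 + B\<^sup>2 * (3/2 * \<Phi> * snd z)\<^sup>2)"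
      by (intro mult_left_mono add_mono sq[OF B(1)[OF z]] sq[OF B(2)[OF z]]) auto
    also have "B\<^sup>2 * (3/2 * \<Phi> * snd z)\<^sup>2 \<le> B\<^sup>2 * ((3/2 * \<Phi>)\<^sup>2 * 1)"
      unfolding power_mult_distrib[of "3/2 * \<Phi>"] using y1 by (intro mult_left_mono) auto
    finally have 1: "(f1 z)\<^sup>2 \<le> 3 * (B\<^sup>2 * (X1 z)\<^sup>2 + B\<^sup>2 * (Y1 z)\<^sup>2 + B\<^sup>2 * ((3/2 * \<Phi>)\<^sup>2 * 1))" by simp
    have "(f2 z)\<^sup>2 \<le> 3 * ((u1 z * X2 z)\<^sup>2 + (u2 z * Y2 z)\<^sup>2)"
      using s3[of "u1 z * X2 z" "u2 z * Y2 z" 0] by (simp add: f2_def)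
    also have "\<dots> \<le> 3 * (B\<^sup>2 * (X2 z)\<^sup>2 + B\<^sup>2 * (Y2 z)\<^sup>2)"
      by (intro mult_left_mono add_mono sq[OF B(1)[OF z]] sq[OF B(2)[OF z]]) auto
    finally have 2: "(f2 z)\<^sup>2 \<le> 3 * (B\<^sup>2 * (X2 z)\<^sup>2 + B\<^sup>2 * (Y2 z)\<^sup>2)" .
    have "\<bar>(f1 z)\<^sup>2 + (f2 z)\<^sup>2 + ((X1 z)\<^sup>2 + (X2 z)\<^sup>2)\<bar> = (f1 z)\<^sup>2 + (f2 z)\<^sup>2 + ((X1 z)\<^sup>2 + (X2 z)\<^sup>2)" by simp
    also have "\<dots> \<le> 3 * (B\<^sup>2 * (X1 z)\<^sup>2 + B\<^sup>2 * (Y1 z)\<^sup>2 + B\<^sup>2 * ((3/2 * \<Phi>)\<^sup>2 * 1)) + 3 * (B\<^sup>2 * (X2 z)\<^sup>2 + B\<^sup>2 * (Y2 z)\<^sup>2) +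
        ((X1 z)\<^sup>2 + (Y1 z)\<^sup>2 + (X2 z)\<^sup>2 + (Y2 z)\<^sup>2)"
      by (rule add_mono[OF add_mono[OF 1 2]]) simp
    also have "\<dots> = (3 * B\<^sup>2 + 1) * ((X1 z)\<^sup>2 + (Y1 z)\<^sup>2 + (X2 z)\<^sup>2 + (Y2 z)\<^sup>2) + 3 * B\<^sup>2 * (3/2 * \<Phi>)\<^sup>2"
      by (simp add: algebra_simps)
    finally show "\<bar>(f1 z)\<^sup>2 + (f2 z)\<^sup>2 + ((X1 z)\<^sup>2 + (X2 z)\<^sup>2)\<bar> \<le> (3 * B\<^sup>2 + 1) * ((X1 z)\<^sup>2 + (Y1 z)\<^sup>2 + (X2 z)\<^sup>2 + (Y2 z)\<^sup>2) + 3 * B\<^sup>2 * (3/2 * \<Phi>)\<^sup>2" .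
  qed auto
  have t: "(slice T (\<lambda>z. f1 z * X1 z + f2 z * X2 z) has_integral 0) I"
    by (rule S.translation_identity) (use bnd int pers in auto)
  have s: "(slice T (\<lambda>z. 3/4 * \<Phi> * (u2 z)\<^sup>2 + 3/4 * \<Phi> * snd z * (2 * (u2 z * Y2 z))) has_integral 0) I"
  proof (rule u2_square_divergence[where g="\<lambda>y. 3/4 * \<Phi> * y" and g'="\<lambda>y. 3/4 * \<Phi>" and C="3/4 * \<Phi>"])
    show "\<bar>3/4 * \<Phi> * y\<bar> \<le> 3/4 * \<Phi>" if "y \<in> I" for y
    proof -
      have "3/4 * \<Phi> * \<bar>y\<bar> \<le> 3/4 * \<Phi> * 1" using that Phi by (intro mult_left_mono) auto
      then show ?thesis using Phi by (simp add: abs_mult)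
    qed
  qed (auto intro!: derivative_eq_intros)
  let ?R = "\<lambda>z. f1 z * X1 z + f2 z * X2 z - (3/4 * \<Phi> * (u2 z)\<^sup>2 + 3/4 * \<Phi> * snd z * (2 * (u2 z * Y2 z)))"
  have R: "(slice T ?R has_integral 0) I"
    by (rule has_integral_0_slice_diff[OF t s]) (intro continuous_intros cs)+
  have Nc: "continuous_on strip N" unfolding N_def[abs_def] by (intro continuous_intros cs)
  have eq: "slice T ?R y + 3/4 * \<Phi> * alpha y - 3/4 * \<Phi> * ((1 - y\<^sup>2) * xi y) = slice T N y" if y: "y \<in> I" for y
  proof -
    have y': "-1 < y" "y < 1" using y by auto
    let ?U = "\<lambda>z. poiseuille \<Phi> (snd z) * ((X1 z)\<^sup>2 + (X2 z)\<^sup>2)"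
    have Uc: "continuous_on strip ?U" unfolding poiseuille_def by (intro continuous_intros cs)
    have "slice T ?R y = slice T (\<lambda>z. ?U z + N z - 3/4 * \<Phi> * (u2 z)\<^sup>2) y"
    proof (rule slice_cong)
      fix x :: real
      let ?z = "(x, y)"
      have e: "Y2 ?z = - X1 ?z" using u_eqs(3)[of ?z] y' by simp
      have e2: "u1 ?z = poiseuille \<Phi> y + v1 ?z" "pdy u1 ?z = Y1 ?z - 3/2 * \<Phi> * y" by (simp_all add: v1_def Y1_def)
      show "?R ?z = ?U ?z + N ?z - 3/4 * \<Phi> * (u2 ?z)\<^sup>2"
        unfolding f1_def f2_def N_def e e2 snd_conv by (simp add: power2_eq_square field_simps)
    qed
    also have "\<dots> = slice T (\<lambda>z. ?U z + N z) y - slice T (\<lambda>z. 3/4 * \<Phi> * (u2 z)\<^sup>2) y"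
      by (rule slice_diff[OF _ _ y']) (intro continuous_intros cs Uc Nc)+
    also have "slice T (\<lambda>z. ?U z + N z) y = slice T ?U y + slice T N y"
      by (rule slice_add[OF Uc Nc y'])
    also have "slice T ?U y = 3/4 * \<Phi> * (1 - y\<^sup>2) * xi y"
      using slice_snd_mult[of T "poiseuille \<Phi>" "\<lambda>z. (X1 z)\<^sup>2 + (X2 z)\<^sup>2" y] by (simp only: xi_def poiseuille_def)
    finally show ?thesis unfolding slice_cmult alpha_def[symmetric] by (simp add: mult.assoc)
  qed
  have "((\<lambda>y. slice T ?R y + 3/4 * \<Phi> * alpha y - 3/4 * \<Phi> * ((1 - y\<^sup>2) * xi y)) has_integral
      0 + 3/4 * \<Phi> * integral I alpha - 3/4 * \<Phi> * weighted) I"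
    unfolding weighted_def
    by (intro has_integral_diff has_integral_add R has_integral_mult_right integrable_integral alpha_facts xi_weighted_integrable)
  then have Ni: "(slice T N has_integral (0 + 3/4 * \<Phi> * integral I alpha - 3/4 * \<Phi> * weighted)) I"
    by (subst (asm) has_integral_cong[OF eq]) auto
  show "slice T N integrable_on I" using Ni by blast
  show "3/4 * \<Phi> * (weighted - integral I alpha) = - integral I (slice T N)"
    using integral_unique[OF Ni] by (simp add: right_diff_distrib)
qed

end

section \<open>Estimates for the deviation\<close>

context ns_flow
begin

definition "E2 = integral I xi"
definition "D = integral I dissipation"
text \<open>With this abbreviation \<open>gradient_line_bound\<close> becomes the wall bound
  \<open>xi_le\<close>.\<close>

definition "K = 4 * (\<Phi> * sqrt \<Phi>) * weighted + 33 * (E2 * D)"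

lemma dissipation_facts: "continuous_on I dissipation" "y \<in> I \<Longrightarrow> 0 \<le> dissipation y"
proof -
  show "continuous_on I dissipation" unfolding dissipation_def by (rule continuous_on_slice[OF dissipation_continuous])
  show "0 \<le> dissipation y" if "y \<in> I" using xi_facts(2,3)[OF that] by linarith
qed

lemma totals: "0 \<le> weighted" "weighted \<le> E2" "0 \<le> E2" "E2 \<le> D" "0 \<le> D"
proof -
  show "0 \<le> weighted" "weighted \<le> E2" using weighted_bounds by (simp_all add: E2_def)
  then show "0 \<le> E2" by simp
  show "E2 \<le> D" unfolding E2_def D_def by (rule integral_le[OF xi_facts(4) dissipation_bound(1) xi_facts(3)])
  then show "0 \<le> D" using \<open>0 \<le> E2\<close> by simp
qed

lemma K_nonneg: "0 \<le> K" using totals Phi by (simp add: K_def)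

lemma xi_le: "0 < \<Phi> \<Longrightarrow> y \<in> I \<Longrightarrow> xi y \<le> (1 - \<bar>y\<bar>) * K"
  using gradient_line_bound by (simp add: K_def E2_def D_def)

lemma slice_square_dissipation:
  assumes y: "y \<in> I"
  shows "slice T (\<lambda>z. (Y1 z)\<^sup>2) y \<le> dissipation y" "slice T (\<lambda>z. (Y2 z)\<^sup>2) y \<le> dissipation y"
  unfolding dissipation_def using y by (auto intro!: slice_mono dissipation_continuous continuous_intros cs)

lemma slice_v1_square_le: assumes y: "y \<in> I" shows "slice T (\<lambda>z. (v1 z)\<^sup>2) y \<le> (1 - \<bar>y\<bar>) * D"
proof -
  have c: "continuous_on strip (\<lambda>z. (Y1 z)\<^sup>2)" by (intro continuous_intros cs)
  have i: "slice T (\<lambda>z. (Y1 z)\<^sup>2) integrable_on I"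
    by (rule dissipation_dominates(1)[OF c, of 1 0]) auto
  have "slice T (\<lambda>z. (v1 z)\<^sup>2) y \<le> (1 - \<bar>y\<bar>) * integral I (slice T (\<lambda>z. (Y1 z)\<^sup>2))"
    by (rule slice_square_le_dist[OF v1_pd(2) v1_closed(1,4,3) i y])
  also have "\<dots> \<le> (1 - \<bar>y\<bar>) * D" unfolding D_def
    using y by (intro mult_left_mono integral_le[OF i dissipation_bound(1)] slice_square_dissipation) auto
  finally show ?thesis .
qed

lemma alpha_le_dist: assumes y: "y \<in> I" shows "alpha y \<le> (1 - \<bar>y\<bar>) * E2"
proof -
  have c: "continuous_on strip (\<lambda>z. (Y2 z)\<^sup>2)" by (intro continuous_intros cs)
  have i: "slice T (\<lambda>z. (Y2 z)\<^sup>2) integrable_on I"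
    by (rule dissipation_dominates(1)[OF c, of 1 0]) auto
  have "alpha y \<le> (1 - \<bar>y\<bar>) * integral I (slice T (\<lambda>z. (Y2 z)\<^sup>2))"
    unfolding alpha_def by (rule slice_square_le_dist[OF u_pd(4) u_closed(2) u_boundary(4,3) i y])
  also have "\<dots> \<le> (1 - \<bar>y\<bar>) * E2" unfolding E2_def
    using y by (intro mult_left_mono integral_le[OF i xi_facts(4)]) (auto simp: xi_split)
  finally show ?thesis .
qed

text \<open>On a line at distance s from the wall the maxima of v1^2 and u2^2 are O(s), since the
  line integrals of v1^2, u2^2 and |X|^2 are. This puts half a power of the weight on each term, so
  that Cauchy-Schwarz in \<open>nonlinear_bound\<close> produces \<open>weighted\<close>.\<close>

lemma nonlinear_line_bound:
  assumes P: "0 < \<Phi>" and y: "y \<in> I"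
  shows "\<bar>slice T N y\<bar> \<le> sqrt (6 * sqrt (E2 * K)) * sqrt (((1 - y\<^sup>2) * xi y) * dissipation y) +
     sqrt (D / T + 2 * sqrt (D * K)) * sqrt (((1 - y\<^sup>2) * xi y) * xi y)"
proof -
  have y': "-1 < y" "y < 1" using y by auto
  let ?s = "1 - \<bar>y\<bar>"
  let ?b = "slice T (\<lambda>z. (X1 z)\<^sup>2) y" and ?g = "slice T (\<lambda>z. (X2 z)\<^sup>2) y" and ?m = "slice T (\<lambda>z. (v1 z)\<^sup>2) y"
  have s: "0 < ?s" "?s \<le> 1 - y\<^sup>2" using y one_minus_square_bounds(3)[OF y] by auto
  note xs = xi_split[OF y]
  have bg: "?b \<le> ?s * K" "?g \<le> ?s * K" using xs xi_le[OF P y] by auto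
  have m0: "0 \<le> ?m" by (rule slice_square_nonneg[OF cs(1) y'])
  note tot = totals K_nonneg
  define A where "A = sqrt (?s * (D / T + 2 * sqrt (D * K)))"
  define B where "B = sqrt (3 * (?s * sqrt (E2 * K)))"
  have v: "\<bar>v1 (x, y)\<bar> \<le> A" if x: "x \<in> {0..T}" for x
  proof -
    have "(v1 (x, y))\<^sup>2 \<le> ?m / T + 2 * sqrt (?m * ?b)"
      by (rule slice_sup_square_le[OF v1_pd(1) T y' x])
    also have "\<dots> \<le> (?s * D) / T + 2 * sqrt ((?s * D) * (?s * K))"
      using slice_v1_square_le[OF y] bg xs m0 T s tot
      by (intro add_mono divide_right_mono mult_left_mono real_sqrt_le_mono mult_mono) auto
    also have "(?s * D) * (?s * K) = ?s\<^sup>2 * (D * K)" by (simp add: power2_eq_square)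
    also have "sqrt (?s\<^sup>2 * (D * K)) = ?s * sqrt (D * K)" using s by (simp add: real_sqrt_mult)
    also have "?s * D / T + 2 * (?s * sqrt (D * K)) = ?s * (D / T + 2 * sqrt (D * K))" by (simp add: algebra_simps)
    finally show ?thesis unfolding A_def by (rule real_le_rsqrt[of "\<bar>v1 (x, y)\<bar>", unfolded power2_abs])
  qed
  have u: "\<bar>u2 (x, y)\<bar> \<le> B" if x: "x \<in> {0..T}" for x
  proof -
    have "(u2 (x, y))\<^sup>2 \<le> 3 * sqrt (alpha y * ?g)"
      unfolding alpha_def by (rule slice_sup_square_mean_zero[OF u_pd(3) T y' x slice_u2[OF y]])
    also have "\<dots> \<le> 3 * sqrt ((?s * E2) * (?s * K))"
      using alpha_le_dist[OF y] alpha_facts(2)[OF y] bg xs s tot by (intro mult_left_mono real_sqrt_le_mono mult_mono) auto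
    also have "(?s * E2) * (?s * K) = ?s\<^sup>2 * (E2 * K)" by (simp add: power2_eq_square)
    also have "sqrt (?s\<^sup>2 * (E2 * K)) = ?s * sqrt (E2 * K)" using s by (simp add: real_sqrt_mult)
    finally show ?thesis unfolding B_def by (rule real_le_rsqrt[of "\<bar>u2 (x, y)\<bar>", unfolded power2_abs])
  qed
  have AB: "0 \<le> A" "0 \<le> B" using v[of 0] u[of 0] T by auto
  \<comment> \<open>\<open>?w\<close> is minus the vorticity of the deviation: incompressibility
    rewrites X1 * Y1 + X2 * Y2 as X1 times \<open>?w\<close>.\<close>
  let ?w = "\<lambda>z. Y1 z - X2 z"
  have wc: "continuous_on strip ?w" by (intro continuous_intros cs)
  have Nc: "continuous_on strip N" unfolding N_def[abs_def] by (intro continuous_intros cs)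
  have "\<bar>slice T N y\<bar> \<le> slice T (\<lambda>z. A * ((X1 z)\<^sup>2 + (X2 z)\<^sup>2) + B * \<bar>X1 z * ?w z\<bar>) y"
  proof (rule slice_abs_le[OF _ _ y'])
    fix x assume x: "x \<in> {0..T}"
    let ?z = "(x, y)"
    have e: "Y2 ?z = - X1 ?z" using u_eqs(3)[of ?z] y' by simp
    have N: "N ?z = v1 ?z * ((X1 ?z)\<^sup>2 + (X2 ?z)\<^sup>2) + u2 ?z * (X1 ?z * ?w ?z)"
      unfolding N_def e by (simp add: algebra_simps)
    have "\<bar>N ?z\<bar> \<le> \<bar>v1 ?z\<bar> * ((X1 ?z)\<^sup>2 + (X2 ?z)\<^sup>2) + \<bar>u2 ?z\<bar> * \<bar>X1 ?z * ?w ?z\<bar>"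
      unfolding N by (rule order_trans[OF abs_triangle_ineq]) (simp add: abs_mult)
    also have "\<dots> \<le> A * ((X1 ?z)\<^sup>2 + (X2 ?z)\<^sup>2) + B * \<bar>X1 ?z * ?w ?z\<bar>"
      by (intro add_mono mult_right_mono v u x) auto
    finally show "\<bar>N ?z\<bar> \<le> A * ((X1 ?z)\<^sup>2 + (X2 ?z)\<^sup>2) + B * \<bar>X1 ?z * ?w ?z\<bar>" .
  qed (intro continuous_intros cs Nc)+
  also have "\<dots> = A * xi y + B * slice T (\<lambda>z. \<bar>X1 z * ?w z\<bar>) y"
  proof -
    have "slice T (\<lambda>z. A * ((X1 z)\<^sup>2 + (X2 z)\<^sup>2) + B * \<bar>X1 z * ?w z\<bar>) y =
      slice T (\<lambda>z. A * ((X1 z)\<^sup>2 + (X2 z)\<^sup>2)) y + slice T (\<lambda>z. B * \<bar>X1 z * ?w z\<bar>) y"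
      by (rule slice_add[OF _ _ y']) (intro continuous_intros cs)+
    then show ?thesis by (simp only: slice_cmult xi_def)
  qed
  also have "A * xi y \<le> sqrt (D / T + 2 * sqrt (D * K)) * sqrt (((1 - y\<^sup>2) * xi y) * xi y)"
  proof -
    have "A * xi y = sqrt (?s * (D / T + 2 * sqrt (D * K)) * (xi y * xi y))"
      using xi_facts(2)[OF y] by (simp add: A_def real_sqrt_mult)
    also have "\<dots> \<le> sqrt ((1 - y\<^sup>2) * (D / T + 2 * sqrt (D * K)) * (xi y * xi y))"
      using s xi_facts(2)[OF y] tot T by (intro real_sqrt_le_mono mult_right_mono) auto
    also have "\<dots> = sqrt (D / T + 2 * sqrt (D * K)) * sqrt (((1 - y\<^sup>2) * xi y) * xi y)"
      unfolding real_sqrt_mult[symmetric] by (simp only: mult_ac)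
    finally show ?thesis .
  qed
  also have "B * slice T (\<lambda>z. \<bar>X1 z * ?w z\<bar>) y \<le> sqrt (6 * sqrt (E2 * K)) * sqrt (((1 - y\<^sup>2) * xi y) * dissipation y)"
  proof -
    have w2: "slice T (\<lambda>z. (?w z)\<^sup>2) y \<le> 2 * dissipation y"
      unfolding dissipation_def slice_cmult[symmetric]
    proof (rule slice_mono[OF _ _ y'])
      have "(a - b)\<^sup>2 \<le> 2 * (p\<^sup>2 + a\<^sup>2 + b\<^sup>2 + q\<^sup>2)" for a b p q :: real
      proof -
        have "0 \<le> (a + b)\<^sup>2 + 2 * p\<^sup>2 + 2 * q\<^sup>2" by simp
        then show ?thesis by (simp add: power2_eq_square algebra_simps)
      qed
      then show "(?w (x, y))\<^sup>2 \<le> 2 * ((X1 (x, y))\<^sup>2 + (Y1 (x, y))\<^sup>2 + (X2 (x, y))\<^sup>2 + (Y2 (x, y))\<^sup>2)" for x .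
    qed (intro continuous_intros cs)+
    have "slice T (\<lambda>z. \<bar>X1 z * ?w z\<bar>) y \<le> sqrt (?b * slice T (\<lambda>z. (?w z)\<^sup>2) y)"
      by (rule slice_cauchy_schwarz(2)[OF cs(4) wc y'])
    also have "\<dots> \<le> sqrt (xi y * (2 * dissipation y))"
      using w2 xs slice_square_nonneg[OF wc y', of T] xi_facts(2)[OF y] by (intro real_sqrt_le_mono mult_mono) auto
    finally have "B * slice T (\<lambda>z. \<bar>X1 z * ?w z\<bar>) y \<le> B * sqrt (xi y * (2 * dissipation y))"
      using AB by (intro mult_left_mono)
    also have "\<dots> = sqrt (?s * (6 * sqrt (E2 * K) * (xi y * dissipation y)))"
      unfolding B_def real_sqrt_mult[symmetric] by (simp add: mult_ac)
    also have "\<dots> \<le> sqrt ((1 - y\<^sup>2) * (6 * sqrt (E2 * K) * (xi y * dissipation y)))"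
      using s xi_facts(2)[OF y] dissipation_facts(2)[OF y] tot by (intro real_sqrt_le_mono mult_right_mono) auto
    also have "\<dots> = sqrt (6 * sqrt (E2 * K)) * sqrt (((1 - y\<^sup>2) * xi y) * dissipation y)"
      unfolding real_sqrt_mult[symmetric] by (simp only: mult_ac)
    finally show ?thesis .
  qed
  finally show ?thesis by simp
qed

lemma nonlinear_bound:
  assumes P: "0 < \<Phi>"
  shows "\<bar>integral I (slice T N)\<bar> \<le> sqrt (6 * sqrt (E2 * K)) * sqrt (weighted * D) + sqrt (D / T + 2 * sqrt (D * K)) * sqrt (weighted * E2)"
proof -
  have wc: "continuous_on I (\<lambda>y. (1 - y\<^sup>2) * xi y)" by (intro continuous_intros xi_facts)
  have w0: "0 \<le> (1 - y\<^sup>2) * xi y" if "y \<in> I" for y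
    using one_minus_square_bounds[OF that] xi_facts(2)[OF that] by simp
  note S1 = integral_sqrt_mult_le[OF wc dissipation_facts(1) w0 dissipation_facts(2) xi_weighted_integrable dissipation_bound(1)]
  note S2 = integral_sqrt_mult_le[OF wc xi_facts(1) w0 xi_facts(2) xi_weighted_integrable xi_facts(4)]
  let ?a = "sqrt (6 * sqrt (E2 * K))" and ?b = "sqrt (D / T + 2 * sqrt (D * K))"
  let ?B = "\<lambda>y. ?a * sqrt (((1 - y\<^sup>2) * xi y) * dissipation y) + ?b * sqrt (((1 - y\<^sup>2) * xi y) * xi y)"
  have ab: "0 \<le> ?a" "0 \<le> ?b" using totals K_nonneg T by simp_all
  have i: "(\<lambda>y. ?a * sqrt (((1 - y\<^sup>2) * xi y) * dissipation y)) integrable_on I" "(\<lambda>y. ?b * sqrt (((1 - y\<^sup>2) * xi y) * xi y)) integrable_on I"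
    using S1(1) S2(1) by (auto intro!: integrable_on_mult_right)
  have "\<bar>integral I (slice T N)\<bar> \<le> integral I ?B"
    by (rule integral_abs_bound_Ioo[OF momentum_identity(1) integrable_add[OF i] nonlinear_line_bound[OF P]])
  also have "\<dots> = ?a * integral I (\<lambda>y. sqrt (((1 - y\<^sup>2) * xi y) * dissipation y)) + ?b * integral I (\<lambda>y. sqrt (((1 - y\<^sup>2) * xi y) * xi y))"
    by (subst integral_add[OF i]) simp
  also have "\<dots> \<le> ?a * sqrt (weighted * D) + ?b * sqrt (weighted * E2)"
    using S1(2) S2(2) ab by (intro add_mono mult_left_mono) (simp_all add: weighted_def D_def E2_def)
  finally show ?thesis .
qed

text \<open>Since \<open>u2\<close> has mean zero on every line, \<open>v1\<close> may be replaced by its fluctuation.\<close>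

lemma fluctuation:
  obtains mu where "continuous_on I mu" "\<And>y. y \<in> I \<Longrightarrow> 0 \<le> mu y" "\<And>y. y \<in> I \<Longrightarrow> mu y \<le> (1 - \<bar>y\<bar>) * D"
    "\<And>y. y \<in> I \<Longrightarrow> mu y \<le> T\<^sup>2 * slice T (\<lambda>z. (X1 z)\<^sup>2) y"
    "\<And>y \<kappa>. y \<in> I \<Longrightarrow> 0 < \<kappa> \<Longrightarrow> \<bar>slice T (\<lambda>z. v1 z * u2 z) y\<bar> \<le> (\<kappa> * mu y + alpha y / \<kappa>) / 2"
proof -
  define g where "g y = slice T v1 y / T" for y
  define w where "w z = v1 z - g (snd z)" for z
  have gc: "continuous_on I g" unfolding g_def using T by (intro continuous_intros continuous_on_slice cs) auto
  have wx: "has_pdx w X1" using has_pdx_diff[OF v1_pd(1) has_pdx_snd[OF gc]] by (simp add: w_def[abs_def])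
  note wc = has_pdxD(1)[OF wx]
  have gs: "continuous_on strip (\<lambda>z. g (snd z))" by (rule continuous_on_strip_snd[OF gc])
  have w0: "slice T w y = 0" if y: "y \<in> I" for y
  proof -
    have "slice T w y = slice T v1 y - slice T (\<lambda>z. g (snd z)) y"
      unfolding w_def[abs_def] by (rule slice_diff[OF cs(1) gs]) (use y in auto)
    also have "slice T (\<lambda>z. g (snd z)) y = g y * T" using T0 by (simp add: slice_def)
    finally show ?thesis using T by (simp add: g_def)
  qed
  define mu where "mu = slice T (\<lambda>z. (w z)\<^sup>2)"
  show ?thesis
  proof (rule that[of mu])
    show "continuous_on I mu" unfolding mu_def by (intro continuous_on_slice continuous_intros wc)
    fix y assume y: "y \<in> I"
    then have y': "-1 < y" "y < 1" by auto
    show "0 \<le> mu y" unfolding mu_def by (rule slice_square_nonneg[OF wc y'])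
    show "mu y \<le> T\<^sup>2 * slice T (\<lambda>z. (X1 z)\<^sup>2) y"
      unfolding mu_def by (rule slice_poincare[OF wx T y' w0[OF y]])
    \<comment> \<open>Mean and fluctuation are orthogonal on a line, so \<open>mu\<close> inherits
      the wall bound of v1^2.\<close>
    have "slice T (\<lambda>z. (v1 z)\<^sup>2) y = slice T (\<lambda>z. (w z)\<^sup>2 + (2 * g y * w z + (g y)\<^sup>2)) y"
      by (rule slice_cong) (simp add: w_def power2_eq_square algebra_simps)
    also have "\<dots> = mu y + slice T (\<lambda>z. 2 * g y * w z + (g y)\<^sup>2) y"
      unfolding mu_def by (rule slice_add[OF _ _ y']) (intro continuous_intros wc)+
    also have "slice T (\<lambda>z. 2 * g y * w z + (g y)\<^sup>2) y = slice T (\<lambda>z. 2 * g y * w z) y + slice T (\<lambda>z. (g y)\<^sup>2) y"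
      by (rule slice_add[OF _ _ y']) (intro continuous_intros wc)+
    also have "\<dots> = (g y)\<^sup>2 * T" using w0[OF y] T0 by (simp add: slice_cmult slice_const)
    finally have "mu y \<le> slice T (\<lambda>z. (v1 z)\<^sup>2) y" using T0 by simp
    then show "mu y \<le> (1 - \<bar>y\<bar>) * D" using slice_v1_square_le[OF y] by linarith
    fix \<kappa> :: real assume k: "0 < \<kappa>"
    have "slice T (\<lambda>z. v1 z * u2 z) y = slice T (\<lambda>z. w z * u2 z + g y * u2 z) y"
      by (rule slice_cong) (simp add: w_def algebra_simps)
    also have "\<dots> = slice T (\<lambda>z. w z * u2 z) y + slice T (\<lambda>z. g y * u2 z) y"
      by (rule slice_add[OF _ _ y']) (intro continuous_intros wc cs)+
    finally have "slice T (\<lambda>z. v1 z * u2 z) y = slice T (\<lambda>z. w z * u2 z) y"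
      by (simp add: slice_cmult slice_u2[OF y])
    also have "\<bar>\<dots>\<bar> \<le> slice T (\<lambda>z. \<kappa> / 2 * (w z)\<^sup>2 + 1 / (2 * \<kappa>) * (u2 z)\<^sup>2) y"
    proof (rule slice_abs_le[OF _ _ y'])
      have "\<bar>a * b\<bar> \<le> \<kappa> / 2 * a\<^sup>2 + 1 / (2 * \<kappa>) * b\<^sup>2" for a b :: real
      proof -
        have "0 \<le> (\<kappa> * \<bar>a\<bar> - \<bar>b\<bar>)\<^sup>2 / (2 * \<kappa>)" using k by simp
        also have "\<dots> = \<kappa> / 2 * a\<^sup>2 + 1 / (2 * \<kappa>) * b\<^sup>2 - \<bar>a * b\<bar>"
          using k by (simp add: power2_diff abs_mult field_simps power2_eq_square)
        finally show ?thesis by simp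
      qed
      then show "\<bar>w (x, y) * u2 (x, y)\<bar> \<le> \<kappa> / 2 * (w (x, y))\<^sup>2 + 1 / (2 * \<kappa>) * (u2 (x, y))\<^sup>2" for x .
    qed (intro continuous_intros wc cs)+
    also have "\<dots> = slice T (\<lambda>z. \<kappa> / 2 * (w z)\<^sup>2) y + slice T (\<lambda>z. 1 / (2 * \<kappa>) * (u2 z)\<^sup>2) y"
      by (rule slice_add[OF _ _ y']) (intro continuous_intros wc cs)+
    also have "\<dots> = (\<kappa> * mu y + alpha y / \<kappa>) / 2"
      unfolding slice_cmult mu_def alpha_def by (simp add: add_divide_distrib)
    finally show "\<bar>slice T (\<lambda>z. v1 z * u2 z) y\<bar> \<le> (\<kappa> * mu y + alpha y / \<kappa>) / 2" .
  qed
qed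

lemma dissipation_le_integral:
  assumes B: "B integrable_on I" and le: "\<And>y. y \<in> I \<Longrightarrow> \<bar>slice T (\<lambda>z. v1 z * u2 z) y\<bar> \<le> B y"
  shows "D \<le> 3/2 * \<Phi> * integral I B"
proof -
  have c: "continuous_on I (\<lambda>y. y * slice T (\<lambda>z. v1 z * u2 z) y)"
    by (intro continuous_intros continuous_on_slice cs)
  have l: "\<bar>y * slice T (\<lambda>z. v1 z * u2 z) y\<bar> \<le> B y" if y: "y \<in> I" for y
  proof -
    have "\<bar>y\<bar> * \<bar>slice T (\<lambda>z. v1 z * u2 z) y\<bar> \<le> 1 * B y" using le[OF y] y by (intro mult_mono) auto
    then show ?thesis by (simp add: abs_mult)
  qed
  have "integral I (\<lambda>y. y * slice T (\<lambda>z. v1 z * u2 z) y) \<le> integral I B"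
    using integral_abs_bound_Ioo[OF Ioo_integrableI_bounded[OF c B l] B l] by linarith
  then have "3/2 * \<Phi> * integral I (\<lambda>y. y * slice T (\<lambda>z. v1 z * u2 z) y) \<le> 3/2 * \<Phi> * integral I B"
    using Phi by (intro mult_left_mono) auto
  then show ?thesis using dissipation_bound(2) by (simp add: D_def)
qed

text \<open>With \<kappa> = 1, the Poincare inequality for the fluctuation of \<open>v1\<close> and
  for \<open>u2\<close> gives D <= 3/4 * (\<Phi> * T^2) * E2; as E2 <= D and 3/4 < 1, this forces D
  = 0.\<close>

lemma dissipation_small_flux:
  assumes "\<Phi> * T\<^sup>2 \<le> 1"
  shows "D = 0"
proof -
  obtain mu where mu: "continuous_on I mu" "\<And>y. y \<in> I \<Longrightarrow> 0 \<le> mu y" "\<And>y. y \<in> I \<Longrightarrow> mu y \<le> (1 - \<bar>y\<bar>) * D"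
    "\<And>y. y \<in> I \<Longrightarrow> mu y \<le> T\<^sup>2 * slice T (\<lambda>z. (X1 z)\<^sup>2) y"
    "\<And>y \<kappa>. y \<in> I \<Longrightarrow> 0 < \<kappa> \<Longrightarrow> \<bar>slice T (\<lambda>z. v1 z * u2 z) y\<bar> \<le> (\<kappa> * mu y + alpha y / \<kappa>) / 2"
    by (rule fluctuation) (rule that)
  have "D \<le> 3/2 * \<Phi> * integral I (\<lambda>y. T\<^sup>2 / 2 * xi y)"
  proof (rule dissipation_le_integral)
    show "(\<lambda>y. T\<^sup>2 / 2 * xi y) integrable_on I" by (intro integrable_on_mult_right xi_facts)
    fix y assume y: "y \<in> I"
    have al: "alpha y \<le> T\<^sup>2 * slice T (\<lambda>z. (X2 z)\<^sup>2) y"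
      unfolding alpha_def by (rule slice_poincare[OF u_pd(3) T _ _ slice_u2[OF y]]) (use y in auto)
    have "\<bar>slice T (\<lambda>z. v1 z * u2 z) y\<bar> \<le> (mu y + alpha y) / 2" using mu(5)[OF y, of 1] by simp
    also have "\<dots> \<le> (T\<^sup>2 * slice T (\<lambda>z. (X1 z)\<^sup>2) y + T\<^sup>2 * slice T (\<lambda>z. (X2 z)\<^sup>2) y) / 2"
      using mu(4)[OF y] al by simp
    also have "\<dots> = T\<^sup>2 / 2 * xi y" unfolding xi_split(1)[OF y] by (simp add: algebra_simps)
    finally show "\<bar>slice T (\<lambda>z. v1 z * u2 z) y\<bar> \<le> T\<^sup>2 / 2 * xi y" .
  qed
  also have "\<dots> = 3/4 * (\<Phi> * T\<^sup>2) * E2" by (simp add: E2_def)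
  also have "\<dots> \<le> 3/4 * 1 * D" using totals assms Phi by (intro mult_mono) auto
  finally show ?thesis using totals by simp
qed

text \<open>The fluctuation is treated by \<open>integral_le_weighted\<close>, and \<open>u2\<close>
  by \<open>alpha_integral_le\<close>. The parameters stay free until the powers of \<Phi> are
  balanced in \<open>high_flux_arith\<close>.\<close>

lemma dissipation_weighted_bound:
  assumes T3: "T \<le> 1/3" and k: "0 < \<kappa>" "0 < \<delta>"
  shows "D \<le> 3/4 * \<Phi> * (\<kappa> * (T\<^sup>2 * weighted / \<delta> + 2 * \<delta>\<^sup>2 * D) + T * weighted / \<kappa>)"
proof -
  obtain mu where mu: "continuous_on I mu" "\<And>y. y \<in> I \<Longrightarrow> 0 \<le> mu y" "\<And>y. y \<in> I \<Longrightarrow> mu y \<le> (1 - \<bar>y\<bar>) * D"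
    "\<And>y. y \<in> I \<Longrightarrow> mu y \<le> T\<^sup>2 * slice T (\<lambda>z. (X1 z)\<^sup>2) y"
    "\<And>y \<kappa>. y \<in> I \<Longrightarrow> 0 < \<kappa> \<Longrightarrow> \<bar>slice T (\<lambda>z. v1 z * u2 z) y\<bar> \<le> (\<kappa> * mu y + alpha y / \<kappa>) / 2"
    by (rule fluctuation) (rule that)
  have mx: "mu y \<le> T\<^sup>2 * xi y" if y: "y \<in> I" for y
  proof -
    have "T\<^sup>2 * slice T (\<lambda>z. (X1 z)\<^sup>2) y \<le> T\<^sup>2 * xi y" using xi_split[OF y] by (intro mult_left_mono) auto
    then show ?thesis using mu(4)[OF y] by linarith
  qed
  have mi: "mu integrable_on I"
    by (rule Ioo_integrableI_bounded[OF mu(1), of "\<lambda>y. T\<^sup>2 * xi y"]) (use mu(2) mx in \<open>auto intro!: integrable_on_mult_right xi_facts\<close>)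
  have "integral I (\<lambda>y. (1 - y\<^sup>2) * mu y) \<le> integral I (\<lambda>y. T\<^sup>2 * ((1 - y\<^sup>2) * xi y))"
  proof (rule integral_le[OF weighted_integrable[OF mu(1) mi mu(2)]])
    show "(\<lambda>y. T\<^sup>2 * ((1 - y\<^sup>2) * xi y)) integrable_on I" by (intro integrable_on_mult_right xi_weighted_integrable)
    fix y assume y: "y \<in> I"
    have "(1 - y\<^sup>2) * mu y \<le> (1 - y\<^sup>2) * (T\<^sup>2 * xi y)"
      by (rule mult_left_mono[OF mx[OF y] one_minus_square_bounds(1)[OF y]])
    then show "(1 - y\<^sup>2) * mu y \<le> T\<^sup>2 * ((1 - y\<^sup>2) * xi y)" by (simp only: mult_ac)
  qed
  then have wm: "integral I (\<lambda>y. (1 - y\<^sup>2) * mu y) \<le> T\<^sup>2 * weighted" by (simp add: weighted_def)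
  have "integral I mu \<le> integral I (\<lambda>y. (1 - y\<^sup>2) * mu y) / \<delta> + 2 * \<delta>\<^sup>2 * D"
    by (rule integral_le_weighted[OF mu(1,2,3) mi k(2)])
  also have "\<dots> \<le> T\<^sup>2 * weighted / \<delta> + 2 * \<delta>\<^sup>2 * D" using wm k by (simp add: divide_right_mono)
  finally have m: "integral I mu \<le> T\<^sup>2 * weighted / \<delta> + 2 * \<delta>\<^sup>2 * D" .
  have ai: "integral I alpha \<le> T * weighted" by (rule alpha_integral_le[OF T3])
  have "D \<le> 3/2 * \<Phi> * integral I (\<lambda>y. (\<kappa> * mu y + alpha y / \<kappa>) / 2)"
    by (rule dissipation_le_integral)
       (use mu(5) k in \<open>auto intro!: integrable_on_divide integrable_add integrable_on_mult_right mi alpha_facts\<close>)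
  also have "integral I (\<lambda>y. (\<kappa> * mu y + alpha y / \<kappa>) / 2) = (\<kappa> * integral I mu + integral I alpha / \<kappa>) / 2"
    using mi alpha_facts(3) by (simp add: integral_add integrable_on_mult_right integrable_on_divide)
  also have "3/2 * \<Phi> * ((\<kappa> * integral I mu + integral I alpha / \<kappa>) / 2) = 3/4 * \<Phi> * (\<kappa> * integral I mu + integral I alpha / \<kappa>)" by simp
  also have "\<dots> \<le> 3/4 * \<Phi> * (\<kappa> * (T\<^sup>2 * weighted / \<delta> + 2 * \<delta>\<^sup>2 * D) + T * weighted / \<kappa>)"
    using m ai k Phi by (intro mult_left_mono add_mono divide_right_mono) auto
  finally show ?thesis .
qed

text \<open>The wall-distance bounds make the integrals of v1^2 and u2^2 over every line vanish, and
  the sup estimate turns this into pointwise zeros on one period.\<close>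

lemma poiseuille_if_no_dissipation:
  assumes "D = 0"
  shows "is_poiseuille_flow \<Phi> u1 u2"
proof -
  have E0: "E2 = 0" using totals assms by simp
  have zero: "v1 (x, y) = 0 \<and> u2 (x, y) = 0" if y: "y \<in> I" and x: "x \<in> {0..T}" for x y
  proof -
    have y': "-1 < y" "y < 1" using y by auto
    have m: "slice T (\<lambda>z. (v1 z)\<^sup>2) y = 0"
      using slice_v1_square_le[OF y] slice_square_nonneg[OF cs(1) y', of T] assms by simp
    have a: "slice T (\<lambda>z. (u2 z)\<^sup>2) y = 0"
      using alpha_le_dist[OF y] alpha_facts(2)[OF y] E0 by (simp add: alpha_def)
    have "(v1 (x, y))\<^sup>2 \<le> 0" "(u2 (x, y))\<^sup>2 \<le> 0"
      using slice_sup_square_le[OF v1_pd(1) T y' x] slice_sup_square_le[OF u_pd(3) T y' x] m a by simp_all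
    then show ?thesis by simp
  qed
  have zero': "v1 (x, y) = 0 \<and> u2 (x, y) = 0" if y: "y \<in> I" for x y
  proof -
    obtain t where t: "0 \<le> t" "t \<le> T" "\<And>g s. shift_periodic T g \<Longrightarrow> g (t + s) = (g (x + s) :: real)"
      using shift_periodic_reduce[OF T, of x] by metis
    have "shift_periodic T (\<lambda>x. v1 (x, y))" "shift_periodic T (\<lambda>x. u2 (x, y))"
      using pers(1,3) y by (auto intro!: shift_periodic_strip_line)
    from t(3)[OF this(1), of 0] t(3)[OF this(2), of 0] show ?thesis using zero[OF y, of t] t(1,2) by simp
  qed
  show ?thesis
    unfolding is_poiseuille_flow_def
  proof
    fix z assume "z \<in> closed_strip"
    then obtain x y where z: "z = (x, y)" "-1 \<le> y" "y \<le> 1" by (cases z) auto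
    show "u1 z = poiseuille \<Phi> (snd z) \<and> u2 z = 0"
    proof (cases "y \<in> I")
      case True
      then show ?thesis using zero'[of y x] by (simp add: z v1_def)
    next
      case False
      then have "y = 1 \<or> y = -1" using z by auto
      then show ?thesis using z u_boundary v1_closed(3,4) by (auto simp: v1_def)
    qed
  qed
qed

text \<open>As X1 = -Y2, the energy of X is part of \<open>H1_density\<close>. Fubini turns the
  Lebesgue integral over the cell into an integral of slices, and \<open>in_H1\<close> supplies the
  integrability for it.\<close>

lemma E2_le_H1_norm:
  assumes "in_H1 L u2"
  shows "E2 \<le> (H1_norm L u2)\<^sup>2"
proof -
  let ?A = "period_cell L"
  let ?f = "\<lambda>z. indicator ?A z * H1_density u2 z"
  have A: "?A = {0<..<T} \<times> I" by (simp add: period_cell_def T_def)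
  have int: "integrable lborel ?f"
    using assms by (simp add: in_H1_def set_integrable_def)
  have int2: "integrable (lborel \<Otimes>\<^sub>M lborel) (\<lambda>(x, y). ?f (x, y))"
    using int by (simp add: lborel_prod case_prod_beta')
  have hc: "continuous_on strip (H1_density u2)"
    unfolding H1_density_def[abs_def] X2_def[symmetric] Y2_def[symmetric] by (intro continuous_intros cs)
  have inner: "(\<integral>x. ?f (x, y) \<partial>lborel) = indicator I y * slice T (H1_density u2) y" for y
  proof (cases "y \<in> I")
    case True
    then have y': "-1 < y" "y < 1" by auto
    have "(\<integral>x. ?f (x, y) \<partial>lborel) = (\<integral>x. indicator {0<..<T} x * H1_density u2 (x, y) \<partial>lborel)"
      using True by (intro Bochner_Integration.integral_cong) (auto simp: A indicator_def)
    also have "\<dots> = integral {0<..<T} (\<lambda>x. H1_density u2 (x, y))"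
    proof -
      have "set_integrable lborel {0..T} (\<lambda>x. H1_density u2 (x, y))"
        by (rule borel_integrable_atLeastAtMost') (rule continuous_on_strip_line[OF hc y'])
      then have "set_integrable lborel {0<..<T} (\<lambda>x. H1_density u2 (x, y))"
        by (rule set_integrable_subset) auto
      from set_borel_integral_eq_integral(2)[OF this] show ?thesis
        by (simp add: set_lebesgue_integral_def)
    qed
    finally show ?thesis using True by (simp add: slice_def integral_open_interval_real)
  next
    case False
    then have "indicator ?A (x, y) = (0::real)" for x by (auto simp: A)
    then show ?thesis using False by simp
  qed
  have "integrable lborel (\<lambda>y. \<integral>x. ?f (x, y) \<partial>lborel)"
    using lborel_pair.integrable_snd[of "\<lambda>x y. ?f (x, y)"] int2 by simp
  then have si: "set_integrable lborel I (slice T (H1_density u2))"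
    unfolding inner by (simp add: set_integrable_def)
  have "integral\<^sup>L lborel ?f = (\<integral>y. (\<integral>x. ?f (x, y) \<partial>lborel) \<partial>lborel)"
    using lborel_pair.integral_snd[of "\<lambda>x y. ?f (x, y)"] int2 by (simp add: lborel_prod case_prod_beta')
  also have "\<dots> = integral I (slice T (H1_density u2))"
    unfolding inner using set_borel_integral_eq_integral(2)[OF si] by (simp add: set_lebesgue_integral_def)
  finally have eq: "set_lebesgue_integral lborel ?A (H1_density u2) = integral I (slice T (H1_density u2))"
    by (simp add: set_lebesgue_integral_def)
  have hi: "slice T (H1_density u2) integrable_on I" using set_borel_integral_eq_integral(1)[OF si] .
  have "E2 \<le> integral I (slice T (H1_density u2))"
    unfolding E2_def
  proof (rule integral_le[OF xi_facts(4) hi])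
    fix y assume y: "y \<in> I"
    then have y': "-1 < y" "y < 1" by auto
    show "xi y \<le> slice T (H1_density u2) y" unfolding xi_def
    proof (rule slice_mono[OF _ hc y'])
      fix x
      have "Y2 (x, y) = - X1 (x, y)" using u_eqs(3)[of "(x, y)"] y' by simp
      then show "(X1 (x, y))\<^sup>2 + (X2 (x, y))\<^sup>2 \<le> H1_density u2 (x, y)"
        by (simp add: H1_density_def X2_def[symmetric] Y2_def[symmetric])
    qed (intro continuous_intros cs)
  qed
  then have "E2 \<le> set_lebesgue_integral lborel ?A (H1_density u2)" using eq by simp
  then show ?thesis using totals(3) by (simp add: H1_norm_def)
qed

end

section \<open>Conclusion\<close>

text \<open>The powers of \<Phi> that occur are multiples of 1/120, so r = \<Phi> powr (1/120) makes
  the exponents integers: E <= r^4, D is of order r^144 * W and K of order r^180 * W.\<close>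

lemma high_flux_arith:
  fixes r T W E D K :: real
  assumes r: "41 \<le> r" and T: "0 < T" "T \<le> 1/3" and W: "0 \<le> W" "W \<le> E" and E: "E \<le> r^4"
    and D0: "0 \<le> D" and D: "\<And>\<kappa> \<delta>. 0 < \<kappa> \<Longrightarrow> 0 < \<delta> \<Longrightarrow> D \<le> 3/4 * r^120 * (\<kappa> * (T\<^sup>2 * W / \<delta> + 2 * \<delta>\<^sup>2 * D) + T * W / \<kappa>)"
    and K: "K = 4 * r^180 * W + 33 * (E * D)"
    and main: "3/8 * r^120 * W \<le> sqrt (6 * sqrt (E * K)) * sqrt (W * D) + sqrt (D / T + 2 * sqrt (D * K)) * sqrt (W * E)"
  shows "D = 0"
proof -
  have r0: "0 < r" using r by simp
  have rp: "r^m \<le> r^n" if "m \<le> n" for m n using r that by (intro power_increasing) auto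
  have D1: "D \<le> 5 * r^144 * (T * W)"
  proof -
    \<comment> \<open>\<kappa> and \<delta> are \<Phi> powr (-1/5) / 3 and \<Phi> powr (-2/5): both
      terms in \<open>W\<close> become of order r^144, and the 3 reduces the term in
      \<open>D\<close> to D / 2, which is absorbed.\<close>
    have "D \<le> 3/4 * r^120 * (1 / (3 * r^24) * (T\<^sup>2 * W / (1 / r^48) + 2 * (1 / r^48)\<^sup>2 * D) + T * W / (1 / (3 * r^24)))"
      using r0 by (intro D) auto
    also have "\<dots> = 1/4 * r^144 * (T\<^sup>2 * W) + D / 2 + 9/4 * r^144 * (T * W)"
      using r0 by (simp add: field_simps flip: power_add power_mult)
    finally have "D \<le> 1/2 * r^144 * (T\<^sup>2 * W) + 9/2 * r^144 * (T * W)" by simp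
    also have "1/2 * r^144 * (T\<^sup>2 * W) \<le> 1/2 * r^144 * (T * W)"
      using T W r0 by (intro mult_left_mono mult_right_mono) (auto simp: power2_eq_square)
    finally show ?thesis by (simp add: algebra_simps)
  qed
  \<comment> \<open>\<open>D1\<close> keeps its factor \<open>T\<close> in order to cancel the 1/T
    in \<open>DT\<close>; for the other estimates T <= 1/3 is inserted.\<close>
  have D2: "D \<le> 5/3 * r^144 * W"
  proof -
    have "5 * r^144 * (T * W) \<le> 5 * r^144 * (1/3 * W)" using T W r0 by (intro mult_left_mono mult_right_mono) auto
    also have "\<dots> = 5/3 * r^144 * W" by simp
    finally show ?thesis using D1 by (rule order_trans[rotated])
  qed
  show ?thesis
  proof (cases "W = 0")
    case True
    then show ?thesis using D2 D0 by simp
  next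
    case False
    then have Wp: "0 < W" using W by simp
    have E0: "0 \<le> E" using W by simp
    have K1: "K \<le> 64 * r^180 * W"
    proof -
      have "E * D \<le> r^4 * (5/3 * r^144 * W)" using E D2 E0 D0 r0 W by (intro mult_mono) auto
      also have "\<dots> = 5/3 * r^148 * W" by (simp flip: power_add)
      also have "\<dots> \<le> 5/3 * r^180 * W" using rp[of 148 180] W by (intro mult_right_mono mult_left_mono) auto
      finally have "E * D \<le> 5/3 * r^180 * W" .
      moreover have "0 \<le> r^180 * W" using W r0 by simp
      ultimately show ?thesis unfolding K mult.assoc by linarith
    qed
    have K0: "0 \<le> K" unfolding K using W r0 E0 D0 by simp
    have EK: "sqrt (E * K) \<le> 8 * r^94"
    proof (rule real_le_lsqrt)
      \<comment> \<open>W <= E turns the \<open>W\<close> in the bound for \<open>K\<close> into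
        another r^4.\<close>
      have "E * K \<le> r^4 * (64 * r^180 * r^4)"
        using E K1 W r0 K0 E0 by (intro mult_mono order_trans[OF K1] mult_left_mono) auto
      also have "\<dots> = 64 * (r^4 * r^180 * r^4)" by (simp only: mult_ac)
      also have "r^4 * r^180 * r^4 = r^188" by (simp only: power_add[symmetric]) simp
      also have "64 * r^188 = (8 * r^94)\<^sup>2" by (simp add: power_mult_distrib flip: power_mult)
      finally show "E * K \<le> (8 * r^94)\<^sup>2" .
    qed (use E0 K0 r0 in auto)
    have a: "sqrt (6 * sqrt (E * K)) * sqrt (W * D) \<le> 9 * r^119 * W"
    proof -
      have "sqrt (6 * sqrt (E * K)) * sqrt (W * D) = sqrt ((6 * sqrt (E * K)) * (W * D))" by (rule real_sqrt_mult[symmetric])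
      also have "\<dots> \<le> 9 * r^119 * W"
      proof (rule real_le_lsqrt)
        have "(6 * sqrt (E * K)) * (W * D) \<le> (6 * (8 * r^94)) * (W * (5/3 * r^144 * W))"
          using EK D2 W D0 E0 K0 r0 by (intro mult_mono mult_left_mono mult_nonneg_nonneg) auto
        also have "\<dots> = 80 * (r^94 * r^144) * W\<^sup>2" by (simp add: power2_eq_square)
        also have "\<dots> = 80 * r^238 * W\<^sup>2" by (simp flip: power_add)
        also have "\<dots> \<le> 81 * r^238 * W\<^sup>2" using r0 by (intro mult_right_mono) auto
        also have "\<dots> = (9 * r^119 * W)\<^sup>2" by (simp add: power_mult_distrib flip: power_mult)
        finally show "(6 * sqrt (E * K)) * (W * D) \<le> (9 * r^119 * W)\<^sup>2" .
      qed (use E0 K0 W D0 r0 in auto)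
      finally show ?thesis .
    qed
    have DK: "sqrt (D * K) \<le> 11 * r^162 * W"
    proof (rule real_le_lsqrt)
      have "D * K \<le> (5/3 * r^144 * W) * (64 * r^180 * W)" using D2 K1 D0 K0 r0 W by (intro mult_mono) auto
      also have "\<dots> = 320/3 * (r^144 * r^180) * W\<^sup>2" by (simp add: power2_eq_square)
      also have "\<dots> = 320/3 * r^324 * W\<^sup>2" by (simp flip: power_add)
      also have "\<dots> \<le> 121 * r^324 * W\<^sup>2" using r0 by (intro mult_right_mono) auto
      also have "\<dots> = (11 * r^162 * W)\<^sup>2" by (simp add: power_mult_distrib flip: power_mult)
      finally show "D * K \<le> (11 * r^162 * W)\<^sup>2" .
    qed (use D0 K0 W r0 in auto)
    have DT: "D / T \<le> 5 * r^162 * W"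
    proof -
      have "D / T \<le> 5 * r^144 * W" using D1 T by (simp add: divide_le_eq mult_ac)
      also have "\<dots> \<le> 5 * r^162 * W" using rp[of 144 162] W by (intro mult_right_mono) auto
      finally show ?thesis .
    qed
    have b: "sqrt (D / T + 2 * sqrt (D * K)) * sqrt (W * E) \<le> 6 * r^83 * W"
    proof -
      have "sqrt (D / T + 2 * sqrt (D * K)) * sqrt (W * E) = sqrt ((D / T + 2 * sqrt (D * K)) * (W * E))" by (rule real_sqrt_mult[symmetric])
      also have "\<dots> \<le> 6 * r^83 * W"
      proof (rule real_le_lsqrt)
        have "D / T + 2 * sqrt (D * K) \<le> 27 * r^162 * W" using DT DK unfolding mult.assoc by linarith
        then have "(D / T + 2 * sqrt (D * K)) * (W * E) \<le> (27 * r^162 * W) * (W * r^4)"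
          using E W E0 r0 by (intro mult_mono mult_left_mono) auto
        also have "\<dots> = 27 * (r^162 * r^4) * W\<^sup>2" by (simp add: power2_eq_square)
        also have "\<dots> = 27 * r^166 * W\<^sup>2" by (simp flip: power_add)
        also have "\<dots> \<le> 36 * r^166 * W\<^sup>2" using r0 by (intro mult_right_mono) auto
        also have "\<dots> = (6 * r^83 * W)\<^sup>2" by (simp add: power_mult_distrib flip: power_mult)
        finally show "(D / T + 2 * sqrt (D * K)) * (W * E) \<le> (6 * r^83 * W)\<^sup>2" .
      qed (use W r0 in auto)
      finally show ?thesis .
    qed
    have "6 * r^83 * W \<le> 6 * r^119 * W" using rp[of 83 119] W by (intro mult_right_mono) auto
    \<comment> \<open>The two contributions add up to 9 + 6 = 15, and 3/8 * r <= 15 means r <= 40;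
      hence the hypothesis with 41.\<close>
    then have "3/8 * r^120 * W \<le> 15 * r^119 * W" using main a b unfolding mult.assoc by linarith
    then have "3/8 * r^120 \<le> 15 * r^119" using Wp by (rule mult_right_le_imp_le)
    also have "r^120 = r * r^119" by (simp flip: power_Suc)
    finally have "(3/8 * r) * r^119 \<le> 15 * r^119" by simp
    then have "3/8 * r \<le> 15" by (rule mult_right_le_imp_le) (use r0 in simp)
    then show ?thesis using r by simp
  qed
qed

lemma (in ns_flow) dissipation_high_flux:
  assumes T3: "T \<le> 1/3" and P: "41 ^ 120 \<le> \<Phi>" and H: "H1_norm L u2 \<le> \<Phi> powr (1/60)" and in_H1: "in_H1 L u2"
  shows "D = 0"
proof -
  have P0: "0 < \<Phi>" by (rule less_le_trans[OF _ P]) simp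
  define r where "r = \<Phi> powr (1/120)"
  have r0: "0 < r" using P0 by (simp add: r_def)
  have rn: "r ^ n = \<Phi> powr (real n / 120)" for n
    using P0 by (simp add: r_def powr_realpow[symmetric] powr_powr)
  have r120: "r ^ 120 = \<Phi>" using rn[of 120] P0 by simp
  have "41 ^ 120 \<le> r ^ 120" using P r120 by simp
  then have r41: "41 \<le> r" by (subst (asm) power_mono_iff) (use r0 in simp_all)
  have s: "sqrt \<Phi> = r ^ 60" by (rule real_sqrt_unique) (use r0 r120 in \<open>simp_all flip: power_mult\<close>)
  have "E2 \<le> (H1_norm L u2)\<^sup>2" by (rule E2_le_H1_norm[OF in_H1])
  also have "\<dots> \<le> (\<Phi> powr (1/60))\<^sup>2"
  proof (rule power_mono[OF H])
    show "0 \<le> H1_norm L u2"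
      unfolding H1_norm_def set_lebesgue_integral_def H1_density_def
      by (intro real_sqrt_ge_zero Bochner_Integration.integral_nonneg) auto
  qed
  also have "\<Phi> powr (1/60) = r ^ 2" using rn[of 2] by simp
  also have "(r^2)\<^sup>2 = r ^ 4" by (simp flip: power_mult)
  finally have E: "E2 \<le> r ^ 4" .
  \<comment> \<open>T <= 1/3 makes the integral of \<open>alpha\<close> at most a third of
    \<open>weighted\<close>, so that at least half of the weighted term is left.\<close>
  have "3/8 * \<Phi> * weighted \<le> 3/4 * \<Phi> * (weighted - integral I alpha)"
  proof -
    have "T * weighted \<le> 1/3 * weighted" using T3 totals by (intro mult_right_mono) auto
    then have "weighted / 2 \<le> weighted - integral I alpha" using alpha_integral_le[OF T3] totals by simp
    then have "3/4 * \<Phi> * (weighted / 2) \<le> 3/4 * \<Phi> * (weighted - integral I alpha)" using P0 by (intro mult_left_mono) auto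
    then show ?thesis by simp
  qed
  also have "\<dots> \<le> \<bar>integral I (slice T N)\<bar>" unfolding momentum_identity(2) by simp
  also have "\<dots> \<le> sqrt (6 * sqrt (E2 * K)) * sqrt (weighted * D) + sqrt (D / T + 2 * sqrt (D * K)) * sqrt (weighted * E2)"
    by (rule nonlinear_bound[OF P0])
  finally have main: "3/8 * \<Phi> * weighted \<le> \<dots>" .
  have K: "K = 4 * r^180 * weighted + 33 * (E2 * D)"
    unfolding K_def s by (subst r120[symmetric]) (simp flip: power_add)
  show ?thesis
    by (rule high_flux_arith[OF r41 T T3 totals(1,2) E totals(5) _ K])
       (use dissipation_weighted_bound[OF T3] main r120 in simp_all)
qed

theorem theorem1p3:
  "(\<exists>\<epsilon>1>0. \<exists>L0>0. \<forall>\<Phi>\<ge>0. \<forall>L. 0 < L \<longrightarrow> L \<le> L0 \<longrightarrow>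
      (\<forall>u1 u2 p. NS0_solution L \<Phi> u1 u2 p \<longrightarrow> in_H1 L u2 \<longrightarrow> H1_norm L u2 \<le> \<epsilon>1 \<longrightarrow>
         is_poiseuille_flow \<Phi> u1 u2)) \<and>
   (\<exists>L0>0. \<exists>\<Phi>0>0. \<forall>L. 0 < L \<longrightarrow> L \<le> L0 \<longrightarrow> (\<forall>\<Phi>\<ge>\<Phi>0.
      \<forall>u1 u2 p. NS0_solution L \<Phi> u1 u2 p \<longrightarrow> in_H1 L u2 \<longrightarrow> H1_norm L u2 \<le> \<Phi> powr (1 / 60) \<longrightarrow>
         is_poiseuille_flow \<Phi> u1 u2))"
proof
  have high: "is_poiseuille_flow \<Phi> u1 u2"
    if "0 < L" "2 * L * pi \<le> 1/3" "41 ^ 120 \<le> \<Phi>" "NS0_solution L \<Phi> u1 u2 p" "in_H1 L u2" "H1_norm L u2 \<le> \<Phi> powr (1/60)"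
    for L \<Phi> u1 u2 p
  proof -
    have "0 \<le> \<Phi>" by (rule order_trans[OF _ that(3)]) simp
    then interpret ns_flow L \<Phi> u1 u2 p using that by unfold_locales
    show ?thesis by (rule poiseuille_if_no_dissipation[OF dissipation_high_flux]) (use that in \<open>simp_all add: T_def\<close>)
  qed
  show "\<exists>L0>0. \<exists>\<Phi>0>0. \<forall>L. 0 < L \<longrightarrow> L \<le> L0 \<longrightarrow> (\<forall>\<Phi>\<ge>\<Phi>0.
      \<forall>u1 u2 p. NS0_solution L \<Phi> u1 u2 p \<longrightarrow> in_H1 L u2 \<longrightarrow> H1_norm L u2 \<le> \<Phi> powr (1 / 60) \<longrightarrow>
         is_poiseuille_flow \<Phi> u1 u2)"
  \<comment> \<open>1 / (6 * pi) expresses 2 * L * pi <= 1/3, and 41 ^ 120 corresponds to r >=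
    41.\<close>
  proof (rule exI[of _ "1 / (6 * pi)"], rule conjI, simp, rule exI[of _ "41 ^ 120"], rule conjI, simp, intro allI impI)
    fix L \<Phi> :: real and u1 u2 p
    assume "0 < L" "L \<le> 1 / (6 * pi)" "41 ^ 120 \<le> \<Phi>" "NS0_solution L \<Phi> u1 u2 p" "in_H1 L u2" "H1_norm L u2 \<le> \<Phi> powr (1 / 60)"
    then show "is_poiseuille_flow \<Phi> u1 u2" by (intro high[of L \<Phi> u1 u2 p]) (simp_all add: field_simps)
  qed
  text \<open>For small \<open>\<Phi> * L\<^sup>2\<close> the energy estimate alone forces \<open>u = U\<close>, so (a) reduces to (b).\<close>
  show "\<exists>\<epsilon>1>0. \<exists>L0>0. \<forall>\<Phi>\<ge>0. \<forall>L. 0 < L \<longrightarrow> L \<le> L0 \<longrightarrow>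
      (\<forall>u1 u2 p. NS0_solution L \<Phi> u1 u2 p \<longrightarrow> in_H1 L u2 \<longrightarrow> H1_norm L u2 \<le> \<epsilon>1 \<longrightarrow>
         is_poiseuille_flow \<Phi> u1 u2)"
  \<comment> \<open>For \<Phi> below 41 ^ 120 this threshold for \<open>L\<close> gives \<Phi> * T^2
    <= (T * 41 ^ 60)^2 <= 1, whatever the norm of \<open>u2\<close>; for larger \<Phi> the bound 1
    on the norm is at most \<Phi> powr (1/60).\<close>
  proof (rule exI[of _ 1], rule conjI, simp, rule exI[of _ "1 / (6 * pi * 41 ^ 60)"], rule conjI, simp, intro allI impI)
    fix L \<Phi> :: real and u1 u2 p
    assume Phi0: "0 \<le> \<Phi>" and lim: "0 < L" "L \<le> 1 / (6 * pi * 41 ^ 60)"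
      and asm: "NS0_solution L \<Phi> u1 u2 p" "in_H1 L u2" "H1_norm L u2 \<le> 1"
    interpret ns_flow L \<Phi> u1 u2 p using asm Phi0 lim by unfold_locales
    have "L * (6 * pi * 41 ^ 60) \<le> 1 / (6 * pi * 41 ^ 60) * (6 * pi * 41 ^ 60)" by (intro mult_right_mono lim) simp
    then have T1: "3 * T * 41 ^ 60 \<le> 1" by (simp add: T_def mult_ac)
    show "is_poiseuille_flow \<Phi> u1 u2"
    proof (cases "41 ^ 120 \<le> \<Phi>")
      case True
      have "1 \<le> \<Phi>" by (rule order_trans[OF one_le_power True]) simp
      then have "1 \<le> \<Phi> powr (1/60)" by (intro ge_one_powr_ge_zero) auto
      then have "H1_norm L u2 \<le> \<Phi> powr (1/60)" using asm(3) by linarith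
      moreover have "3 * T * 1 \<le> 3 * T * 41 ^ 60" using T by (intro mult_left_mono one_le_power) simp_all
      then have "2 * L * pi \<le> 1/3" using T1 by (simp add: T_def)
      ultimately show ?thesis using True asm lim by (intro high)
    next
      case False
      have "\<Phi> * T\<^sup>2 \<le> 41 ^ 120 * T\<^sup>2" using False by (intro mult_right_mono) auto
      also have "\<dots> = (T * 41 ^ 60)\<^sup>2" by (simp only: power_mult_distrib power_mult[symmetric]) simp
      also have "\<dots> \<le> 1\<^sup>2" using T1 T by (intro power_mono) auto
      finally show ?thesis by (intro poiseuille_if_no_dissipation dissipation_small_flux) simp
    qed
  qed
qed

end
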